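(* Let $\Omega\subset\mathbb{R}^2$ be a planar arithmetic lattice. Then $\zeta_{\mathrm{WR}}(\Omega,s)$ has abscissa of convergence with a real pole of order $2$ at $s=1$; that is, the series $\zeta_{\mathrm{WR}}(\Omega,s)$ converges absolutely for $\mathrm{Re}(s)>1$, and for real $s$ the limit $\lim_{s\to 1^+}(s-1)^2\,\zeta_{\mathrm{WR}}(\Omega,s)$ exists and is nonzero. Moreover, $$\#\{\Lambda\subseteq\Omega : \Lambda \text{ a well-rounded sublattice with } |\Omega:\Lambda|\le N\} = O(N\log N)\quad\text{as } N\to\infty.$$
   Context: A lattice $\Lambda=A\mathbb{Z}^2\subset\mathbb{R}^2$ of full rank (with $A$ an invertible real $2\times 2$ basis matrix) is arithmetic if the entries of $A^tA$ span a $1$-dimensional $\mathbb{Q}$-vector subspace of $\mathbb{R}$ (independent of the basis). The minimum of $\Lambda$ is $|\Lambda|=\min\{\|x\|^2: x\in\Lambda\setminus\{0\}\}$ (Euclidean norm), the minimal vectors are those $x\in\Lambda$ with $\|x\|^2=|\Lambda|$, and $\Lambda$ is well-rounded (WR) if its minimal vectors contain a basis of $\Lambda$. For a planar lattice $\Omega$, the zeta-function of WR sublattices is $\zeta_{\mathrm{WR}}(\Omega,s)=\sum_{\Lambda\subseteq\Omega\ \mathrm{WR}}|\Omega:\Lambda|^{-s}$, the sum over all full-rank well-rounded sublattices $\Lambda$ of $\Omega$. Here "$f(N)=O(N\log N)$" means that $f(N)$ is asymptotically bounded both from above and from below by positive constant multiples of $N\log N$. *)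

theory Defs
  imports "HOL-Analysis.Analysis" "HOL-Library.Landau_Symbols"
begin

definition lattice_of :: "real^2^2 \<Rightarrow> (real^2) set" where
  "lattice_of A = (\<lambda>z. A *v z) ` {z. \<forall>i. z $ i \<in> \<int>}"

definition planar_lattice :: "(real^2) set \<Rightarrow> bool" where
  "planar_lattice L \<longleftrightarrow> (\<exists>A. invertible A \<and> L = lattice_of A)"

definition rat_scale :: "rat \<Rightarrow> real \<Rightarrow> real" where
  "rat_scale q x = of_rat q * x"

lemma vector_space_rat_scale: "vector_space rat_scale"
  by unfold_locales (simp_all add: rat_scale_def algebra_simps of_rat_add of_rat_mult)

abbreviation rat_dim :: "real set \<Rightarrow> nat" where
  "rat_dim \<equiv> vector_space.dim rat_scale"

text \<open>
  The dimension of a set is that of its linear span. The property below does not depend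
  on the chosen basis matrix, so an existential quantifier over bases suffices.
\<close>

definition arithmetic_lattice :: "(real^2) set \<Rightarrow> bool" where
  "arithmetic_lattice L \<longleftrightarrow>
     (\<exists>A. invertible A \<and> L = lattice_of A \<and>
          rat_dim {(transpose A ** A) $ i $ j | i j. True} = 1)"

definition lattice_min :: "(real^2) set \<Rightarrow> real" where
  "lattice_min L = (LEAST m. m \<in> (\<lambda>x. (norm x)\<^sup>2) ` (L - {0}))"

definition minimal_vectors :: "(real^2) set \<Rightarrow> (real^2) set" where
  "minimal_vectors L = {x \<in> L. (norm x)\<^sup>2 = lattice_min L}"

definition well_rounded :: "(real^2) set \<Rightarrow> bool" where
  "well_rounded L \<longleftrightarrow>
     (\<exists>A. invertible A \<and> L = lattice_of A \<and> (\<forall>j. column j A \<in> minimal_vectors L))"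

definition wr_sublattices :: "(real^2) set \<Rightarrow> (real^2) set set" where
  "wr_sublattices M = {L. planar_lattice L \<and> L \<subseteq> M \<and> well_rounded L}"

definition lattice_index :: "(real^2) set \<Rightarrow> (real^2) set \<Rightarrow> nat" where
  "lattice_index M L = card ((\<lambda>x. (\<lambda>y. x + y) ` L) ` M)"

definition zeta_WR :: "(real^2) set \<Rightarrow> complex \<Rightarrow> complex" where
  "zeta_WR M s = (\<Sum>\<^sub>\<infinity>L\<in>wr_sublattices M. of_nat (lattice_index M L) powr (- s))"

end

theory Submission
  imports Defs "HOL-Real_Asymp.Real_Asymp" "HOL-Number_Theory.Cong"
begin

text \<open>
  After scaling, the Gram matrix of an arithmetic lattice is integral, so the lattice is \<open>\<int>\<^sup>2\<close> with a
  positive definite integral form \<open>Q\<close> of determinant \<open>D\<close>. If \<open>x, y\<close> are minimal vectors spanning a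
  well-rounded sublattice, then \<open>u = x + y\<close> and \<open>v = x - y\<close> are orthogonal and
  \<open>1/3 \<le> Q u / Q v \<le> 3\<close>. Away from the hexagonal sublattices, where equality holds and which contribute
  only a simple pole, the sublattice determines \<open>(u, v)\<close> up to signs and order. A primitive \<open>z\<close> fixes the
  directions of \<open>u = \<alpha> z\<close> and \<open>v = \<beta> z'\<close>, the index is proportional to \<open>\<alpha> \<beta> Q z\<close>, and the admissible
  \<open>(\<alpha>, \<beta>)\<close> are the lattice points of a sector subject to parity conditions which, like the constant of
  proportionality, depend only on \<open>z\<close> modulo \<open>2 D\<close>. So the zeta function is a finite sum of products of a
  series over the primitive vectors \<open>z\<close> of a residue class and a series over the pairs \<open>(\<alpha>, \<beta>)\<close>, up to
  elementary factors. Each of these series has a simple pole at 1, because its terms are counted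
  by lattice points in dilates of a fixed planar region. The bounds of order \<open>N log N\<close> come from
  summing the linear counts of the pairs \<open>(\<alpha>, \<beta>)\<close> over \<open>z\<close>.
\<close>

section \<open>Lattice points in dilated regions\<close>


text \<open>The constant 3 comes from minimality: if \<open>Q x = Q y = n\<close>, the diagonals
  \<open>x + y\<close> and \<open>x - y\<close> have norms \<open>2 * n + 2 * B x y\<close> and
  \<open>2 * n - 2 * B x y\<close>, and minimality forces
  \<open>2 * \<bar>B x y\<bar> \<le> n\<close>. The diagonals replace the basis because they are
  orthogonal: once the direction of \<open>u\<close> is known, \<open>v\<close> is confined to a
  line, and only two integers remain free. This separation of direction from size makes the series
  factor, and each factor supplies one of the two orders of the pole. The limit needs an exact
  residue for the primitive vectors of every class. Coprimality does not describe a planar region,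
  so these residues have to be extracted from those of all vectors. The limit involves only real
  \<open>s > 1\<close>, so summation by parts takes the place of analytic continuation. Such an
  Abelian argument goes from counts to series and cannot be reversed without a Tauberian theorem, so
  the counting statement is proved separately; there orders of magnitude suffice.\<close>

lemma residue_floor_bound:
  fixes x t :: real and m c :: int
  assumes "t > 0" "m > 0"
  shows "\<bar>of_int (m * \<lfloor>t * x / m\<rfloor> + c) / t - x\<bar> \<le> (of_int m + \<bar>of_int c\<bar>) / t"
proof -
  define k where "k = \<lfloor>t * x / m\<rfloor>"
  have "of_int k \<le> t * x / m" "t * x / m < of_int k + 1"
    unfolding k_def by linarith+
  hence "of_int m * of_int k \<le> t * x" "t * x < of_int m * of_int k + of_int m"
    using assms by (simp_all add: field_simps)
  hence "\<bar>of_int m * of_int k + of_int c - t * x\<bar> \<le> of_int m + \<bar>of_int c :: real\<bar>"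
    by linarith
  hence "\<bar>of_int m * of_int k + of_int c - t * x\<bar> / t \<le> (of_int m + \<bar>of_int c\<bar>) / t"
    using assms by (intro divide_right_mono) auto
  moreover have "\<bar>of_int m * of_int k + of_int c - t * x\<bar> / t = \<bar>(of_int m * of_int k + of_int c - t * x) / t\<bar>"
    using assms by simp
  moreover have "(of_int m * of_int k + of_int c - t * x) / t = of_int (m * k + c) / t - x"
    using assms by (simp add: field_simps)
  ultimately show ?thesis unfolding k_def by simp
qed

definition residue_points :: "int \<Rightarrow> int \<times> int \<Rightarrow> (int \<times> int) set" where
  "residue_points m c = {z. fst z mod m = fst c mod m \<and> snd z mod m = snd c mod m}"

definition scaled_point :: "real \<Rightarrow> int \<times> int \<Rightarrow> real \<times> real" where
  "scaled_point t z = (of_int (fst z) / t, of_int (snd z) / t)"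

lemma finite_scaled_points:
  assumes "bounded S" "t > 0"
  shows "finite {z. scaled_point t z \<in> S}"
proof -
  obtain R where R: "\<And>x. x \<in> S \<Longrightarrow> norm x \<le> R"
    using assms(1) by (auto simp: bounded_iff)
  have "{z. scaled_point t z \<in> S} \<subseteq> {-\<lceil>R*t\<rceil>..\<lceil>R*t\<rceil>} \<times> {-\<lceil>R*t\<rceil>..\<lceil>R*t\<rceil>}"
  proof safe
    fix i j assume "scaled_point t (i, j) \<in> S"
    hence n: "norm (of_int i / t, of_int j / t) \<le> R" using R by (auto simp: scaled_point_def)
    have "\<bar>of_int i / t\<bar> \<le> R" "\<bar>of_int j / t\<bar> \<le> R"
      using n norm_fst_le[of "of_int i / t" "of_int j / t"] norm_snd_le[of "of_int j / t" "of_int i / t"]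
      by auto
    hence "\<bar>of_int i\<bar> \<le> R * t" "\<bar>of_int j\<bar> \<le> R * t" using assms(2) by (auto simp: field_simps)
    thus "i \<in> {-\<lceil>R*t\<rceil>..\<lceil>R*t\<rceil>}" "j \<in> {-\<lceil>R*t\<rceil>..\<lceil>R*t\<rceil>}"
      by (simp; linarith)+
  qed
  thus ?thesis by (rule finite_subset) auto
qed

lemma measure_half_open_box:
  assumes "a \<le> b" "c \<le> d"
  shows "{a..<b} \<times> {c..<d::real} \<in> sets lebesgue" "emeasure lebesgue ({a..<b::real} \<times> {c..<d::real}) = ennreal ((b - a) * (d - c))"
proof -
  have B: "{a..<b} \<times> {c..<d} \<in> sets (borel :: (real \<times> real) measure)"
    by (intro borel_Times) auto
  show "{a..<b} \<times> {c..<d::real} \<in> sets lebesgue" using B by auto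
  have "emeasure lebesgue ({a..<b} \<times> {c..<d}) = emeasure (lborel \<Otimes>\<^sub>M lborel) ({a..<b} \<times> {c..<d})"
    using B by (simp add: lborel_prod)
  also have "\<dots> = ennreal (b - a) * ennreal (d - c)"
    using assms by (subst lborel.emeasure_pair_measure_Times) auto
  also have "\<dots> = ennreal ((b - a) * (d - c))" using assms by (simp add: ennreal_mult)
  finally show "emeasure lebesgue ({a..<b} \<times> {c..<d}) = ennreal ((b - a) * (d - c))" .
qed

text \<open>
  The normalised count is the integral of the indicator of \<open>S\<close> evaluated at the
  grid point below the argument; these step functions converge to the indicator off the frontier.
\<close>

lemma lattice_point_density:
  fixes S :: "(real \<times> real) set"
  assumes S: "bounded S" "negligible (frontier S)" and m: "m > 0"
  shows "(\<lambda>n. real (card {z \<in> residue_points m c. scaled_point (sqrt (real n)) z \<in> S}) / real n)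
           \<longlonglongrightarrow> measure lebesgue S / (of_int m)\<^sup>2"
proof -
  obtain R where R: "\<And>x. x \<in> S \<Longrightarrow> norm x \<le> R"
    using S(1) by (auto simp: bounded_iff)
  obtain c1 c2 where c: "c = (c1, c2)" by (cases c)
  define h where "h = (\<lambda>n (x,y). (of_int (m * \<lfloor>sqrt (real n) * x / m\<rfloor> + c1) / sqrt (real n),
                                of_int (m * \<lfloor>sqrt (real n) * y / m\<rfloor> + c2) / sqrt (real n)))"
  define g where "g = (\<lambda>n z. indicator S (h n z) :: real)"
  define F where "F = (\<lambda>n. {z \<in> residue_points m c. scaled_point (sqrt (real n)) z \<in> S})"
  \<comment> \<open>The cell of a point \<open>p\<close> of the residue class consists of the
    arguments that \<open>h n\<close> sends to the scaled \<open>p\<close>. The shifts by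
    \<open>c1\<close> and \<open>c2\<close> make these squares of side \<open>m / sqrt n\<close>
    tile the plane.\<close>
  define cell where "cell = (\<lambda>n (i::int,j::int).
     {of_int (i - c1) / sqrt (real n)..<of_int (i - c1 + m) / sqrt (real n)} \<times> {of_int (j - c2) / sqrt (real n)..<of_int (j - c2 + m) / sqrt (real n)})"
  have finF: "finite (F n)" if "n > 0" for n
    by (rule finite_subset[OF _ finite_scaled_points[OF S(1), of "sqrt (real n)"]]) (use that in \<open>auto simp: F_def\<close>)
  have gsum: "g n z = (\<Sum>p\<in>F n. indicator (cell n p) z)" if n: "n > 0" for n z
  proof -
    obtain x y where z: "z = (x, y)" by (cases z)
    define t where "t = sqrt (real n)"
    have t: "t > 0" using n by (simp add: t_def)
    define k l where "k = \<lfloor>t * x / m\<rfloor>" and "l = \<lfloor>t * y / m\<rfloor>"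
    define p where "p = (m * k + c1, m * l + c2)"
    have pr: "p \<in> residue_points m c" by (simp add: p_def residue_points_def c)
    have hp: "h n z = scaled_point t p" by (simp add: h_def z t_def p_def k_def l_def scaled_point_def)
    have *: "x \<in> {of_int (i - c1) / t..<of_int (i - c1 + m) / t} \<longleftrightarrow> i = m * \<lfloor>t * x / m\<rfloor> + c1"
      if "i mod m = c1 mod m" for i x c1
    proof -
      have "m dvd i - c1" using that by (simp add: mod_eq_dvd_iff)
      then obtain q where "i - c1 = m * q" by (elim dvdE)
      hence q: "i = m * q + c1" by simp
      have "x \<in> {of_int (i - c1) / t..<of_int (i - c1 + m) / t} \<longleftrightarrow> of_int q \<le> t * x / m \<and> t * x / m < of_int q + 1"
        using t m by (auto simp: q field_simps)
      also have "\<dots> \<longleftrightarrow> q = \<lfloor>t * x / m\<rfloor>" by linarith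
      finally show ?thesis using m by (auto simp: q)
    qed
    have cell: "z \<in> cell n r \<longleftrightarrow> r = p" if "r \<in> residue_points m c" for r
      using that *[of "fst r" c1 x] *[of "snd r" c2 y]
      by (cases r) (auto simp: residue_points_def c cell_def z p_def k_def l_def t_def[symmetric])
    have "(\<Sum>r\<in>F n. indicator (cell n r) z) = (\<Sum>r\<in>F n. if r = p then 1 else (0::real))"
      by (intro sum.cong) (auto simp: F_def indicator_def cell)
    also have "\<dots> = (if p \<in> F n then 1 else 0)" using finF[OF n] by simp
    also have "\<dots> = g n z" using pr by (auto simp: g_def hp F_def t_def)
    finally show ?thesis by simp
  qed
  have cellm: "cell n p \<in> sets lebesgue" "emeasure lebesgue (cell n p) = ennreal ((of_int m)\<^sup>2 / real n)"
    if "n > 0" for n p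
  proof -
    obtain i j where p: "p = (i,j)" by (cases p)
    have le: "of_int (i - c1) / sqrt (real n) \<le> of_int (i - c1 + m) / sqrt (real n)"
             "of_int (j - c2) / sqrt (real n) \<le> of_int (j - c2 + m) / sqrt (real n)"
      using m that by (intro divide_right_mono; simp)+
    have d: "of_int (i - c1 + m) / sqrt (real n) - of_int (i - c1) / sqrt (real n) = of_int m / sqrt (real n)" for i c1
      by (simp add: diff_divide_distrib add_divide_distrib)
    show "cell n p \<in> sets lebesgue" using measure_half_open_box(1)[OF le] by (simp add: cell_def p)
    show "emeasure lebesgue (cell n p) = ennreal ((of_int m)\<^sup>2 / real n)"
      using measure_half_open_box(2)[OF le] unfolding cell_def p split_conv d
      by (simp add: power2_eq_square)
  qed
  have gint: "integral\<^sup>L lebesgue (g n) = real (card (F n)) * (of_int m)\<^sup>2 / real n" if n: "n > 0" for n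
  proof -
    have "integral\<^sup>L lebesgue (g n) = integral\<^sup>L lebesgue (\<lambda>z. \<Sum>p\<in>F n. indicator (cell n p) z)"
      using gsum[OF n] by presburger
    also have "\<dots> = (\<Sum>p\<in>F n. integral\<^sup>L lebesgue (indicator (cell n p)))"
      using cellm[OF n] by (intro Bochner_Integration.integral_sum) (simp add: integrable_indicator_iff)
    also have "\<dots> = (\<Sum>p\<in>F n. (of_int m)\<^sup>2 / real n)"
      using cellm[OF n] by (intro sum.cong) (auto simp: measure_def)
    finally show ?thesis by simp
  qed
  have gmeas: "g n \<in> borel_measurable lebesgue" if "n > 0" for n
  proof -
    have "(\<lambda>z. \<Sum>p\<in>F n. indicator (cell n p) z :: real) \<in> borel_measurable lebesgue"
      using cellm[OF that] by (intro borel_measurable_sum borel_measurable_indicator) auto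
    moreover have "g n = (\<lambda>z. \<Sum>p\<in>F n. indicator (cell n p) z)" using gsum[OF that] by blast
    ultimately show ?thesis by simp
  qed
  have Sm: "S \<in> lmeasurable" by (rule measurable_Jordan[OF S])
  \<comment> \<open>Half the side of a box containing the support of every \<open>g (Suc n)\<close>:
    \<open>h\<close> moves each coordinate by at most \<open>m + \<bar>c1\<bar>\<close> or
    \<open>m + \<bar>c2\<bar>\<close>, since \<open>sqrt (Suc n) \<ge> 1\<close>.\<close>
  define X where "X = R + of_int m + \<bar>of_int c1\<bar> + \<bar>of_int c2\<bar>"
  have hb: "\<bar>fst (h n z) - fst z\<bar> \<le> (of_int m + \<bar>of_int c1\<bar>) / sqrt (real n)"
           "\<bar>snd (h n z) - snd z\<bar> \<le> (of_int m + \<bar>of_int c2\<bar>) / sqrt (real n)" if "n > 0" for n z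
    using residue_floor_bound[of "sqrt (real n)" m "fst z" c1] residue_floor_bound[of "sqrt (real n)" m "snd z" c2] that m
    by (simp_all add: h_def case_prod_beta)
  have lim: "AE z in lebesgue. (\<lambda>n. g (Suc n) z) \<longlonglongrightarrow> indicator S z"
  proof -
    have "AE z in lebesgue. z \<notin> frontier S"
      using S(2) by (intro AE_not_in) (simp add: negligible_iff_null_sets)
    thus ?thesis
    proof eventually_elim
      case (elim z)
      have z0: "(\<lambda>n. (of_int m + \<bar>of_int c\<bar>) / sqrt (real (Suc n))) \<longlonglongrightarrow> 0" for c :: int
        by real_asymp
      have "(\<lambda>n. fst (h (Suc n) z)) \<longlonglongrightarrow> fst z"
        by (rule LIM_zero_cancel, rule Lim_null_comparison[OF _ z0[of c1]]) (use hb in \<open>auto simp del: of_nat_Suc\<close>)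
      moreover have "(\<lambda>n. snd (h (Suc n) z)) \<longlonglongrightarrow> snd z"
        by (rule LIM_zero_cancel, rule Lim_null_comparison[OF _ z0[of c2]]) (use hb in \<open>auto simp del: of_nat_Suc\<close>)
      ultimately have hz: "(\<lambda>n. h (Suc n) z) \<longlonglongrightarrow> z"
        using tendsto_Pair by fastforce
      consider "z \<in> interior S" | "z \<in> - closure S" using elim by (auto simp: frontier_def)
      hence "eventually (\<lambda>n. g (Suc n) z = indicator S z) sequentially"
      proof cases
        case 1
        have "eventually (\<lambda>n. h (Suc n) z \<in> interior S) sequentially"
          using topological_tendstoD[OF hz open_interior 1] .
        thus ?thesis by eventually_elim (use 1 interior_subset in \<open>fastforce simp: g_def indicator_def\<close>)
      next
        case 2
        have "eventually (\<lambda>n. h (Suc n) z \<in> - closure S) sequentially"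
          using topological_tendstoD[OF hz open_Compl[OF closed_closure] 2] .
        thus ?thesis by eventually_elim (use 2 closure_subset in \<open>fastforce simp: g_def indicator_def\<close>)
      qed
      thus ?case by (rule tendsto_eventually)
    qed
  qed
  have bnd: "norm (g (Suc n) z) \<le> indicator (cbox (-X,-X) (X,X)) z" for n z
  proof (cases "h (Suc n) z \<in> S")
    case True
    hence "norm (h (Suc n) z) \<le> R" by (rule R)
    hence r: "\<bar>fst (h (Suc n) z)\<bar> \<le> R" "\<bar>snd (h (Suc n) z)\<bar> \<le> R"
      using norm_fst_le[of "fst (h (Suc n) z)" "snd (h (Suc n) z)"] norm_snd_le[of "snd (h (Suc n) z)" "fst (h (Suc n) z)"]
      by auto
    have k: "(of_int m + \<bar>of_int c\<bar>) / sqrt (real (Suc n)) \<le> of_int m + \<bar>of_int c :: real\<bar>" for c :: int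
      using m divide_left_mono[of 1 "sqrt (real (Suc n))" "of_int m + \<bar>of_int c :: real\<bar>"] by simp
    have "\<bar>fst z\<bar> \<le> X" "\<bar>snd z\<bar> \<le> X"
      using hb[of "Suc n" z] k[of c1] k[of c2] r unfolding X_def by linarith+
    hence "z \<in> cbox (-X,-X) (X,X)" by (cases z) (auto simp: cbox_Pair_eq)
    thus ?thesis by (simp add: g_def indicator_def)
  qed (simp add: g_def)
  have "(\<lambda>n. integral\<^sup>L lebesgue (g (Suc n))) \<longlonglongrightarrow> integral\<^sup>L lebesgue (indicator S :: _ \<Rightarrow> real)"
  proof (rule integral_dominated_convergence[where w = "indicator (cbox (-X,-X) (X,X))"])
    show "indicator S \<in> borel_measurable lebesgue" using Sm by (intro borel_measurable_indicator) auto
    show "g (Suc n) \<in> borel_measurable lebesgue" for n by (rule gmeas) simp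
    show "integrable lebesgue (indicator (cbox (- X, - X) (X, X)) :: _ \<Rightarrow> real)"
      by (subst integrable_indicator_iff) (auto intro: emeasure_lborel_cbox_finite[unfolded infinity_ennreal_def])
    show "AE z in lebesgue. (\<lambda>n. g (Suc n) z) \<longlonglongrightarrow> indicator S z" by (rule lim)
    show "AE x in lebesgue. norm (g (Suc n) x) \<le> indicat_real (cbox (- X, - X) (X, X)) x" for n
      using bnd by simp
  qed
  moreover have "integral\<^sup>L lebesgue (indicator S :: _ \<Rightarrow> real) = measure lebesgue S" by simp
  ultimately have "(\<lambda>n. real (card (F (Suc n))) * (of_int m)\<^sup>2 / real (Suc n)) \<longlonglongrightarrow> measure lebesgue S"
    using gint by (simp del: of_nat_Suc)
  hence "(\<lambda>n. real (card (F (Suc n))) * (of_int m)\<^sup>2 / real (Suc n) / (of_int m)\<^sup>2) \<longlonglongrightarrow> measure lebesgue S / (of_int m)\<^sup>2"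
    using m by (intro tendsto_divide tendsto_const) auto
  hence "(\<lambda>n. real (card (F (Suc n))) / real (Suc n)) \<longlonglongrightarrow> measure lebesgue S / (of_int m)\<^sup>2"
    using m by (simp del: of_nat_Suc)
  from LIMSEQ_imp_Suc[of "\<lambda>n. real (card (F n)) / real n", OF this] show ?thesis by (simp only: F_def)
qed

section \<open>Dirichlet series and counting functions\<close>


text \<open>The derivative of \<open>z powr (-a)\<close> is monotone, so the mean value theorem
  bounds the difference by its values at the two ends.\<close>

lemma powr_neg_diff_bounds:
  fixes x a :: real
  assumes "x > 0" "a > 0"
  shows "a * (x + 1) powr (-a - 1) \<le> x powr (-a) - (x + 1) powr (-a)"
    and "x powr (-a) - (x + 1) powr (-a) \<le> a * x powr (-a - 1)"
proof -
  have "\<exists>z>x. z < x + 1 \<and> (x + 1) powr (-a) - x powr (-a) = (x + 1 - x) * (-a * z powr (-a - 1))"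
    by (rule MVT2) (use assms in \<open>auto intro!: derivative_eq_intros simp: field_simps\<close>)
  then obtain z where z: "z > x" "z < x + 1" "x powr (-a) - (x + 1) powr (-a) = a * z powr (-a - 1)"
    by auto
  have "(x + 1) powr (-a - 1) \<le> z powr (-a - 1)" "z powr (-a - 1) \<le> x powr (-a - 1)"
    using z assms by (intro powr_mono2'; simp)+
  thus "a * (x + 1) powr (-a - 1) \<le> x powr (-a) - (x + 1) powr (-a)"
       "x powr (-a) - (x + 1) powr (-a) \<le> a * x powr (-a - 1)"
    using z(3) assms by auto
qed

lemma summable_powr_neg_Suc:
  assumes "s > (1::real)"
  shows "summable (\<lambda>k. real (Suc k) powr -s)"
  using assms by (subst summable_Suc_iff[of "\<lambda>k. real k powr -s"]) (simp add: summable_real_powr_iff)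

text \<open>Comparison with the telescoping series of \<open>k powr (1 - s)\<close>, a discrete
  integral test. The two bounds squeeze \<open>s - 1\<close> times the zeta series to 1.\<close>

lemma zeta_pole_bounds:
  fixes s :: real
  assumes s: "s > 1"
  shows "1 \<le> (s - 1) * (\<Sum>k. real (Suc k) powr -s)" "(s - 1) * (\<Sum>k. real (Suc k) powr -s) \<le> s"
proof -
  define f where "f = (\<lambda>k. real (Suc k) powr (1 - s))"
  have "f \<longlonglongrightarrow> 0" unfolding f_def using s by real_asymp
  from telescope_sums'[OF this] have fs: "(\<lambda>k. f k - f (Suc k)) sums 1" by (simp add: f_def)
  have sm: "summable (\<lambda>k. real (Suc k) powr -s)" by (rule summable_powr_neg_Suc[OF s])
  have b: "(s - 1) * real (Suc (Suc k)) powr -s \<le> f k - f (Suc k)" "f k - f (Suc k) \<le> (s - 1) * real (Suc k) powr -s" for k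
    using powr_neg_diff_bounds[of "real (Suc k)" "s - 1"] s by (simp_all add: f_def add_ac)
  have "1 \<le> (\<Sum>k. (s - 1) * real (Suc k) powr -s)"
    using sums_le[OF b(2) fs summable_sums[OF summable_mult[OF sm]]] by simp
  thus "1 \<le> (s - 1) * (\<Sum>k. real (Suc k) powr -s)"
    using suminf_mult[OF sm, of "s - 1"] by simp
  have sm2: "summable (\<lambda>k. real (Suc (Suc k)) powr -s)"
    using sm by (subst summable_Suc_iff)
  have "(\<Sum>k. (s - 1) * real (Suc (Suc k)) powr -s) \<le> 1"
    using sums_le[OF b(1) summable_sums[OF summable_mult[OF sm2]] fs] by simp
  moreover have "(\<Sum>k. real (Suc k) powr -s) = (\<Sum>k. real (Suc (Suc k)) powr -s) + 1"
    using suminf_split_head[OF sm] by simp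
  ultimately show "(s - 1) * (\<Sum>k. real (Suc k) powr -s) \<le> s"
    using suminf_mult[OF sm2, of "s - 1"] by (simp add: algebra_simps)
qed

text \<open>The weights of Abel summation; the shift by \<open>Suc\<close> keeps the base
  positive.\<close>

definition powr_step :: "real \<Rightarrow> nat \<Rightarrow> real" where
  "powr_step s k = real (Suc k) powr -s - real (Suc (Suc k)) powr -s"

lemma powr_step_bounds:
  assumes "s > 1"
  shows "0 \<le> powr_step s k" "powr_step s k \<le> 1" "real (Suc k) * powr_step s k \<le> s * real (Suc k) powr -s"
proof -
  have "0 \<le> s * (real (Suc k) + 1) powr (-s - 1)" using assms by simp
  also have "\<dots> \<le> powr_step s k"
    using powr_neg_diff_bounds(1)[of "real (Suc k)" s] assms by (simp add: powr_step_def add_ac)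
  finally show "0 \<le> powr_step s k" .
  have "real (Suc k) powr -s \<le> 1" using assms powr_mono2'[of "-s" 1 "real (Suc k)"] by simp
  moreover have "0 \<le> real (Suc (Suc k)) powr -s" by simp
  ultimately show "powr_step s k \<le> 1" unfolding powr_step_def by linarith
  have "powr_step s k \<le> s * real (Suc k) powr (-s - 1)"
    using powr_neg_diff_bounds(2)[of "real (Suc k)" s] assms by (simp add: powr_step_def add_ac)
  hence "real (Suc k) * powr_step s k \<le> real (Suc k) * (s * real (Suc k) powr (-s - 1))"
    by (intro mult_left_mono) auto
  also have "\<dots> = s * real (Suc k) powr -s"
    by (simp add: powr_diff)
  finally show "real (Suc k) * powr_step s k \<le> s * real (Suc k) powr -s" .
qed

text \<open>Telescoping. A term \<open>q powr -s\<close> becomes a sum over all thresholds that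
  \<open>q\<close> does not exceed, which turns a Dirichlet series into a sum over its counting
  function.\<close>

lemma has_sum_powr_step:
  assumes "s > 1" "q \<ge> 1"
  shows "(powr_step s has_sum real q powr -s) {k. q \<le> Suc k}"
proof -
  obtain r where q: "q = Suc r" using assms(2) by (cases q) auto
  have "(\<lambda>k. real (Suc (k + r)) powr -s) \<longlonglongrightarrow> 0" using assms(1) by real_asymp
  from telescope_sums'[OF this] have "(\<lambda>k. powr_step s (k + r)) sums (real q powr -s)"
    by (simp add: powr_step_def q)
  hence "((\<lambda>k. powr_step s (k + r)) has_sum (real q powr -s)) UNIV"
    by (rule sums_nonneg_imp_has_sum) (use powr_step_bounds assms in auto)
  moreover have "bij_betw (\<lambda>k. k + r) UNIV {k. q \<le> Suc k}"
    by (rule bij_betwI[of _ _ _ "\<lambda>k. k - r"]) (auto simp: q)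
  ultimately show ?thesis using has_sum_reindex_bij_betw by blast
qed

text \<open>Summation by parts, as a Tonelli exchange.\<close>

lemma dirichlet_series_by_counts:
  fixes q :: "'i \<Rightarrow> nat"
  assumes q: "\<And>i. i \<in> I \<Longrightarrow> q i \<ge> 1" and fin: "\<And>n. finite {i \<in> I. q i \<le> n}"
    and K: "\<And>n. real (card {i \<in> I. q i \<le> n}) \<le> K * real n" and s: "s > 1"
  shows "summable (\<lambda>k. real (card {i \<in> I. q i \<le> Suc k}) * powr_step s k)"
    and "((\<lambda>i. real (q i) powr -s) has_sum (\<Sum>k. real (card {i \<in> I. q i \<le> Suc k}) * powr_step s k)) I"
proof -
  define N where "N = (\<lambda>n. real (card {i \<in> I. q i \<le> n}))"
  have "summable (\<lambda>k. K * (s * real (Suc k) powr -s))"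
    by (intro summable_mult summable_powr_neg_Suc s)
  moreover have "norm (N (Suc k) * powr_step s k) \<le> K * (s * real (Suc k) powr -s)" for k
  proof -
    have K0: "0 \<le> K" using K[of 1] by (simp add: order_trans[OF of_nat_0_le_iff])
    have "N (Suc k) * powr_step s k \<le> (K * real (Suc k)) * powr_step s k"
      unfolding N_def using powr_step_bounds[OF s] K by (intro mult_right_mono)
    also have "\<dots> = K * (real (Suc k) * powr_step s k)" by simp
    also have "\<dots> \<le> K * (s * real (Suc k) powr -s)"
      using powr_step_bounds[OF s] K0 by (intro mult_left_mono) auto
    finally show ?thesis using powr_step_bounds[OF s] by (simp add: N_def)
  qed
  ultimately show sm: "summable (\<lambda>k. real (card {i \<in> I. q i \<le> Suc k}) * powr_step s k)"
    unfolding N_def by (rule summable_comparison_test'[where N = 0])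
  define h where "h = (\<Sum>k. N (Suc k) * powr_step s k)"
  have 1: "((\<lambda>k. N (Suc k) * powr_step s k) has_sum h) UNIV"
    using summable_sums[OF sm] powr_step_bounds[OF s] unfolding h_def N_def
    by (intro sums_nonneg_imp_has_sum) auto
  have 2: "((\<lambda>i. (\<lambda>(k,i). powr_step s k) (k, i)) has_sum (N (Suc k) * powr_step s k)) {i \<in> I. q i \<le> Suc k}" for k
    by (rule has_sum_finiteI[OF fin]) (simp add: N_def)
  have 3: "(\<lambda>(k,i). powr_step s k) summable_on Sigma UNIV (\<lambda>k. {i \<in> I. q i \<le> Suc k})"
    by (rule summable_on_SigmaI[OF 2]) (use 1 powr_step_bounds[OF s] in \<open>auto simp: summable_on_def\<close>)
  have 4: "((\<lambda>(k,i). powr_step s k) has_sum h) (Sigma UNIV (\<lambda>k. {i \<in> I. q i \<le> Suc k}))"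
    by (rule has_sum_SigmaI[OF 2 1 3])
  have bij: "bij_betw prod.swap (Sigma I (\<lambda>i. {k. q i \<le> Suc k})) (Sigma UNIV (\<lambda>k. {i \<in> I. q i \<le> Suc k}))"
    by (rule bij_betwI[of _ _ _ prod.swap]) auto
  have 5: "((\<lambda>(i,k). powr_step s k) has_sum h) (Sigma I (\<lambda>i. {k. q i \<le> Suc k}))"
    using has_sum_reindex_bij_betw[OF bij, of "\<lambda>(k,i). powr_step s k" h] 4 by (simp add: case_prod_unfold)
  have "((\<lambda>i. real (q i) powr -s) has_sum h) I"
    by (rule has_sum_SigmaD[OF 5]) (use has_sum_powr_step[OF s] q in auto)
  thus "((\<lambda>i. real (q i) powr -s) has_sum (\<Sum>k. real (card {i \<in> I. q i \<le> Suc k}) * powr_step s k)) I"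
    by (simp add: h_def N_def)
qed

text \<open>Finiteness is demanded explicitly because \<open>card\<close> of an infinite set is 0,
  and \<open>q i \<ge> 1\<close> because Abel summation starts at the threshold 1.\<close>

definition has_density :: "('i \<Rightarrow> nat) \<Rightarrow> 'i set \<Rightarrow> real \<Rightarrow> bool" where
  "has_density q I \<kappa> \<longleftrightarrow> (\<forall>i\<in>I. q i \<ge> 1) \<and> (\<forall>n. finite {i \<in> I. q i \<le> n}) \<and>
     (\<lambda>n. real (card {i \<in> I. q i \<le> n}) / real n) \<longlonglongrightarrow> \<kappa>"

lemma has_density_count_le:
  assumes "has_density q I \<kappa>"
  obtains K where "K > 0" "\<And>n. real (card {i \<in> I. q i \<le> n}) \<le> K * real n"
proof -
  have "Bseq (\<lambda>n. real (card {i \<in> I. q i \<le> n}) / real n)"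
    using assms by (intro convergent_imp_Bseq) (auto simp: has_density_def convergent_def)
  then obtain K where K: "K > 0" "\<And>n. norm (real (card {i \<in> I. q i \<le> n}) / real n) \<le> K"
    by (auto simp: Bseq_def)
  have "real (card {i \<in> I. q i \<le> n}) \<le> K * real n" for n
  \<comment> \<open>At \<open>n = 0\<close> the quotient is 0 by convention and says nothing about
    the count; the set is empty there because \<open>q i \<ge> 1\<close>.\<close>
  proof (cases "n = 0")
    case True
    hence "{i \<in> I. q i \<le> n} = {}" using assms by (force simp: has_density_def)
    thus ?thesis using True by (simp only: card.empty)
  next
    case False
    thus ?thesis using K(2)[of n] by (simp add: field_simps)
  qed
  thus ?thesis using K(1) that by blast
qed

lemma has_density_count_ge:
  assumes "has_density q I \<kappa>" "c < \<kappa>"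
  obtains n0 where "\<And>n. n \<ge> n0 \<Longrightarrow> c * real n \<le> real (card {i \<in> I. q i \<le> n})"
proof -
  have "eventually (\<lambda>n. c < real (card {i \<in> I. q i \<le> n}) / real n) sequentially"
    using assms by (intro order_tendstoD) (auto simp: has_density_def)
  hence "eventually (\<lambda>n. c * real n \<le> real (card {i \<in> I. q i \<le> n})) sequentially"
    using eventually_gt_at_top[of 0] by eventually_elim (auto simp: field_simps)
  thus ?thesis using that unfolding eventually_sequentially by blast
qed

lemma has_density_summable:
  assumes "has_density q I \<kappa>" "s > 1"
  shows "(\<lambda>i. real (q i) powr -s) summable_on I"
proof -
  obtain K where K: "K > 0" "\<And>n. real (card {i \<in> I. q i \<le> n}) \<le> K * real n"
    using has_density_count_le[OF assms(1)] by blast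
  show ?thesis
    using dirichlet_series_by_counts(2)[of I q K s, OF _ _ K(2) assms(2)] assms(1)
    by (auto simp: has_density_def summable_on_def)
qed

text \<open>An Abelian theorem. The count is \<open>\<kappa> * n\<close> plus \<open>o(n)\<close>,
  and \<open>n\<close> is the count of the Riemann zeta series, whose residue is 1. After Abel
  summation the error is at most a constant plus a small multiple of that series.\<close>

theorem has_density_residue:
  assumes "has_density q I \<kappa>"
  shows "((\<lambda>s. (s - 1) * infsum (\<lambda>i. real (q i) powr -s) I) \<longlongrightarrow> \<kappa>) (at_right 1)"
proof -
  obtain K where K: "K > 0" "\<And>n. real (card {i \<in> I. q i \<le> n}) \<le> K * real n"
    using has_density_count_le[OF assms(1)] by blast
  define N where "N = (\<lambda>n. real (card {i \<in> I. q i \<le> n}))"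
  define h where "h = (\<lambda>s. infsum (\<lambda>i. real (q i) powr -s) I)"
  define Z where "Z = (\<lambda>s. \<Sum>k. real (Suc k) powr -s)"
  have h: "(\<lambda>k. N (Suc k) * powr_step s k) sums h s" if "s > 1" for s
    using dirichlet_series_by_counts[of I q K s, OF _ _ K(2) that] assms(1)
    by (auto simp: has_density_def h_def N_def infsumI summable_sums)
  \<comment> \<open>The zeta series is the case \<open>q = Suc\<close>, so the general summation
    formula applies to it as well.\<close>
  have Z: "(\<lambda>k. real (Suc k) * powr_step s k) sums Z s" if "s > 1" for s
  proof -
    have c: "{i. Suc i \<le> n} = {..<n}" for n by auto
    have *: "summable (\<lambda>k. real (card {i \<in> UNIV. Suc i \<le> Suc k}) * powr_step s k)"
         "((\<lambda>i. real (Suc i) powr -s) has_sum (\<Sum>k. real (card {i \<in> UNIV. Suc i \<le> Suc k}) * powr_step s k)) UNIV"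
      by (rule dirichlet_series_by_counts[of UNIV Suc 1 s, OF _ _ _ that]; simp add: c)+
    have "Z s = (\<Sum>k. real (card {i \<in> UNIV. Suc i \<le> Suc k}) * powr_step s k)"
      unfolding Z_def using has_sum_imp_sums[OF *(2)] by (rule sums_unique[symmetric])
    thus ?thesis using summable_sums[OF *(1)] by (simp add: c lessThan_Suc_atMost[symmetric] del: of_nat_Suc)
  qed
  have Zlim: "((\<lambda>s. (s - 1) * Z s) \<longlongrightarrow> 1) (at_right 1)"
  proof (rule tendsto_sandwich[of "\<lambda>_. 1" _ _ "\<lambda>s. s"])
    show "\<forall>\<^sub>F s in at_right 1. 1 \<le> (s - 1) * Z s" "\<forall>\<^sub>F s in at_right 1. (s - 1) * Z s \<le> s"
      unfolding Z_def using zeta_pole_bounds by (auto intro: eventually_mono[OF eventually_at_right_less])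
  qed (auto intro!: tendsto_eq_intros)
  have "((\<lambda>s. (s - 1) * h s - \<kappa> * ((s - 1) * Z s)) \<longlongrightarrow> 0) (at_right 1)"
  proof (rule tendstoI)
    fix e :: real assume e: "e > 0"
    have "(\<lambda>n. N n / real n) \<longlonglongrightarrow> \<kappa>" using assms by (simp add: has_density_def N_def)
    hence "eventually (\<lambda>n. dist (N n / real n) \<kappa> < e / 4) sequentially" using e by (intro tendstoD) auto
    then obtain T where T: "\<And>n. n \<ge> T \<Longrightarrow> \<bar>N n / real n - \<kappa>\<bar> < e / 4"
      by (auto simp: eventually_sequentially dist_real_def)
    define r where "r = (\<lambda>k. \<bar>N (Suc k) - \<kappa> * real (Suc k)\<bar>)"
    \<comment> \<open>The terms before \<open>T\<close> need not be small, but
      \<open>powr_step s k \<le> 1\<close> bounds them independently of \<open>s\<close>, and the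
      factor \<open>s - 1\<close> removes them in the limit.\<close>
    define C where "C = (\<Sum>k<T. r k)"
    have C: "C \<ge> 0" unfolding C_def r_def by (intro sum_nonneg) auto
    \<comment> \<open>\<open>C + 1\<close> instead of \<open>C\<close> keeps the quotient defined;
      the two parts of the error are then below \<open>e / 4\<close> and
      \<open>e / 2\<close>.\<close>
    have main: "\<bar>(s - 1) * h s - \<kappa> * ((s - 1) * Z s)\<bar> < e" if s: "s > 1" "s < 2" "s < 1 + e / (4 * (C + 1))" for s
    proof -
      have 1: "(\<lambda>k. (N (Suc k) - \<kappa> * real (Suc k)) * powr_step s k) sums (h s - \<kappa> * Z s)"
        using sums_diff[OF h[OF s(1)] sums_mult[OF Z[OF s(1)], of \<kappa>]] by (simp add: algebra_simps)
      have 2: "(\<lambda>k. (if k \<in> {..<T} then r k else 0) + e / 4 * (real (Suc k) * powr_step s k)) sums (C + e / 4 * Z s)"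
        unfolding C_def by (intro sums_add sums_If_finite_set sums_mult Z s) auto
      have le: "\<bar>(N (Suc k) - \<kappa> * real (Suc k)) * powr_step s k\<bar> \<le> (if k \<in> {..<T} then r k else 0) + e / 4 * (real (Suc k) * powr_step s k)" for k
      proof (cases "k < T")
        case True
        have "\<bar>(N (Suc k) - \<kappa> * real (Suc k)) * powr_step s k\<bar> = r k * powr_step s k"
          using powr_step_bounds[OF s(1), of k] by (simp add: r_def abs_mult)
        also have "\<dots> \<le> r k * 1" using powr_step_bounds[OF s(1), of k] by (intro mult_left_mono) (auto simp: r_def)
        finally have "\<bar>(N (Suc k) - \<kappa> * real (Suc k)) * powr_step s k\<bar> \<le> r k" by simp
        moreover have "0 \<le> e / 4 * (real (Suc k) * powr_step s k)" using e powr_step_bounds[OF s(1), of k] by simp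
        ultimately show ?thesis using True by simp
      next
        case False
        hence "\<bar>N (Suc k) / real (Suc k) - \<kappa>\<bar> < e / 4" by (intro T) auto
        moreover have "N (Suc k) / real (Suc k) - \<kappa> = (N (Suc k) - \<kappa> * real (Suc k)) / real (Suc k)"
          by (simp add: field_simps)
        ultimately have "\<bar>N (Suc k) - \<kappa> * real (Suc k)\<bar> / real (Suc k) < e / 4" by simp
        hence "r k \<le> e / 4 * real (Suc k)" unfolding r_def by (simp add: field_simps)
        hence "r k * powr_step s k \<le> e / 4 * real (Suc k) * powr_step s k"
          using powr_step_bounds[OF s(1), of k] by (intro mult_right_mono) auto
        thus ?thesis using False powr_step_bounds[OF s(1), of k] by (simp add: r_def abs_mult mult_ac)
      qed
      have "h s - \<kappa> * Z s \<le> C + e / 4 * Z s" by (rule sums_le[OF _ 1 2]) (use le abs_le_D1 in blast)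
      moreover have "- (h s - \<kappa> * Z s) \<le> C + e / 4 * Z s" by (rule sums_le[OF _ sums_minus[OF 1] 2]) (use le abs_le_D2 in blast)
      ultimately have "\<bar>h s - \<kappa> * Z s\<bar> \<le> C + e / 4 * Z s" by linarith
      hence "(s - 1) * \<bar>h s - \<kappa> * Z s\<bar> \<le> (s - 1) * (C + e / 4 * Z s)" using s by (intro mult_left_mono) auto
      also have "\<dots> = (s - 1) * C + e / 4 * ((s - 1) * Z s)" by (simp only: distrib_left mult.left_commute)
      also have "\<dots> \<le> (s - 1) * C + e / 4 * s"
        using zeta_pole_bounds(2)[OF s(1)] e unfolding Z_def by (intro add_left_mono mult_left_mono) auto
      also have "\<dots> \<le> (s - 1) * (C + 1) + e / 4 * 2"
        using s e by (intro add_mono mult_left_mono) auto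
      also have "(s - 1) * (C + 1) < e / 4" using s C by (simp add: field_simps)
      finally have "(s - 1) * \<bar>h s - \<kappa> * Z s\<bar> < e" using e by simp
      moreover have "\<bar>(s - 1) * h s - \<kappa> * ((s - 1) * Z s)\<bar> = (s - 1) * \<bar>h s - \<kappa> * Z s\<bar>"
      proof -
        have "(s - 1) * h s - \<kappa> * ((s - 1) * Z s) = (s - 1) * (h s - \<kappa> * Z s)" by (simp add: algebra_simps)
        thus ?thesis using s by (simp only: abs_mult)
      qed
      ultimately show ?thesis by linarith
    qed
    have "eventually (\<lambda>s. s < x) (at_right (1::real))" if "x > 1" for x
      by (rule eventually_at_rightI[of 1 x]) (use that in auto)
    from this[of 2] this[of "1 + e / (4 * (C + 1))"]
    have "eventually (\<lambda>s. s < 2) (at_right (1::real))" "eventually (\<lambda>s. s < 1 + e / (4 * (C + 1))) (at_right (1::real))"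
      using e C by auto
    moreover have "eventually (\<lambda>s. s > 1) (at_right (1::real))" by (simp add: eventually_at_filter)
    ultimately show "\<forall>\<^sub>F s in at_right 1. dist ((s - 1) * h s - \<kappa> * ((s - 1) * Z s)) 0 < e"
      by eventually_elim (use main in \<open>simp add: dist_real_def\<close>)
  qed
  from tendsto_add[OF this tendsto_mult_left[OF Zlim, of \<kappa>]] show ?thesis by (simp add: h_def)
qed

text \<open>Abel summation with the weights \<open>1 / k - 1 / (k + 1)\<close>; for a linear count
  the right-hand side is a harmonic sum, the source of every logarithm in the counting
  bounds.\<close>

lemma sum_inverse_by_counts:
  fixes q :: "'i \<Rightarrow> nat"
  assumes q: "\<And>i. i \<in> I \<Longrightarrow> q i \<ge> 1" and fin: "\<And>n. finite {i \<in> I. q i \<le> n}"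
  shows "(\<Sum>i | i \<in> I \<and> q i \<le> n. 1 / real (q i)) =
    (\<Sum>k=1..n. real (card {i \<in> I. q i \<le> k}) / (real k * (real k + 1))) + real (card {i \<in> I. q i \<le> n}) / (real n + 1)"
proof (induction n)
  case 0
  have "{i \<in> I. q i = 0} = {}" using q by force
  thus ?case by (simp only: le_zero_eq) simp
next
  case (Suc n)
  have un: "{i \<in> I. q i \<le> Suc n} = {i \<in> I. q i \<le> n} \<union> {i \<in> I. q i = Suc n}" by auto
  have fin': "finite {i \<in> I. q i = Suc n}" by (rule finite_subset[OF _ fin[of "Suc n"]]) auto
  have c: "card {i \<in> I. q i \<le> Suc n} = card {i \<in> I. q i \<le> n} + card {i \<in> I. q i = Suc n}"
    unfolding un by (rule card_Un_disjoint) (use fin fin' in auto)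
  have "(\<Sum>i | i \<in> I \<and> q i \<le> Suc n. 1 / real (q i)) = (\<Sum>i | i \<in> I \<and> q i \<le> n. 1 / real (q i)) + (\<Sum>i | i \<in> I \<and> q i = Suc n. 1 / real (q i))"
    unfolding un by (rule sum.union_disjoint) (use fin fin' in auto)
  also have "(\<Sum>i | i \<in> I \<and> q i = Suc n. 1 / real (q i)) = real (card {i \<in> I. q i = Suc n}) / real (Suc n)"
    by simp
  finally have eq: "(\<Sum>i | i \<in> I \<and> q i \<le> Suc n. 1 / real (q i)) =
      (\<Sum>k=1..n. real (card {i \<in> I. q i \<le> k}) / (real k * (real k + 1))) +
      (real (card {i \<in> I. q i \<le> n}) / (real n + 1) + real (card {i \<in> I. q i = Suc n}) / real (Suc n))"
    unfolding Suc.IH by simp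
  have alg: "A / (x + 1) + B / (x + 1) = (A + B) / ((x + 1) * (x + 1 + 1)) + (A + B) / (x + 1 + 1)"
    if "x \<ge> 0" for A B x :: real
    using that by (simp add: divide_simps) (simp add: algebra_simps)
  show ?case unfolding eq using alg[of "real n" "real (card {i \<in> I. q i \<le> n})" "real (card {i \<in> I. q i = Suc n})"] c
    by (simp add: add_ac)
qed

lemma has_density_sum_inverse_le:
  assumes "has_density q I \<kappa>"
  obtains C where "C > 0" "\<And>n. n \<ge> 2 \<Longrightarrow> (\<Sum>i | i \<in> I \<and> q i \<le> n. 1 / real (q i)) \<le> C * ln (real n)"
proof -
  obtain K where K: "K > 0" "\<And>n. real (card {i \<in> I. q i \<le> n}) \<le> K * real n"
    using has_density_count_le[OF assms(1)] by blast
  have bound: "(\<Sum>i | i \<in> I \<and> q i \<le> n. 1 / real (q i)) \<le> (4 * K) * ln (real n)" if n: "n \<ge> 2" for n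
  proof -
    have harm: "(\<Sum>k=1..n. 1 / (real k + 1)) \<le> ln (real n + 1)" for n
    proof (induction n)
      case (Suc n)
      have "ln ((real n + 1) / (real n + 2)) \<le> (real n + 1) / (real n + 2) - 1" by (rule ln_le_minus_one) simp
      also have "\<dots> = - 1 / (real n + 2)" by (simp add: field_simps)
      finally have "1 / (real n + 2) \<le> ln (real n + 2) - ln (real n + 1)" by (simp add: ln_div)
      thus ?case using Suc by (simp add: add_ac)
    qed auto
    have "(\<Sum>i | i \<in> I \<and> q i \<le> n. 1 / real (q i)) =
        (\<Sum>k=1..n. real (card {i \<in> I. q i \<le> k}) / (real k * (real k + 1))) + real (card {i \<in> I. q i \<le> n}) / (real n + 1)"
      using assms by (intro sum_inverse_by_counts) (auto simp: has_density_def)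
    also have "\<dots> \<le> (\<Sum>k=1..n. K * (1 / (real k + 1))) + K"
    proof (intro add_mono sum_mono)
      fix k assume k: "k \<in> {1..n}"
      have "real (card {i \<in> I. q i \<le> k}) / (real k * (real k + 1)) \<le> K * real k / (real k * (real k + 1))"
        using K(2) by (intro divide_right_mono) auto
      thus "real (card {i \<in> I. q i \<le> k}) / (real k * (real k + 1)) \<le> K * (1 / (real k + 1))"
        using k by simp
    next
      have "real (card {i \<in> I. q i \<le> n}) / (real n + 1) \<le> K * real n / (real n + 1)"
        using K(2) by (intro divide_right_mono) auto
      also have "\<dots> \<le> K" using K(1) by (simp add: field_simps)
      finally show "real (card {i \<in> I. q i \<le> n}) / (real n + 1) \<le> K" .
    qed
    also have "\<dots> \<le> K * ln (real n + 1) + K * 1"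
      using harm[of n] K(1) unfolding sum_distrib_left[symmetric] by simp
    \<comment> \<open>Both estimates use \<open>n \<ge> 2\<close>:
      \<open>n + 1 \<le> n\<^sup>2\<close> at most doubles the logarithm, and
      \<open>ln 2 \<ge> 2/3\<close> absorbs the constant.\<close>
    also have "\<dots> \<le> K * (2 * ln (real n)) + K * (2 * ln (real n))"
    proof (intro add_mono mult_left_mono)
      have "real n + 1 \<le> real n ^ 2"
      proof -
        have "2 * real n \<le> real n * real n" using n by (intro mult_right_mono) auto
        thus ?thesis using n unfolding power2_eq_square by linarith
      qed
      hence "ln (real n + 1) \<le> ln (real n ^ 2)" using n by (subst ln_le_cancel_iff) auto
      thus "ln (real n + 1) \<le> 2 * ln (real n)" using n by (simp add: ln_realpow)
    next
      have "2/3 \<le> ln (2::real)" by (rule ln2_ge_two_thirds)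
      also have "\<dots> \<le> ln (real n)" using n by simp
      finally show "1 \<le> 2 * ln (real n)" by simp
    qed (use K(1) in auto)
    finally show ?thesis by simp
  qed
  show ?thesis by (rule that[of "4 * K"]) (use bound K(1) in auto)
qed

lemma has_density_sum_inverse_ge:
  assumes "has_density q I \<kappa>" "\<kappa> > 0"
  obtains c n0 where "c > 0" "\<And>n. n \<ge> n0 \<Longrightarrow> c * ln (real n) \<le> (\<Sum>i | i \<in> I \<and> q i \<le> n. 1 / real (q i))"
proof -
  define c where "c = \<kappa> / 2"
  have c: "c > 0" "c < \<kappa>" using assms(2) by (auto simp: c_def)
  obtain n1 where n1: "\<And>n. n \<ge> n1 \<Longrightarrow> c * real n \<le> real (card {i \<in> I. q i \<le> n})"
    using has_density_count_ge[OF assms(1) c(2)] by blast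
  \<comment> \<open>The counts are controlled only from \<open>n1\<close> on. Starting the harmonic
    sum at \<open>n1 + 1\<close> loses \<open>ln (n1 + 2)\<close>, which
    \<open>n \<ge> (n1 + 2)\<^sup>2\<close> makes at most half of \<open>ln (n + 2)\<close>.\<close>
  have bound: "c / 2 * ln (real n) \<le> (\<Sum>i | i \<in> I \<and> q i \<le> n. 1 / real (q i))" if n: "n \<ge> (n1 + 2)\<^sup>2" for n
  proof -
    define m where "m = n1 + 1"
    have "m \<le> (n1 + 2)\<^sup>2" by (simp add: m_def power2_eq_square)
    hence nm: "m \<le> n" using n by linarith
    have harm: "ln (real n + 2) - ln (real m + 1) \<le> (\<Sum>k=m..n. 1 / (real k + 1))" if "m \<le> n" for n m
      using that
    proof (induction n rule: dec_induct)
      case base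
      have "ln ((real m + 2) / (real m + 1)) \<le> (real m + 2) / (real m + 1) - 1" by (rule ln_le_minus_one) simp
      also have "\<dots> = 1 / (real m + 1)" by (simp add: field_simps)
      finally show ?case by (simp add: ln_div)
    next
      case (step n)
      have "ln ((real n + 3) / (real n + 2)) \<le> (real n + 3) / (real n + 2) - 1" by (rule ln_le_minus_one) simp
      also have "\<dots> = 1 / (real n + 2)" by (simp add: field_simps)
      finally have "ln (real n + 3) - ln (real n + 2) \<le> 1 / (real n + 2)" by (simp add: ln_div)
      thus ?case using step by (simp add: add_ac)
    qed
    have "real ((n1 + 2)\<^sup>2) \<le> real n" using n by (subst of_nat_le_iff)
    hence n': "(real n1 + 2) ^ 2 \<le> real n" by (simp add: add.commute)
    hence "ln ((real n1 + 2) ^ 2) \<le> ln (real n + 2)" by (subst ln_le_cancel_iff) (auto intro: order_trans)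
    hence "2 * ln (real m + 1) \<le> ln (real n + 2)" by (simp add: ln_realpow m_def add_ac)
    moreover have "ln (real n) \<le> ln (real n + 2)"
    proof -
      have "0 < (real n1 + 2) ^ 2" by simp
      hence "real n > 0" using n' by linarith
      thus ?thesis by simp
    qed
    ultimately have "ln (real n) / 2 \<le> ln (real n + 2) - ln (real m + 1)" by linarith
    also have "\<dots> \<le> (\<Sum>k=m..n. 1 / (real k + 1))" by (rule harm[OF nm])
    finally have "c * (ln (real n) / 2) \<le> c * (\<Sum>k=m..n. 1 / (real k + 1))" using c by (intro mult_left_mono) auto
    also have "\<dots> = (\<Sum>k=m..n. c * real k / (real k * (real k + 1)))"
      unfolding sum_distrib_left by (intro sum.cong) (auto simp: m_def)
    also have "\<dots> \<le> (\<Sum>k=m..n. real (card {i \<in> I. q i \<le> k}) / (real k * (real k + 1)))"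
      by (intro sum_mono divide_right_mono n1) (auto simp: m_def)
    also have "\<dots> \<le> (\<Sum>k=1..n. real (card {i \<in> I. q i \<le> k}) / (real k * (real k + 1)))"
      by (intro sum_mono2) (auto simp: m_def)
    also have "\<dots> \<le> \<dots> + real (card {i \<in> I. q i \<le> n}) / (real n + 1)" by simp
    also have "\<dots> = (\<Sum>i | i \<in> I \<and> q i \<le> n. 1 / real (q i))"
      using assms by (intro sum_inverse_by_counts[symmetric]) (auto simp: has_density_def)
    finally show ?thesis by simp
  qed
  show ?thesis by (rule that[of "c / 2" "(n1 + 2)\<^sup>2"]) (use bound c in auto)
qed

section \<open>Sectors and binary quadratic forms\<close>


text \<open>Sandwiching \<open>S\<close> treats strict and weak defining inequalities alike.\<close>

lemma negligible_frontier_between: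
  assumes "open U" "closed V" "U \<subseteq> S" "S \<subseteq> V" "negligible (V - U)"
  shows "negligible (frontier S)"
proof (rule negligible_subset[OF assms(5)])
  have "closure S \<subseteq> V" using assms by (simp add: closure_minimal)
  moreover have "U \<subseteq> interior S" using assms by (simp add: interior_maximal)
  ultimately show "frontier S \<subseteq> V - U" by (auto simp: frontier_def)
qed

text \<open>By homogeneity a ray from the origin meets the level set at most once, so the starlike
  criterion applies.\<close>

lemma negligible_level_set:
  fixes f :: "'a::euclidean_space \<Rightarrow> real"
  assumes "continuous_on UNIV f" "\<And>t x. f (t *\<^sub>R x) = t\<^sup>2 * f x"
  shows "negligible {x. f x = 1}"
proof (rule starlike_negligible[where a = 0])
  show "closed {x. f x = 1}" using assms(1) by (intro closed_Collect_eq) auto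
  show "t = 1" if "0 + t *\<^sub>R x \<in> {x. f x = 1}" "0 \<le> t" "0 + x \<in> {x. f x = 1}" for t x
    using that assms(2) by (simp add: power2_eq_1_iff)
qed

lemma negligible_frontier_sector:
  fixes f :: "'a::euclidean_space \<Rightarrow> real"
  assumes f: "continuous_on UNIV f" "\<And>t x. f (t *\<^sub>R x) = t\<^sup>2 * f x" and uv: "u \<noteq> 0" "v \<noteq> 0"
    and S: "{x. u \<bullet> x > 0 \<and> v \<bullet> x > 0 \<and> f x < 1} \<subseteq> S" "S \<subseteq> {x. u \<bullet> x \<ge> 0 \<and> v \<bullet> x \<ge> 0 \<and> f x \<le> 1}"
  shows "negligible (frontier S)"
proof (rule negligible_frontier_between[OF _ _ S])
  show "open {x. u \<bullet> x > 0 \<and> v \<bullet> x > 0 \<and> f x < 1}"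
    using f(1) by (intro open_Collect_conj open_Collect_less continuous_intros)
  show "closed {x. u \<bullet> x \<ge> 0 \<and> v \<bullet> x \<ge> 0 \<and> f x \<le> 1}"
    using f(1) by (intro closed_Collect_conj closed_Collect_le continuous_intros)
  have "negligible ({x. u \<bullet> x = 0} \<union> {x. v \<bullet> x = 0} \<union> {x. f x = 1})"
    using uv by (intro negligible_Un negligible_hyperplane negligible_level_set f) auto
  thus "negligible ({x. u \<bullet> x \<ge> 0 \<and> v \<bullet> x \<ge> 0 \<and> f x \<le> 1} - {x. u \<bullet> x > 0 \<and> v \<bullet> x > 0 \<and> f x < 1})"
    by (rule negligible_subset) auto
qed

lemma measure_pos_if_open_subset:
  assumes "S \<in> lmeasurable" "open U" "U \<subseteq> S" "U \<noteq> {}"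
  shows "measure lebesgue S > 0"
proof (rule ccontr)
  assume "\<not> measure lebesgue S > 0"
  hence "measure lebesgue S = 0" using measure_nonneg[of lebesgue S] by linarith
  hence "negligible S" using assms(1) by (simp add: negligible_iff_measure)
  hence "negligible U" using assms(3) by (rule negligible_subset)
  thus False using open_not_negligible[OF assms(2,4)] by simp
qed

text \<open>The scale \<open>sqrt n\<close> fits functions \<open>q\<close> that are homogeneous of
  degree two, such as a quadratic form or the product of the coordinates: \<open>q z \<le> n\<close>
  then says that the scaled point lies in a fixed region.\<close>

lemma has_density_region:
  fixes q :: "int \<times> int \<Rightarrow> nat"
  assumes S: "bounded S" "negligible (frontier S)" and m: "m > 0"
    and q1: "\<And>z. z \<in> I \<Longrightarrow> q z \<ge> 1"
    and eq: "\<And>n. n \<ge> 1 \<Longrightarrow> {z \<in> I. q z \<le> n} = {z \<in> residue_points m c. scaled_point (sqrt (real n)) z \<in> S}"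
  shows "has_density q I (measure lebesgue S / (of_int m)\<^sup>2)"
  unfolding has_density_def
proof (intro conjI ballI allI)
  show "q i \<ge> 1" if "i \<in> I" for i by (rule q1[OF that])
  show "finite {i \<in> I. q i \<le> n}" for n
  proof (rule finite_subset)
    have "{i \<in> I. q i \<le> n} \<subseteq> {i \<in> I. q i \<le> Suc n}" by auto
    also have "\<dots> \<subseteq> {z. scaled_point (sqrt (real (Suc n))) z \<in> S}" using eq[of "Suc n"] by auto
    finally show "{i \<in> I. q i \<le> n} \<subseteq> {z. scaled_point (sqrt (real (Suc n))) z \<in> S}" .
    show "finite {z. scaled_point (sqrt (real (Suc n))) z \<in> S}" by (rule finite_scaled_points[OF S(1)]) simp
  qed
  show "(\<lambda>n. real (card {i \<in> I. q i \<le> n}) / real n) \<longlonglongrightarrow> measure lebesgue S / (of_int m)\<^sup>2"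
  proof (rule Lim_transform_eventually[OF lattice_point_density[OF S m, of c]])
    show "\<forall>\<^sub>F n in sequentially. real (card {z \<in> residue_points m c. scaled_point (sqrt (real n)) z \<in> S}) / real n = real (card {i \<in> I. q i \<le> n}) / real n"
      using eventually_ge_at_top[of 1] by eventually_elim (simp add: eq)
  qed
qed

text \<open>With \<open>(content_perp z)\<^sup>2\<close> for \<open>A\<close> and \<open>D\<close>
  for \<open>B\<close>, these inequalities express that \<open>Q u / Q v\<close> lies strictly
  between \<open>1/3\<close> and 3, for \<open>u\<close> and \<open>v\<close> the multiples of
  \<open>z\<close> and \<open>perp z\<close> by the two coordinates.\<close>

definition ratio_sector :: "int \<Rightarrow> int \<Rightarrow> (int \<times> int) set" where
  "ratio_sector A B = {z. fst z > 0 \<and> snd z > 0 \<and> A * (fst z)\<^sup>2 < 3 * B * (snd z)\<^sup>2 \<and> B * (snd z)\<^sup>2 < 3 * A * (fst z)\<^sup>2}"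

text \<open>Inside the sector the two coordinates are comparable, so \<open>x * y \<le> 1\<close>
  cuts off a bounded piece that avoids the unbounded arms of the hyperbola.\<close>

lemma ratio_sector_density:
  assumes A: "A > 0" and B: "B > 0"
  shows "\<exists>\<kappa>>0. \<forall>m>0. \<forall>c. has_density (\<lambda>z. nat (fst z * snd z)) (residue_points m c \<inter> ratio_sector A B) (\<kappa> / (of_int m)\<^sup>2)"
proof -
  define \<alpha> \<beta> where "\<alpha> = sqrt (of_int A)" and "\<beta> = sqrt (of_int B)"
  have ab: "\<alpha> > 0" "\<beta> > 0" "\<alpha>\<^sup>2 = of_int A" "\<beta>\<^sup>2 = of_int B" using A B by (auto simp: \<alpha>_def \<beta>_def)
  \<comment> \<open>Normals of the bounding lines \<open>\<alpha> x = sqrt 3 \<beta> y\<close> and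
    \<open>\<beta> y = sqrt 3 \<alpha> x\<close>. For positive coordinates the quadratic
    inequalities are equivalent to these linear ones.\<close>
  define u v where "u = (-\<alpha>, sqrt 3 * \<beta>)" and "v = (sqrt 3 * \<alpha>, -\<beta>)"
  define f where "f = (\<lambda>z::real \<times> real. fst z * snd z)"
  define S where "S = {z::real\<times>real. fst z > 0 \<and> snd z > 0 \<and> of_int A * (fst z)\<^sup>2 < 3 * of_int B * (snd z)\<^sup>2
       \<and> of_int B * (snd z)\<^sup>2 < 3 * of_int A * (fst z)\<^sup>2 \<and> f z \<le> 1}"
  have s3: "sqrt 3 > (0::real)" "(sqrt 3)\<^sup>2 = (3::real)" "sqrt 3 > (1::real)" by auto
  have inner: "{x. u \<bullet> x > 0 \<and> v \<bullet> x > 0 \<and> f x < 1} \<subseteq> S"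
  proof safe
    fix x y assume h: "u \<bullet> (x, y) > 0" "v \<bullet> (x, y) > 0" "f (x, y) < 1"
    have 1: "\<alpha> * x < sqrt 3 * (\<beta> * y)" "\<beta> * y < sqrt 3 * (\<alpha> * x)" using h by (auto simp: u_def v_def algebra_simps)
    \<comment> \<open>Chaining the two linear inequalities gives
      \<open>\<alpha> x < 3 \<alpha> x\<close>, so they already force positivity.\<close>
    have "\<alpha> * x > 0"
    proof -
      have "sqrt 3 * (\<beta> * y) < sqrt 3 * (sqrt 3 * (\<alpha> * x))" using 1 s3 by (intro mult_strict_left_mono) auto
      also have "\<dots> = 3 * (\<alpha> * x)" using s3 by (simp add: power2_eq_square mult.assoc[symmetric])
      finally show ?thesis using 1 by linarith
    qed
    moreover have "\<beta> * y > 0"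
    proof -
      have "sqrt 3 * (\<alpha> * x) < sqrt 3 * (sqrt 3 * (\<beta> * y))" using 1 s3 by (intro mult_strict_left_mono) auto
      also have "\<dots> = 3 * (\<beta> * y)" using s3 by (simp add: power2_eq_square mult.assoc[symmetric])
      finally show ?thesis using 1 by linarith
    qed
    ultimately have xy: "x > 0" "y > 0" using ab by (simp_all add: zero_less_mult_iff)
    have "(\<alpha> * x)\<^sup>2 < (sqrt 3 * (\<beta> * y))\<^sup>2" "(\<beta> * y)\<^sup>2 < (sqrt 3 * (\<alpha> * x))\<^sup>2"
      using 1 xy ab by (intro power_strict_mono; simp)+
    thus "(x, y) \<in> S" using xy h(3) s3 ab by (simp add: S_def power_mult_distrib)
  qed
  have outer: "S \<subseteq> {x. u \<bullet> x \<ge> 0 \<and> v \<bullet> x \<ge> 0 \<and> f x \<le> 1}"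
  proof safe
    fix x y assume h: "(x, y) \<in> S"
    have "(\<alpha> * x)\<^sup>2 \<le> (sqrt 3 * (\<beta> * y))\<^sup>2" "(\<beta> * y)\<^sup>2 \<le> (sqrt 3 * (\<alpha> * x))\<^sup>2"
      using h ab by (auto simp: S_def power_mult_distrib)
    moreover have "0 \<le> sqrt 3 * (\<beta> * y)" "0 \<le> sqrt 3 * (\<alpha> * x)" using h ab by (simp_all add: S_def)
    ultimately have "\<alpha> * x \<le> sqrt 3 * (\<beta> * y)" "\<beta> * y \<le> sqrt 3 * (\<alpha> * x)"
      using power2_le_imp_le by blast+
    thus "u \<bullet> (x, y) \<ge> 0" "v \<bullet> (x, y) \<ge> 0" by (auto simp: u_def v_def algebra_simps)
    show "f (x, y) \<le> 1" using h by (simp add: S_def)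
  qed
  have cont: "continuous_on UNIV f" unfolding f_def by (intro continuous_intros)
  have neg: "negligible (frontier S)"
    by (rule negligible_frontier_sector[OF cont _ _ _ inner outer]) (use ab in \<open>auto simp: f_def power2_eq_square u_def v_def zero_prod_def\<close>)
  have bnd: "bounded S"
  proof -
    have "S \<subseteq> cbox (0, 0) (3 * of_int B, 3 * of_int A)"
    proof (rule subrelI)
      fix x y assume h: "(x, y) \<in> S"
      hence xy: "x > 0" "y > 0" "x * y \<le> 1" by (auto simp: S_def f_def)
      have ge1: "1 \<le> (of_int A :: real)" "1 \<le> (of_int B::real)" using A B by simp_all
      \<comment> \<open>The fourth power of \<open>x\<close> is at most
        \<open>K * (x * y)\<^sup>2\<close>, hence at most \<open>K\<close>.\<close>
      have k: "x \<le> K" if "x > 0" "y > 0" "x * y \<le> 1" "x\<^sup>2 \<le> K * y\<^sup>2" "K \<ge> 1" for x y K :: real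
      proof (rule power2_le_imp_le)
        have "(x\<^sup>2)\<^sup>2 = x\<^sup>2 * x\<^sup>2" by (simp add: power2_eq_square)
        also have "\<dots> \<le> x\<^sup>2 * (K * y\<^sup>2)" using that by (intro mult_left_mono) auto
        also have "\<dots> = K * (x * y)\<^sup>2" by (simp add: power_mult_distrib)
        also have "\<dots> \<le> K * 1" using that by (intro mult_left_mono power_le_one) auto
        also have "\<dots> \<le> K\<^sup>2" using that by (simp add: power2_eq_square)
        finally have "x\<^sup>2 \<le> K" by (rule power2_le_imp_le) (use that in auto)
        also have "\<dots> \<le> K\<^sup>2" using that by (simp add: power2_eq_square)
        finally show "x\<^sup>2 \<le> K\<^sup>2" .
      qed (use that in auto)
      have "x\<^sup>2 \<le> of_int A * x\<^sup>2" "y\<^sup>2 \<le> of_int B * y\<^sup>2" using ge1 by (simp_all add: mult_le_cancel_right1)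
      moreover have "of_int A * x\<^sup>2 < 3 * of_int B * y\<^sup>2" "of_int B * y\<^sup>2 < 3 * of_int A * x\<^sup>2" using h by (simp_all add: S_def)
      ultimately have "x\<^sup>2 \<le> (3 * of_int B) * y\<^sup>2" "y\<^sup>2 \<le> (3 * of_int A) * x\<^sup>2" by linarith+
      hence "x \<le> 3 * of_int B" "y \<le> 3 * of_int A"
        using xy ge1 by (intro k[of x y]; simp; fail | intro k[of y x]; simp add: mult.commute; fail)+
      thus "(x, y) \<in> cbox (0, 0) (3 * of_int B, 3 * of_int A)" using xy by (auto simp: cbox_Pair_eq)
    qed
    thus ?thesis by (rule bounded_subset[OF bounded_cbox])
  qed
  have pos: "measure lebesgue S > 0"
  proof (rule measure_pos_if_open_subset[OF measurable_Jordan[OF bnd neg] _ inner])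
    show "open {x. u \<bullet> x > 0 \<and> v \<bullet> x > 0 \<and> f x < 1}"
      using cont by (intro open_Collect_conj open_Collect_less continuous_intros)
    \<comment> \<open>The ray \<open>\<alpha> x = \<beta> y\<close> runs inside the sector, and
      \<open>e\<close> shrinks its point \<open>(\<beta>, \<alpha>)\<close> below the
      hyperbola.\<close>
    define e where "e = 1 / (1 + \<alpha> * \<beta>)"
    have ab0: "\<alpha> * \<beta> > 0" "1 + \<alpha> * \<beta> > 0" using mult_pos_pos[OF ab(1,2)] by linarith+
    hence e: "e > 0" "e \<le> 1" by (auto simp: e_def divide_le_eq_1)
    have "e * (e * (\<alpha> * \<beta>)) \<le> 1 * (e * (\<alpha> * \<beta>))" using e ab by (intro mult_right_mono) auto
    also have "\<dots> < 1" using ab0 by (simp add: e_def divide_less_eq)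
    finally have "e * (e * (\<alpha> * \<beta>)) < 1" .
    moreover have "\<alpha> * \<beta> * e < sqrt 3 * (\<alpha> * \<beta> * e)" using ab e s3 by simp
    ultimately have "(e * \<beta>, e * \<alpha>) \<in> {x. u \<bullet> x > 0 \<and> v \<bullet> x > 0 \<and> f x < 1}"
      by (auto simp: u_def v_def f_def mult_ac)
    thus "{x. u \<bullet> x > 0 \<and> v \<bullet> x > 0 \<and> f x < 1} \<noteq> {}" by blast
  qed
  have "has_density (\<lambda>z. nat (fst z * snd z)) (residue_points m c \<inter> ratio_sector A B) (measure lebesgue S / (of_int m)\<^sup>2)" if "m > 0" for m c
  proof (rule has_density_region[OF bnd neg that, where c = c])
    show "1 \<le> nat (fst z * snd z)" if "z \<in> residue_points m c \<inter> ratio_sector A B" for z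
    proof -
      have "0 < fst z * snd z" using that by (intro mult_pos_pos) (simp_all add: ratio_sector_def)
      thus ?thesis by linarith
    qed
    show "{z \<in> residue_points m c \<inter> ratio_sector A B. nat (fst z * snd z) \<le> n} =
         {z \<in> residue_points m c. scaled_point (sqrt (real n)) z \<in> S}" if n: "n \<ge> 1" for n
    proof -
      have "z \<in> ratio_sector A B \<and> nat (fst z * snd z) \<le> n \<longleftrightarrow> scaled_point (sqrt (real n)) z \<in> S" for z
      proof -
        obtain x y where z: "z = (x, y)" by (cases z)
        have n0: "real n > 0" using n by simp
        have i: "A * x\<^sup>2 < 3 * B * y\<^sup>2 \<longleftrightarrow> of_int A * (of_int x)\<^sup>2 < (3 * of_int B * (of_int y)\<^sup>2 :: real)" for A B x y
        proof -
          have "of_int A * (of_int x)\<^sup>2 = (of_int (A * x\<^sup>2) :: real)" "3 * of_int B * (of_int y)\<^sup>2 = (of_int (3 * B * y\<^sup>2) :: real)"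
            by simp_all
          thus ?thesis by (simp only: of_int_less_iff)
        qed
        have "nat (x * y) \<le> n \<longleftrightarrow> of_int x * of_int y \<le> real n"
        proof -
          have "of_int x * of_int y = (of_int (x * y) :: real)" "real n = of_int (int n)" by simp_all
          thus ?thesis by (simp only: of_int_le_iff nat_le_iff)
        qed
        moreover have "(of_int x / sqrt n)\<^sup>2 = (of_int x)\<^sup>2 / n" for x using n0 by (simp add: power_divide)
        moreover have "of_int x / sqrt n * (of_int y / sqrt n) = of_int x * of_int y / n"
          using n0 by simp
        ultimately show ?thesis using n0
          by (simp add: ratio_sector_def scaled_point_def S_def f_def z i divide_less_cancel zero_less_divide_iff)
      qed
      thus ?thesis by blast
    qed
  qed
  thus ?thesis using pos by blast
qed

section \<open>Positive definite integral binary quadratic forms\<close>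

locale binary_form =
  fixes a b c :: int
  assumes a_pos: "a > 0" and disc_pos: "a * c - b\<^sup>2 > 0"
begin

definition D :: int where "D = a * c - b\<^sup>2"

definition B :: "int \<times> int \<Rightarrow> int \<times> int \<Rightarrow> int" where
  "B z w = a * fst z * fst w + b * (fst z * snd w + snd z * fst w) + c * snd z * snd w"

definition Q :: "int \<times> int \<Rightarrow> int" where
  "Q z = a * (fst z)\<^sup>2 + 2 * b * fst z * snd z + c * (snd z)\<^sup>2"

definition RQ :: "real \<times> real \<Rightarrow> real" where
  "RQ z = of_int a * (fst z)\<^sup>2 + 2 * of_int b * fst z * snd z + of_int c * (snd z)\<^sup>2"

lemma D_pos: "D > 0" using disc_pos by (simp add: D_def)

lemma c_pos: "c > 0"
proof -
  have "a * c > 0" using disc_pos zero_le_power2[of b] by linarith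
  thus ?thesis using a_pos by (simp add: zero_less_mult_iff)
qed

text \<open>Completing the square gives \<open>a * RQ z = (a x + b y)\<^sup>2 + D y\<^sup>2\<close>,
  and \<open>D \<ge> 1\<close> because it is a positive integer.\<close>

lemma RQ_bounds: "(snd z)\<^sup>2 \<le> of_int a * RQ z" "(fst z)\<^sup>2 \<le> of_int c * RQ z"
proof -
  have D1: "of_int D \<ge> (1::real)" using D_pos by simp
  have Dr: "of_int D = (of_int a * of_int c - (of_int b)\<^sup>2 :: real)" by (simp add: D_def)
  have "of_int a * RQ z = (of_int a * fst z + of_int b * snd z)\<^sup>2 + of_int D * (snd z)\<^sup>2"
       "of_int c * RQ z = (of_int b * fst z + of_int c * snd z)\<^sup>2 + of_int D * (fst z)\<^sup>2"
    by (simp_all add: RQ_def Dr power2_eq_square algebra_simps)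
  moreover have "(snd z)\<^sup>2 \<le> of_int D * (snd z)\<^sup>2" "(fst z)\<^sup>2 \<le> of_int D * (fst z)\<^sup>2"
    using D1 by (simp_all add: mult_le_cancel_right1)
  moreover have "0 \<le> (of_int a * fst z + of_int b * snd z)\<^sup>2" "0 \<le> (of_int b * fst z + of_int c * snd z)\<^sup>2" by auto
  ultimately show "(snd z)\<^sup>2 \<le> of_int a * RQ z" "(fst z)\<^sup>2 \<le> of_int c * RQ z" by linarith+
qed

lemma Q_pos: assumes "z \<noteq> (0,0)" shows "Q z > 0"
proof -
  have aQ: "a * Q z = (a * fst z + b * snd z)\<^sup>2 + D * (snd z)\<^sup>2"
    by (simp add: Q_def D_def power2_eq_square algebra_simps)
  have "a * Q z > 0"
  proof (cases "snd z = 0")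
    case True
    hence "fst z \<noteq> 0" using assms by (cases z) auto
    thus ?thesis using True a_pos by (simp add: aQ)
  next
    case False
    hence "D * (snd z)\<^sup>2 > 0" using D_pos by simp
    thus ?thesis unfolding aQ using zero_le_power2[of "a * fst z + b * snd z"] by linarith
  qed
  thus ?thesis using a_pos by (simp add: zero_less_mult_iff)
qed

lemma Q_zero [simp]: "Q (0,0) = 0" by (simp add: Q_def)

lemma Q_nonneg: "Q z \<ge> 0" using Q_pos[of z] by (cases "z = (0,0)") auto

lemma RQ_ellipse:
  fixes A :: "(real \<times> real) set" and t :: real and z :: "real \<times> real"
  shows "bounded {z. RQ z \<le> 1}" "continuous_on A RQ" "RQ (t *\<^sub>R z) = t\<^sup>2 * RQ z"
    "negligible (frontier {z. RQ z \<le> 1})"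
proof -
  have "{z. RQ z \<le> 1} \<subseteq> cbox (- of_int c, - of_int a) (of_int c, of_int a)"
  proof (rule subrelI)
    fix x y assume "(x, y) \<in> {z. RQ z \<le> 1}"
    hence h: "RQ (x, y) \<le> 1" by simp
    have ac1: "of_int a \<ge> (1::real)" "of_int c \<ge> (1::real)" using a_pos c_pos by simp_all
    have k: "\<bar>x\<bar> \<le> k" if "x\<^sup>2 \<le> k * r" "r \<le> 1" "k \<ge> 1" for x k r :: real
    proof (rule power2_le_imp_le)
      have "x\<^sup>2 \<le> k * r" by fact
      also have "\<dots> \<le> k * k" using that by (intro mult_left_mono) auto
      finally show "\<bar>x\<bar>\<^sup>2 \<le> k\<^sup>2" by (simp add: power2_eq_square)
    qed (use that in auto)
    have "\<bar>x\<bar> \<le> of_int c" "\<bar>y\<bar> \<le> of_int a"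
      using k[OF RQ_bounds(2)[of "(x,y)", simplified] h] k[OF RQ_bounds(1)[of "(x,y)", simplified] h] ac1 by auto
    thus "(x, y) \<in> cbox (- of_int c, - of_int a) (of_int c, of_int a)" by (auto simp: cbox_Pair_eq)
  qed
  thus "bounded {z. RQ z \<le> 1}" by (rule bounded_subset[OF bounded_cbox])
  have cont: "continuous_on A RQ" for A unfolding RQ_def by (intro continuous_intros)
  show "continuous_on A RQ" by (rule cont)
  have h: "RQ (t *\<^sub>R z) = t\<^sup>2 * RQ z" for t z by (simp add: RQ_def power2_eq_square algebra_simps)
  show "RQ (t *\<^sub>R z) = t\<^sup>2 * RQ z" by (rule h)
  have "negligible {x. RQ x = 1}" by (rule negligible_level_set[OF cont h])
  hence "negligible ({x. RQ x \<le> 1} - {x. RQ x < 1})" by (rule negligible_subset) auto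
  thus "negligible (frontier {z. RQ z \<le> 1})"
    by (intro negligible_frontier_between[of "{x. RQ x < 1}" "{x. RQ x \<le> 1}"] open_Collect_less closed_Collect_le cont continuous_intros) auto
qed

lemma RQ_scaled_point: "n > 0 \<Longrightarrow> RQ (scaled_point (sqrt (real n)) z) = of_int (Q z) / real n"
  by (simp add: scaled_point_def RQ_def Q_def power_divide add_divide_distrib)

lemma RQ_scaled_point_le: "n > 0 \<Longrightarrow> RQ (scaled_point (sqrt (real n)) z) \<le> 1 \<longleftrightarrow> nat (Q z) \<le> n"
proof -
  assume "n > 0"
  hence "RQ (scaled_point (sqrt (real n)) z) \<le> 1 \<longleftrightarrow> of_int (Q z) \<le> real n" by (simp add: RQ_scaled_point)
  also have "\<dots> \<longleftrightarrow> Q z \<le> int n" by (metis of_int_le_iff of_int_of_nat_eq)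
  finally show ?thesis by (simp add: nat_le_iff)
qed

text \<open>Serves the hexagonal sublattices, which inject into the nonzero vectors. The origin is
  deleted because a density is defined only for values at least 1; this adds one point to the
  frontier of the ellipse.\<close>

lemma form_density_nonzero: "\<exists>\<kappa>. has_density (\<lambda>z. nat (Q z)) {z. z \<noteq> (0,0)} \<kappa>"
proof (rule exI, rule has_density_region[where m = 1 and c = "(0,0)" and S = "{z. RQ z \<le> 1} - {0}"])
  show "bounded ({z. RQ z \<le> 1} - {0})" using RQ_ellipse(1) by (rule bounded_subset) auto
  have "frontier ({z. RQ z \<le> 1} - {0}) \<subseteq> frontier {z. RQ z \<le> 1} \<union> frontier (- {0})"
    unfolding Diff_eq by (rule order_trans[OF frontier_Int_subset]) auto
  moreover have "negligible (frontier {z. RQ z \<le> 1} \<union> frontier (- {0}))"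
    using RQ_ellipse(4) negligible_subset[OF negligible_sing[of "0::real\<times>real"] frontier_subset_closed]
    by (simp add: frontier_complement negligible_Un)
  ultimately show "negligible (frontier ({z. RQ z \<le> 1} - {0}))" by (rule negligible_subset[rotated])
  show "1 \<le> nat (Q z)" if "z \<in> {z. z \<noteq> (0,0)}" for z using Q_pos[of z] that by simp
  show "{z \<in> {z. z \<noteq> (0, 0)}. nat (Q z) \<le> n} = {z \<in> residue_points 1 (0,0). scaled_point (sqrt (real n)) z \<in> {z. RQ z \<le> 1} - {0}}"
    if "n \<ge> 1" for n
    using that by (auto simp: RQ_scaled_point_le residue_points_def) (auto simp: scaled_point_def zero_prod_def prod_eq_iff)
qed auto

text \<open>
  The orthogonal vector \<open>(- (b x + c y), a x + b y)\<close> of \<open>(x, y)\<close> defines a quarter turn for the form;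
  \<open>quad\<close> is a fundamental domain for its powers.
\<close>

definition quad :: "int \<times> int \<Rightarrow> bool" where
  "quad z \<longleftrightarrow> a * fst z + b * snd z > 0 \<and> snd z \<ge> 0"

lemma quad_density:
  obtains \<kappa> where "\<kappa> > 0" "\<And>m cc. m > 0 \<Longrightarrow> has_density (\<lambda>z. nat (Q z)) {z \<in> residue_points m cc. quad z} (\<kappa> / (of_int m)\<^sup>2)"
proof -
  define S where "S = {z. of_int a * fst z + of_int b * snd z > 0 \<and> snd z \<ge> 0 \<and> RQ z \<le> 1}"
  define u v :: "real \<times> real" where "u = (of_int a, of_int b)" and "v = (0, 1)"
  have inner: "{x. u \<bullet> x > 0 \<and> v \<bullet> x > 0 \<and> RQ x < 1} \<subseteq> S" and outer: "S \<subseteq> {x. u \<bullet> x \<ge> 0 \<and> v \<bullet> x \<ge> 0 \<and> RQ x \<le> 1}"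
    by (auto simp: S_def u_def v_def)
  have neg: "negligible (frontier S)"
    by (rule negligible_frontier_sector[OF RQ_ellipse(2) RQ_ellipse(3) _ _ inner outer]) (use a_pos in \<open>auto simp: u_def v_def zero_prod_def\<close>)
  have bnd: "bounded S" by (rule bounded_subset[OF RQ_ellipse(1)]) (auto simp: S_def)
  have pos: "measure lebesgue S > 0"
  proof (rule measure_pos_if_open_subset[OF measurable_Jordan[OF bnd neg] _ inner])
    show "open {x. u \<bullet> x > 0 \<and> v \<bullet> x > 0 \<and> RQ x < 1}"
      using RQ_ellipse(2) by (intro open_Collect_conj open_Collect_less continuous_intros)
    \<comment> \<open>The coordinate \<open>\<bar>b\<bar> + 1\<close> outweighs a negative
      \<open>b\<close>, so \<open>p\<close> lies inside the sector; scaling by \<open>e\<close>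
      below moves it into the ellipse.\<close>
    define p :: "real \<times> real" where "p = (\<bar>of_int b\<bar> + 1, 1)"
    have p: "u \<bullet> p > 0" "v \<bullet> p > 0"
    proof -
      have "\<bar>of_int b :: real\<bar> + 1 \<le> of_int a * (\<bar>of_int b\<bar> + 1)"
        using a_pos mult_right_mono[of 1 "of_int a" "\<bar>of_int b :: real\<bar> + 1"] by simp
      moreover have "\<bar>of_int b :: real\<bar> + 1 + of_int b > 0" by linarith
      ultimately show "u \<bullet> p > 0" by (auto simp: u_def p_def)
    qed (auto simp: v_def p_def)
    have "0 \<le> of_int a * RQ p" by (rule order_trans[OF zero_le_power2 RQ_bounds(1)])
    hence R: "RQ p \<ge> 0" using a_pos by (simp add: zero_le_mult_iff)
    define e where "e = 1 / (1 + RQ p)"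
    have e: "e > 0" "e \<le> 1" using R by (auto simp: e_def)
    have "e * (e * RQ p) \<le> 1 * (e * RQ p)" using e R by (intro mult_right_mono) auto
    also have "\<dots> < 1" using R by (simp add: e_def field_simps)
    finally have "RQ (e *\<^sub>R p) < 1" unfolding RQ_ellipse(3) by (simp add: power2_eq_square mult.assoc)
    hence "e *\<^sub>R p \<in> {x. u \<bullet> x > 0 \<and> v \<bullet> x > 0 \<and> RQ x < 1}" using e p by simp
    thus "{x. u \<bullet> x > 0 \<and> v \<bullet> x > 0 \<and> RQ x < 1} \<noteq> {}" by blast
  qed
  have "has_density (\<lambda>z. nat (Q z)) {z \<in> residue_points m cc. quad z} (measure lebesgue S / (of_int m)\<^sup>2)" if "m > 0" for m cc
  proof (rule has_density_region[OF bnd neg that, where c = cc])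
    show "1 \<le> nat (Q z)" if "z \<in> {z \<in> residue_points m cc. quad z}" for z
      using that Q_pos[of z] by (cases "z = (0,0)") (auto simp: quad_def)
    show "{z \<in> {z \<in> residue_points m cc. quad z}. nat (Q z) \<le> n} =
         {z \<in> residue_points m cc. scaled_point (sqrt (real n)) z \<in> S}" if n: "n \<ge> 1" for n
    proof -
      have "quad z \<and> nat (Q z) \<le> n \<longleftrightarrow> scaled_point (sqrt (real n)) z \<in> S" for z
      proof -
        have n0: "real n > 0" using n by simp
        have "of_int a * (of_int (fst z) / sqrt n) + of_int b * (of_int (snd z) / sqrt n) = of_int (a * fst z + b * snd z) / sqrt n"
          by (simp add: add_divide_distrib)
        hence "of_int a * fst (scaled_point (sqrt n) z) + of_int b * snd (scaled_point (sqrt n) z) > 0 \<longleftrightarrow> a * fst z + b * snd z > 0"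
          using n0 unfolding scaled_point_def fst_conv snd_conv by (simp only: zero_less_divide_iff of_int_0_less_iff) auto
        moreover have "snd (scaled_point (sqrt n) z) \<ge> 0 \<longleftrightarrow> snd z \<ge> 0" using n0 by (simp add: scaled_point_def zero_le_divide_iff)
        ultimately show ?thesis using n RQ_scaled_point_le[of n z] by (simp add: S_def quad_def)
      qed
      thus ?thesis by blast
    qed
  qed
  thus ?thesis using pos that by blast
qed

end

section \<open>Primitive vectors in residue classes\<close>


definition scale :: "int \<Rightarrow> int \<times> int \<Rightarrow> int \<times> int" where
  "scale d z = (d * fst z, d * snd z)"

definition prim :: "int \<times> int \<Rightarrow> bool" where
  "prim z \<longleftrightarrow> coprime (fst z) (snd z)"

lemma scale_1 [simp]: "scale 1 z = z" by (simp add: scale_def)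

lemma scale_prim_unique:
  assumes "scale d z = scale d' z'" "prim z" "prim z'" "d > 0" "d' > 0"
  shows "d = d'" "z = z'"
proof -
  have g: "gcd (d * fst w) (d * snd w) = d" if "prim w" "d > 0" for d w
    using that by (simp add: gcd_mult_left prim_def)
  have "gcd (fst (scale d z)) (snd (scale d z)) = d" "gcd (fst (scale d' z')) (snd (scale d' z')) = d'"
    using assms g[of z d] g[of z' d'] by (simp_all add: scale_def)
  thus "d = d'" using assms(1) by metis
  thus "z = z'" using assms by (auto simp: scale_def prod_eq_iff)
qed

lemma ex_scale_prim:
  assumes "z \<noteq> (0,0)"
  obtains d w where "d > 0" "prim w" "z = scale d w"
proof -
  define d where "d = gcd (fst z) (snd z)"
  have d: "d > 0" using assms by (cases z) (auto simp: d_def)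
  define w where "w = (fst z div d, snd z div d)"
  have "z = scale d w" by (cases z) (simp add: scale_def w_def d_def)
  moreover have "prim w" unfolding prim_def w_def d_def fst_conv snd_conv
    using assms by (intro div_gcd_coprime) (cases z; auto)
  ultimately show ?thesis using d that by blast
qed

text \<open>Only such classes can contain primitive vectors: a common divisor of both coordinates
  and the modulus divides every vector of the class.\<close>

definition unit_class :: "int \<Rightarrow> int \<times> int \<Rightarrow> bool" where
  "unit_class m c \<longleftrightarrow> gcd (gcd (fst c) (snd c)) m = 1"

text \<open>A common divisor of \<open>d\<close> and \<open>m\<close> would divide both coordinates
  of \<open>c\<close>.\<close>

lemma scale_residue_not_coprime:
  assumes "unit_class m c" "\<not> coprime d m"
  shows "scale d z \<notin> residue_points m c"
proof
  assume r: "scale d z \<in> residue_points m c"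
  define g where "g = gcd d m"
  have g: "g dvd d" "g dvd m" by (auto simp: g_def)
  have "m dvd d * fst z - fst c" "m dvd d * snd z - snd c"
    using r by (auto simp: residue_points_def scale_def mod_eq_dvd_iff)
  hence "g dvd d * fst z - fst c" "g dvd d * snd z - snd c" using g dvd_trans by blast+
  moreover have "g dvd d * fst z" "g dvd d * snd z" using g by auto
  ultimately have "g dvd fst c" "g dvd snd c"
    by (metis dvd_diff_right_iff)+
  hence "g dvd gcd (gcd (fst c) (snd c)) m" using g by simp
  hence "g dvd 1" using assms(1) unfolding unit_class_def by (simp only:)
  hence "g = 1" by (simp add: g_def)
  thus False using assms(2) by (simp add: g_def coprime_iff_gcd_eq_1)
qed

text \<open>Modulo \<open>m\<close>, division by \<open>d\<close> is multiplication by its inverse,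
  which sends unit classes to unit classes.\<close>

lemma scale_residue_coprime:
  assumes "unit_class m c" "coprime d m" "m > 0"
  obtains c' where "c' \<in> {0..<m} \<times> {0..<m}" "unit_class m c'"
    "\<And>z. scale d z \<in> residue_points m c \<longleftrightarrow> z \<in> residue_points m c'"
proof -
  obtain e where "[d * e = 1] (mod m)" using cong_solve_coprime_int[OF assms(2)] by blast
  hence e: "d * e mod m = 1 mod m" by (simp add: cong_def)
  define c' where "c' = ((e * fst c) mod m, (e * snd c) mod m)"
  have key: "d * x mod m = y mod m \<longleftrightarrow> x mod m = (e * y) mod m" for x y
  proof
    assume "d * x mod m = y mod m"
    hence "(e * y) mod m = (e * (d * x)) mod m" by (metis mod_mult_right_eq)
    also have "e * (d * x) = (d * e) * x" by simp
    also have "(d * e) * x mod m = (d * e mod m) * x mod m" by (rule mod_mult_left_eq[symmetric])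
    also have "\<dots> = x mod m" unfolding e by (simp add: mod_mult_left_eq)
    finally show "x mod m = (e * y) mod m" by simp
  next
    assume "x mod m = (e * y) mod m"
    hence "d * x mod m = d * (e * y) mod m" by (metis mod_mult_right_eq)
    also have "d * (e * y) = (d * e) * y" by simp
    also have "(d * e) * y mod m = (d * e mod m) * y mod m" by (rule mod_mult_left_eq[symmetric])
    also have "\<dots> = y mod m" unfolding e by (simp add: mod_mult_left_eq)
    finally show "d * x mod m = y mod m" .
  qed
  have iff: "scale d z \<in> residue_points m c \<longleftrightarrow> z \<in> residue_points m c'" for z
    by (simp add: residue_points_def scale_def c'_def key)
  have "unit_class m c'"
  proof -
    define g where "g = gcd (gcd (fst c') (snd c')) m"
    have g: "g dvd fst c'" "g dvd snd c'" "g dvd m"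
      unfolding g_def by (rule dvd_trans[OF gcd_dvd1 gcd_dvd1] dvd_trans[OF gcd_dvd1 gcd_dvd2] gcd_dvd2)+
    have "scale d c' \<in> residue_points m c" unfolding iff by (simp add: residue_points_def)
    hence "m dvd d * fst c' - fst c" "m dvd d * snd c' - snd c"
      by (auto simp: residue_points_def scale_def mod_eq_dvd_iff)
    hence "g dvd d * fst c' - fst c" "g dvd d * snd c' - snd c" using g dvd_trans by blast+
    moreover have "g dvd d * fst c'" "g dvd d * snd c'" using g by auto
    ultimately have "g dvd fst c" "g dvd snd c" by (metis dvd_diff_right_iff)+
    hence "g dvd gcd (gcd (fst c) (snd c)) m" using g by simp
    hence "g dvd 1" using assms(1) unfolding unit_class_def by (simp only:)
    thus ?thesis by (simp add: g_def unit_class_def)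
  qed
  moreover have "c' \<in> {0..<m} \<times> {0..<m}" using assms(3) by (auto simp: c'_def)
  ultimately show ?thesis using iff that by blast
qed

text \<open>The sum of these terms is the zeta function at \<open>2 * s\<close> without the Euler
  factors at the primes dividing \<open>m\<close>; the index \<open>k\<close> stands for the
  multiplier \<open>Suc k\<close>.\<close>

definition coprime_zeta_term :: "int \<Rightarrow> real \<Rightarrow> nat \<Rightarrow> real" where
  "coprime_zeta_term m s k = (if coprime (int (Suc k)) m then real (Suc k) powr (-2 * s) else 0)"

lemma coprime_zeta_term_bounds:
  assumes "s \<ge> 1"
  shows "0 \<le> coprime_zeta_term m s k" "coprime_zeta_term m s k \<le> 1 / (real k + 1)\<^sup>2"
proof -
  have "real (Suc k) powr (-2 * s) \<le> real (Suc k) powr (-2)" using assms by (intro powr_mono) auto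
  also have "\<dots> = 1 / (real k + 1)\<^sup>2" by (simp add: powr_minus_divide powr_numeral add_ac)
  finally show "coprime_zeta_term m s k \<le> 1 / (real k + 1)\<^sup>2" by (simp add: coprime_zeta_term_def)
qed (simp add: coprime_zeta_term_def)

definition coprime_zeta :: "int \<Rightarrow> real \<Rightarrow> real" where
  "coprime_zeta m s = (\<Sum>k. coprime_zeta_term m s k)"

lemma coprime_zeta_sums: "s \<ge> 1 \<Longrightarrow> coprime_zeta_term m s sums coprime_zeta m s"
  unfolding coprime_zeta_def using coprime_zeta_term_bounds[of s m]
  by (intro summable_sums summable_comparison_test'[OF sums_summable[OF inverse_squares_sums], of 0]) (auto simp: add_ac)

text \<open>The decisive point is an upper bound below 2: the multiplier 1 then outweighs all others
  together, with contraction factor \<open>3/4\<close>. The bound is \<open>pi\<^sup>2 / 6\<close>,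
  rounded up through an estimate of \<open>pi\<close> by 3.2.\<close>

lemma coprime_zeta_bounds:
  assumes "s \<ge> 1" shows "1 \<le> coprime_zeta m s" "coprime_zeta m s \<le> 7/4"
proof -
  have "(\<Sum>k<1. coprime_zeta_term m s k) \<le> coprime_zeta m s"
    unfolding coprime_zeta_def by (intro sum_le_suminf sums_summable[OF coprime_zeta_sums[OF assms]])
      (use coprime_zeta_term_bounds[OF assms] in auto)
  thus "1 \<le> coprime_zeta m s" by (simp add: coprime_zeta_term_def)
  have "coprime_zeta m s \<le> pi\<^sup>2 / 6"
    by (rule sums_le[OF _ coprime_zeta_sums[OF assms] inverse_squares_sums])
      (use coprime_zeta_term_bounds[OF assms] in \<open>auto simp: add_ac\<close>)
  also have "pi\<^sup>2 \<le> (32/10)\<^sup>2" using pi_approx by (intro power_mono) auto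
  hence "pi\<^sup>2 / 6 \<le> 7/4" by (simp add: power2_eq_square)
  finally show "coprime_zeta m s \<le> 7/4" .
qed

lemma coprime_zeta_tendsto: "(coprime_zeta m \<longlongrightarrow> coprime_zeta m 1) (at_right 1)"
proof -
  have "eventually (\<lambda>(k,s). norm (coprime_zeta_term m s k) \<le> 1 / (real k + 1)\<^sup>2) (at_top \<times>\<^sub>F at_right 1)"
    unfolding eventually_prod_filter
    by (rule exI[of _ "\<lambda>_. True"], rule exI[of _ "\<lambda>s. s > 1"])
       (use coprime_zeta_term_bounds in \<open>auto simp: eventually_at_right_less\<close>)
  moreover have "((\<lambda>s. coprime_zeta_term m s k) \<longlongrightarrow> coprime_zeta_term m 1 k) (at_right 1)" for k
    unfolding coprime_zeta_term_def by (cases "coprime (int (Suc k)) m") (auto intro!: tendsto_eq_intros)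
  moreover have "summable (\<lambda>k. 1 / (real k + 1)\<^sup>2)" using sums_summable[OF inverse_squares_sums] by (simp add: add_ac)
  ultimately show ?thesis
    using tannerys_theorem[of "\<lambda>k s. coprime_zeta_term m s k" "coprime_zeta_term m 1" "at_right 1" "\<lambda>k. 1 / (real k + 1)\<^sup>2"]
    unfolding coprime_zeta_def by auto
qed

context binary_form
begin

lemma Q_scale: "Q (scale d z) = d\<^sup>2 * Q z"
  by (simp add: Q_def scale_def power2_eq_square algebra_simps)

lemma quad_scale: "d > 0 \<Longrightarrow> quad (scale d z) \<longleftrightarrow> quad z"
proof -
  assume d: "d > 0"
  have eq: "a * (d * fst z) + b * (d * snd z) = d * (a * fst z + b * snd z)" by (simp add: algebra_simps)
  show ?thesis unfolding quad_def scale_def fst_conv snd_conv eq using d by (simp add: zero_less_mult_iff zero_le_mult_iff)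
qed

lemma quad_nonzero: "quad z \<Longrightarrow> z \<noteq> (0,0)" by (auto simp: quad_def)

definition prim_quad :: "(int \<times> int) set" where
  "prim_quad = {z. prim z \<and> quad z}"

definition prim_series :: "int \<Rightarrow> int \<times> int \<Rightarrow> real \<Rightarrow> real" where
  "prim_series m cc s = infsum (\<lambda>z. real (nat (Q z)) powr -s) (prim_quad \<inter> residue_points m cc)"

lemma quad_summable: "s > 1 \<Longrightarrow> (\<lambda>z. real (nat (Q z)) powr -s) summable_on {z. quad z}"
proof -
  assume s: "s > 1"
  obtain \<kappa> where "\<kappa> > 0" and k: "\<And>m cc. m > 0 \<Longrightarrow> has_density (\<lambda>z. nat (Q z)) {z \<in> residue_points m cc. quad z} (\<kappa> / (of_int m)\<^sup>2)"
    using quad_density by blast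
  show ?thesis using has_density_summable[OF k[of 1 "(0,0)"] s] by (simp add: residue_points_def)
qed

lemma prim_summable: "s > 1 \<Longrightarrow> (\<lambda>z. real (nat (Q z)) powr -s) summable_on (prim_quad \<inter> A)"
  by (rule summable_on_subset[OF quad_summable]) (auto simp: prim_quad_def)

text \<open>A vector of the cone is a unique positive multiple of a primitive vector of the cone,
  and \<open>Q\<close> is homogeneous of degree two. \<open>R\<close> is arbitrary so that residue
  classes, pulled back along scaling, can be inserted.\<close>

lemma quad_series_decompose:
  assumes s: "s > 1"
  shows "(\<lambda>k. real (Suc k) powr (-2 * s) * infsum (\<lambda>z. real (nat (Q z)) powr -s) (prim_quad \<inter> {z. scale (int (Suc k)) z \<in> R}))
    sums infsum (\<lambda>z. real (nat (Q z)) powr -s) {z \<in> R. quad z}"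
proof -
  define X where "X = (\<lambda>k. prim_quad \<inter> {z. scale (int (Suc k)) z \<in> R})"
  define f where "f = (\<lambda>z. real (nat (Q z)) powr -s)"
  have bij: "bij_betw (\<lambda>(k,z). scale (int (Suc k)) z) (Sigma UNIV X) {z \<in> R. quad z}"
    unfolding bij_betw_def
  proof (intro conjI inj_onI)
    fix x y assume xy: "x \<in> Sigma UNIV X" "y \<in> Sigma UNIV X"
      "(case x of (k, z) \<Rightarrow> scale (int (Suc k)) z) = (case y of (k, z) \<Rightarrow> scale (int (Suc k)) z)"
    obtain k z k' z' where e: "x = (k,z)" "y = (k',z')" by (cases x, cases y)
    have "int (Suc k) = int (Suc k')" "z = z'"
      by (rule scale_prim_unique[of "int (Suc k)" z "int (Suc k')" z']; use xy e in \<open>auto simp: X_def prim_quad_def simp del: of_nat_Suc\<close>)+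
    thus "x = y" by (simp add: e)
  next
    show "(\<lambda>(k,z). scale (int (Suc k)) z) ` Sigma UNIV X = {z \<in> R. quad z}"
    proof (intro equalityI subsetI)
      fix z assume "z \<in> (\<lambda>(k,z). scale (int (Suc k)) z) ` Sigma UNIV X"
      thus "z \<in> {z \<in> R. quad z}" by (auto simp: X_def prim_quad_def quad_scale simp del: of_nat_Suc)
    next
      fix z assume z: "z \<in> {z \<in> R. quad z}"
      have "z \<noteq> (0,0)" using z quad_nonzero[of z] by simp
      then obtain d w where d: "d > 0" "prim w" "z = scale d w" using ex_scale_prim by blast
      define k where "k = nat d - 1"
      have k: "d = int (Suc k)" using d by (simp add: k_def)
      have "(k, w) \<in> Sigma UNIV X" using z d k by (auto simp: X_def prim_quad_def quad_scale simp del: of_nat_Suc)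
      thus "z \<in> (\<lambda>(k,z). scale (int (Suc k)) z) ` Sigma UNIV X" using d k by force
    qed
  qed
  have fsc: "f (scale (int (Suc k)) z) = real (Suc k) powr (-2 * s) * f z" for k z
  proof -
    have "real (nat (Q (scale (int (Suc k)) z))) = real (Suc k) ^ 2 * real (nat (Q z))"
      using Q_nonneg[of z] by (simp add: Q_scale nat_mult_distrib nat_power_eq del: of_nat_Suc)
    also have "\<dots> powr -s = (real (Suc k) ^ 2) powr -s * real (nat (Q z)) powr -s"
      by (rule powr_mult)
    also have "(real (Suc k) ^ 2) powr -s = real (Suc k) powr (-2 * s)"
      using powr_powr[of "real (Suc k)" 2 "-s"] by (simp add: powr_numeral)
    finally show ?thesis by (simp add: f_def)
  qed
  have "f summable_on {z \<in> R. quad z}"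
    unfolding f_def by (rule summable_on_subset[OF quad_summable[OF s]]) auto
  hence "(f has_sum infsum f {z \<in> R. quad z}) {z \<in> R. quad z}" by simp
  hence "((\<lambda>(k,z). real (Suc k) powr (-2 * s) * f z) has_sum infsum f {z \<in> R. quad z}) (Sigma UNIV X)"
    using has_sum_reindex_bij_betw[OF bij, of f] fsc by (simp add: case_prod_unfold del: of_nat_Suc)
  moreover have "((\<lambda>z. (\<lambda>(k,z). real (Suc k) powr (-2 * s) * f z) (k, z)) has_sum (real (Suc k) powr (-2 * s) * infsum f (X k))) (X k)" for k
    unfolding split_conv
    by (intro has_sum_cmult_right has_sum_infsum) (simp add: f_def X_def prim_summable s)
  ultimately have "((\<lambda>k. real (Suc k) powr (-2 * s) * infsum f (X k)) has_sum infsum f {z \<in> R. quad z}) UNIV"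
    by (rule has_sum_SigmaD)
  thus ?thesis unfolding X_def f_def by (rule has_sum_imp_sums)
qed

text \<open>
  Writing every vector as a multiple of a primitive one, the residues of the series over all vectors
  of a class are those of the primitive series averaged with weights \<open>d powr -2s\<close>. The weight of
  \<open>d = 1\<close> exceeds the sum of the others, so this averaging is invertible.
\<close>

theorem prim_series_residue:
  assumes m: "m > 0"
  obtains \<rho> where "\<rho> > 0"
    "\<And>cc. unit_class m cc \<Longrightarrow> ((\<lambda>s. (s - 1) * prim_series m cc s) \<longlongrightarrow> \<rho>) (at_right 1)"
proof -
  obtain \<kappa> where k: "\<kappa> > 0" "\<And>m cc. m > 0 \<Longrightarrow> has_density (\<lambda>z. nat (Q z)) {z \<in> residue_points m cc. quad z} (\<kappa> / (of_int m)\<^sup>2)"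
    using quad_density by blast
  define \<kappa>' where "\<kappa>' = \<kappa> / (of_int m)\<^sup>2"
  have k': "\<kappa>' > 0" using k(1) m by (simp add: \<kappa>'_def)
  define H where "H = coprime_zeta m"
  define Z where "Z = (\<lambda>cc s. infsum (\<lambda>z. real (nat (Q z)) powr -s) {z \<in> residue_points m cc. quad z})"
  define V where "V = {cc \<in> {0..<m} \<times> {0..<m}. unit_class m cc}"
  \<comment> \<open>The deviation from the common value that is expected if all unit classes share
    one primitive series: each \<open>Z cc\<close> would then be \<open>H\<close> times that
    series.\<close>
  define err where "err = (\<lambda>s cc. \<bar>(s - 1) * prim_series m cc s - \<kappa>' / H s\<bar>)"
  define dl where "dl = (\<lambda>s. \<Sum>cc\<in>V. \<bar>(s - 1) * Z cc s - \<kappa>'\<bar>)"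
  have finV: "finite V" by (simp add: V_def)
  \<comment> \<open>Every unit class is represented in the finite set \<open>V\<close>, so a maximal
    deviation exists.\<close>
  have rep: "\<exists>c'\<in>V. residue_points m c' = residue_points m cc" if uc: "unit_class m cc" for cc
  proof -
    obtain c' where "c' \<in> {0..<m} \<times> {0..<m}" "unit_class m c'"
      "\<And>z. scale 1 z \<in> residue_points m cc \<longleftrightarrow> z \<in> residue_points m c'"
      using scale_residue_coprime[OF uc _ m, of 1] by (metis coprime_1_left)
    thus ?thesis by (intro bexI[of _ c']) (auto simp: V_def)
  qed
  have Zlim: "((\<lambda>s. (s - 1) * Z cc s) \<longlongrightarrow> \<kappa>') (at_right 1)" for cc
    unfolding Z_def \<kappa>'_def by (rule has_density_residue[OF k(2)[OF m]])
  have dl0: "(dl \<longlongrightarrow> 0) (at_right 1)"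
    unfolding dl_def
    by (rule tendsto_null_sum, rule tendsto_rabs_zero, rule LIM_zero, rule Zlim)
  have main: "err s cc \<le> 4 * dl s" if s: "s > 1" and cc: "cc \<in> V" for s cc
  proof -
    define M where "M = Max (err s ` V)"
    have errM: "err s cc \<le> M" if "cc \<in> V" for cc unfolding M_def using finV that by auto
    have M0: "M \<ge> 0" using errM[OF cc] by (simp add: err_def)
    have H: "1 \<le> H s" "H s \<le> 7/4" using coprime_zeta_bounds[of s m] s by (auto simp: H_def)
    \<comment> \<open>In the decomposition of \<open>Z cc\<close>, the multiplier 1 gives the
      primitive series of \<open>cc\<close> itself; every other nonzero term involves the primitive
      series of some unit class, whose deviation is at most \<open>M\<close>.\<close>
    have step: "err s cc \<le> dl s + (H s - 1) * M" if cc: "cc \<in> V" for cc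
    proof -
      have uc: "unit_class m cc" using cc by (simp add: V_def)
      define P where "P = (\<lambda>k. (s - 1) * infsum (\<lambda>z. real (nat (Q z)) powr -s) (prim_quad \<inter> {z. scale (int (Suc k)) z \<in> residue_points m cc}))"
      define E where "E = (\<lambda>k. P k - \<kappa>' / H s)"
      have P0: "P 0 = (s - 1) * prim_series m cc s" by (simp add: P_def prim_series_def)
      have PE: "real (Suc k) powr (-2 * s) * P k = coprime_zeta_term m s k * P k" for k
      proof (cases "coprime (int (Suc k)) m")
        case False
        have "prim_quad \<inter> {z. scale (int (Suc k)) z \<in> residue_points m cc} = {}"
          using scale_residue_not_coprime[OF uc False] by blast
        hence "P k = 0" unfolding P_def by (simp only: infsum_empty)
        thus ?thesis by simp
      qed (simp add: coprime_zeta_term_def)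
      have "(\<lambda>k. real (Suc k) powr (-2 * s) * P k) sums ((s - 1) * Z cc s)"
        using sums_mult[OF quad_series_decompose[OF s, of "residue_points m cc"], of "s - 1"]
        unfolding P_def Z_def by (simp only: mult.left_commute)
      hence "(\<lambda>k. coprime_zeta_term m s k * P k) sums ((s - 1) * Z cc s)" unfolding PE .
      moreover have "(\<lambda>k. coprime_zeta_term m s k * (\<kappa>' / H s)) sums (H s * (\<kappa>' / H s))"
        unfolding H_def by (intro sums_mult2 coprime_zeta_sums) (use s in simp)
      ultimately have 1: "(\<lambda>k. coprime_zeta_term m s k * E k) sums ((s - 1) * Z cc s - \<kappa>')"
        using sums_diff H by (fastforce simp: E_def algebra_simps)
      have EM: "\<bar>coprime_zeta_term m s k * E k\<bar> \<le> coprime_zeta_term m s k * M" for k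
      proof (cases "coprime (int (Suc k)) m")
        case True
        obtain c' where c': "c' \<in> {0..<m} \<times> {0..<m}" "unit_class m c'"
          "\<And>z. scale (int (Suc k)) z \<in> residue_points m cc \<longleftrightarrow> z \<in> residue_points m c'"
          using scale_residue_coprime[OF uc True m] by blast
        have "P k = (s - 1) * prim_series m c' s" unfolding P_def prim_series_def using c'(3) by simp
        hence "\<bar>E k\<bar> = err s c'" by (simp add: E_def err_def)
        also have "\<dots> \<le> M" using c' by (intro errM) (auto simp: V_def)
        finally show ?thesis using coprime_zeta_term_bounds(1)[of s m k] s by (simp add: abs_mult mult_left_mono)
      qed (simp add: coprime_zeta_term_def)
      have t0: "coprime_zeta_term m s 0 = 1" by (simp add: coprime_zeta_term_def)
      have 2: "(\<lambda>k. coprime_zeta_term m s (Suc k) * E (Suc k)) sums ((s - 1) * Z cc s - \<kappa>' - E 0)"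
        using sums_split_initial_segment[OF 1, of 1] by (simp add: t0)
      have "(\<lambda>k. coprime_zeta_term m s (Suc k)) sums (H s - 1)"
        using sums_split_initial_segment[OF coprime_zeta_sums[of s m], of 1] s by (simp add: t0 H_def)
      hence 3: "(\<lambda>k. coprime_zeta_term m s (Suc k) * M) sums ((H s - 1) * M)" by (rule sums_mult2)
      have "(s - 1) * Z cc s - \<kappa>' - E 0 \<le> (H s - 1) * M"
        by (rule sums_le[OF _ 2 3]) (use EM abs_le_D1 in blast)
      moreover have "-((s - 1) * Z cc s - \<kappa>' - E 0) \<le> (H s - 1) * M"
        by (rule sums_le[OF _ sums_minus[OF 2] 3]) (use EM abs_le_D2 in blast)
      moreover have "\<bar>(s - 1) * Z cc s - \<kappa>'\<bar> \<le> dl s"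
        unfolding dl_def by (rule member_le_sum[OF cc]) (auto simp: finV)
      moreover have "err s cc = \<bar>E 0\<bar>" by (simp add: err_def E_def P0)
      ultimately show ?thesis by linarith
    qed
    \<comment> \<open>At a class attaining the maximum, \<open>step\<close> gives
      \<open>M \<le> dl s + 3/4 * M\<close>.\<close>
    have "M \<in> err s ` V" unfolding M_def using finV cc by (intro Max_in) auto
    then obtain c0 where "c0 \<in> V" "M = err s c0" by auto
    hence "M \<le> dl s + (H s - 1) * M" using step by simp
    moreover have "(H s - 1) * M \<le> 3/4 * M" using H M0 by (intro mult_right_mono) auto
    ultimately have "M \<le> 4 * dl s" by linarith
    thus ?thesis using errM[OF cc] by linarith
  qed
  have H1: "H 1 \<ge> 1" using coprime_zeta_bounds[of 1 m] by (simp add: H_def)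
  have lim: "((\<lambda>s. (s - 1) * prim_series m cc s) \<longlongrightarrow> \<kappa>' / H 1) (at_right 1)" if cc: "unit_class m cc" for cc
  proof -
    obtain c' where c': "c' \<in> V" "residue_points m c' = residue_points m cc" using rep[OF cc] by blast
    have "((\<lambda>s. (s - 1) * prim_series m c' s - \<kappa>' / H s) \<longlongrightarrow> 0) (at_right 1)"
    proof (rule Lim_null_comparison)
      show "\<forall>\<^sub>F s in at_right 1. norm ((s - 1) * prim_series m c' s - \<kappa>' / H s) \<le> 4 * dl s"
        using eventually_at_right_less[of "1::real"] by eventually_elim (use main[OF _ c'(1)] in \<open>auto simp: err_def\<close>)
      show "((\<lambda>s. 4 * dl s) \<longlongrightarrow> 0) (at_right 1)" using tendsto_mult_right_zero[OF dl0, of 4] by simp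
    qed
    moreover have "((\<lambda>s. \<kappa>' / H s) \<longlongrightarrow> \<kappa>' / H 1) (at_right 1)"
      using H1 unfolding H_def by (intro tendsto_divide tendsto_const coprime_zeta_tendsto) auto
    ultimately have "((\<lambda>s. (s - 1) * prim_series m c' s) \<longlongrightarrow> \<kappa>' / H 1) (at_right 1)"
      using tendsto_add by fastforce
    thus ?thesis using c'(2) by (simp add: prim_series_def)
  qed
  show ?thesis by (rule that[of "\<kappa>' / H 1"]) (use k' H1 lim in auto)
qed

end

section \<open>Reduced bases and orthogonal pairs\<close>


definition det2 :: "int \<times> int \<Rightarrow> int \<times> int \<Rightarrow> int" where
  "det2 x y = fst x * snd y - snd x * fst y"

definition intlat :: "int \<times> int \<Rightarrow> int \<times> int \<Rightarrow> (int \<times> int) set" where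
  "intlat x y = range (\<lambda>(k, l). scale k x + scale l y)"

lemma fst_scale [simp]: "fst (scale k x) = k * fst x" and snd_scale [simp]: "snd (scale k x) = k * snd x"
  by (simp_all add: scale_def)

lemma intlatI': "z = scale k x + scale l y \<Longrightarrow> z \<in> intlat x y" by (auto simp: intlat_def)

lemma intlatE: assumes "z \<in> intlat x y" obtains k l where "z = scale k x + scale l y"
  using assms by (auto simp: intlat_def)

lemma intlat_generators [simp]: "x \<in> intlat x y" "y \<in> intlat x y"
  by (rule intlatI'[of _ 1 x 0 y] intlatI'[of _ 0 x 1 y], simp add: prod_eq_iff)+

lemma intlat_subset:
  assumes "x' \<in> intlat x y" "y' \<in> intlat x y" shows "intlat x' y' \<subseteq> intlat x y"
proof
  fix z assume "z \<in> intlat x' y'"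
  then obtain k l where z: "z = scale k x' + scale l y'" by (rule intlatE)
  obtain k1 l1 where x: "x' = scale k1 x + scale l1 y" using assms(1) by (rule intlatE)
  obtain k2 l2 where y: "y' = scale k2 x + scale l2 y" using assms(2) by (rule intlatE)
  show "z \<in> intlat x y"
    by (rule intlatI'[of _ "k * k1 + l * k2" _ "k * l1 + l * l2"]) (simp add: z x y prod_eq_iff algebra_simps)
qed

lemma intlat_commute: "intlat y x = intlat x y"
  by (intro equalityI intlat_subset) auto

lemma intlat_uminus [simp]: "intlat x (-y) = intlat x y" "intlat (-x) y = intlat x y"
proof -
  have "- y \<in> intlat x y" for x y by (rule intlatI'[of _ 0 x "-1" y]) (simp add: prod_eq_iff)
  moreover have "y \<in> intlat x (-y)" for x y by (rule intlatI'[of _ 0 x "-1" "-y"]) (simp add: prod_eq_iff)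
  ultimately show *: "intlat x (-y) = intlat x y" for x y by (intro equalityI intlat_subset) auto
  show "intlat (-x) y = intlat x y" using *[of y x] by (simp add: intlat_commute)
qed

lemma intlat_diff: "intlat x (x - y) = intlat x y"
proof (intro equalityI intlat_subset)
  show "x - y \<in> intlat x y" by (rule intlatI'[of _ 1 x "-1" y]) (simp add: prod_eq_iff)
  show "y \<in> intlat x (x - y)" by (rule intlatI'[of _ 1 x "-1" "x - y"]) (simp add: prod_eq_iff)
qed auto

lemma scale_combination_eq_0:
  assumes "det2 x y \<noteq> 0" "scale k x + scale l y = 0" shows "k = 0" "l = 0"
proof -
  have 1: "k * fst x + l * fst y = 0" "k * snd x + l * snd y = 0" using assms(2) by (auto simp: prod_eq_iff)
  have "k * det2 x y = (k * fst x + l * fst y) * snd y - (k * snd x + l * snd y) * fst y"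
       "l * det2 x y = (k * snd x + l * snd y) * fst x - (k * fst x + l * fst y) * snd x"
    by (simp_all add: det2_def algebra_simps)
  thus "k = 0" "l = 0" using 1 assms(1) by auto
qed

context binary_form
begin

lemma Q_0 [simp]: "Q 0 = 0" using Q_zero by (simp add: zero_prod_def)

lemma Q_pos': "z \<noteq> 0 \<Longrightarrow> Q z > 0" using Q_pos[of z] by (simp add: zero_prod_def)

lemma Q_combination: "Q (scale k x + scale l y) = k\<^sup>2 * Q x + 2 * k * l * B x y + l\<^sup>2 * Q y"
  by (simp add: Q_def B_def power2_eq_square algebra_simps)

lemma Q_add: "Q (x + y) = Q x + 2 * B x y + Q y" and Q_diff: "Q (x - y) = Q x - 2 * B x y + Q y"
  by (simp_all add: Q_def B_def power2_eq_square algebra_simps)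

lemma Q_uminus [simp]: "Q (- x) = Q x" by (simp add: Q_def)

lemma B_uminus [simp]: "B (- x) y = - B x y" "B x (- y) = - B x y" by (simp_all add: B_def algebra_simps)

lemma B_commute: "B x y = B y x" by (simp add: B_def algebra_simps)

text \<open>Gauss reduction for vectors of equal norm: the bound on \<open>B x y\<close> says that
  \<open>x + y\<close> and \<open>x - y\<close> are not shorter than \<open>x\<close>.\<close>

definition reduced :: "int \<times> int \<Rightarrow> int \<times> int \<Rightarrow> bool" where
  "reduced x y \<longleftrightarrow> det2 x y \<noteq> 0 \<and> Q x = Q y \<and> 2 * \<bar>B x y\<bar> \<le> Q x"

lemma hexagonal_norm_ge_1: assumes "(k, l) \<noteq> (0, 0)" shows "k\<^sup>2 + l\<^sup>2 - \<bar>k * l\<bar> \<ge> (1::int)"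
proof -
  have "2 * (k\<^sup>2 + l\<^sup>2 - \<bar>k * l\<bar>) = k\<^sup>2 + l\<^sup>2 + (\<bar>k\<bar> - \<bar>l\<bar>)\<^sup>2"
    by (simp add: power2_eq_square algebra_simps abs_mult)
  moreover have "k\<^sup>2 + l\<^sup>2 > 0" using assms by (simp add: sum_power2_gt_zero_iff)
  moreover have "(\<bar>k\<bar> - \<bar>l\<bar>)\<^sup>2 \<ge> 0" by simp
  ultimately have "2 * (k\<^sup>2 + l\<^sup>2 - \<bar>k * l\<bar>) > 0" by linarith
  thus ?thesis by simp
qed

text \<open>The extreme case \<open>2 * \<bar>B x y\<bar> = Q x\<close>, with the unfavourable sign,
  is the hexagonal form on the left. The excess over it is at least
  \<open>\<bar>k * l\<bar> * (Q x - 2 * \<bar>B x y\<bar>)\<close>.\<close>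

lemma reduced_bound:
  assumes "reduced x y"
  shows "(k\<^sup>2 + l\<^sup>2 - \<bar>k * l\<bar>) * Q x \<le> Q (scale k x + scale l y)"
    "2 * \<bar>B x y\<bar> < Q x \<Longrightarrow> k * l \<noteq> 0 \<Longrightarrow> (k\<^sup>2 + l\<^sup>2 - \<bar>k * l\<bar>) * Q x < Q (scale k x + scale l y)"
proof -
  have eq: "Q (scale k x + scale l y) - (k\<^sup>2 + l\<^sup>2 - \<bar>k * l\<bar>) * Q x = \<bar>k * l\<bar> * Q x + 2 * (k * l) * B x y"
    using assms unfolding Q_combination by (simp add: reduced_def algebra_simps)
  have "2 * (k * l) * B x y \<ge> - (\<bar>k * l\<bar> * (2 * \<bar>B x y\<bar>))"
  proof -
    have "- \<bar>k * l * B x y\<bar> \<le> k * l * B x y" by linarith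
    moreover have "\<bar>k * l * B x y\<bar> = \<bar>k * l\<bar> * \<bar>B x y\<bar>" by (rule abs_mult)
    moreover have "2 * (k * l) * B x y = 2 * (k * l * B x y)" "\<bar>k * l\<bar> * (2 * \<bar>B x y\<bar>) = 2 * (\<bar>k * l\<bar> * \<bar>B x y\<bar>)"
      by simp_all
    ultimately show ?thesis by linarith
  qed
  hence ge: "Q (scale k x + scale l y) - (k\<^sup>2 + l\<^sup>2 - \<bar>k * l\<bar>) * Q x \<ge> \<bar>k * l\<bar> * (Q x - 2 * \<bar>B x y\<bar>)"
    unfolding eq by (simp add: algebra_simps)
  have "\<bar>k * l\<bar> * (Q x - 2 * \<bar>B x y\<bar>) \<ge> 0" using assms by (intro mult_nonneg_nonneg) (auto simp: reduced_def)
  thus "(k\<^sup>2 + l\<^sup>2 - \<bar>k * l\<bar>) * Q x \<le> Q (scale k x + scale l y)" using ge by linarith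
  assume "2 * \<bar>B x y\<bar> < Q x" "k * l \<noteq> 0"
  hence "\<bar>k * l\<bar> * (Q x - 2 * \<bar>B x y\<bar>) > 0" by (intro mult_pos_pos) auto
  thus "(k\<^sup>2 + l\<^sup>2 - \<bar>k * l\<bar>) * Q x < Q (scale k x + scale l y)" using ge by linarith
qed

lemma reduced_min:
  assumes "reduced x y" "z \<in> intlat x y" "z \<noteq> 0" shows "Q x \<le> Q z"
proof -
  obtain k l where z: "z = scale k x + scale l y" using assms(2) by (rule intlatE)
  have kl: "(k, l) \<noteq> (0, 0)" using assms(3) z by (auto simp: prod_eq_iff)
  have "1 * Q x \<le> (k\<^sup>2 + l\<^sup>2 - \<bar>k * l\<bar>) * Q x"
    using hexagonal_norm_ge_1[OF kl] Q_nonneg[of x] by (intro mult_right_mono)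
  thus ?thesis using reduced_bound(1)[OF assms(1), of k l] z by simp
qed

lemma reduced_nonzero: "reduced x y \<Longrightarrow> x \<noteq> 0 \<and> y \<noteq> 0"
  by (auto simp: reduced_def det2_def)

text \<open>Off the hexagonal case the comparison is strict whenever \<open>k * l\<close> is
  nonzero, so only multiples of \<open>x\<close> or of \<open>y\<close> can be minimal. A hexagonal
  lattice has six minimal vectors, which is why it is treated apart.\<close>

lemma reduced_min_vectors:
  assumes "reduced x y" "2 * \<bar>B x y\<bar> < Q x" "z \<in> intlat x y" "Q z = Q x"
  shows "z \<in> {x, -x, y, -y}"
proof -
  obtain k l where z: "z = scale k x + scale l y" using assms(3) by (rule intlatE)
  have Qx: "Q x > 0" using reduced_nonzero[OF assms(1)] Q_pos' by blast
  hence "z \<noteq> 0" using assms(4) by auto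
  hence kl: "(k, l) \<noteq> (0, 0)" using z by (auto simp: prod_eq_iff)
  have "k * l = 0"
  proof (rule ccontr)
    assume "k * l \<noteq> 0"
    from reduced_bound(2)[OF assms(1,2) this] have "(k\<^sup>2 + l\<^sup>2 - \<bar>k * l\<bar>) * Q x < Q x" using z assms(4) by simp
    moreover have "1 * Q x \<le> (k\<^sup>2 + l\<^sup>2 - \<bar>k * l\<bar>) * Q x"
      using hexagonal_norm_ge_1[OF kl] Qx by (intro mult_right_mono) auto
    ultimately show False by linarith
  qed
  have "Q x = Q y" using assms(1) by (simp add: reduced_def)
  have un: "n = 1 \<or> n = -1" if "n\<^sup>2 * Q x = Q x" for n :: int
  proof -
    have "n\<^sup>2 = 1" using that Qx by simp
    thus ?thesis by (simp add: power2_eq_1_iff)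
  qed
  from \<open>k * l = 0\<close> consider "k = 0" | "l = 0" by auto
  thus ?thesis
  proof cases
    case 1
    hence "l = 1 \<or> l = -1" using un[of l] assms(4) \<open>Q x = Q y\<close> by (simp add: z Q_combination)
    thus ?thesis using 1 by (auto simp: z prod_eq_iff)
  next
    case 2
    hence "k = 1 \<or> k = -1" using un[of k] assms(4) by (simp add: z Q_combination)
    thus ?thesis using 2 by (auto simp: z prod_eq_iff)
  qed
qed

text \<open>Both bases consist of minimal vectors of the same lattice, and the first one accounts
  for all of these up to sign.\<close>

lemma intlat_eq_reduced:
  assumes "reduced x y" "2 * \<bar>B x y\<bar> < Q x" "reduced x' y'" "intlat x y = intlat x' y'"
  shows "x' \<in> {x, -x, y, -y}" "y' \<in> {x, -x, y, -y}"
proof -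
  have m: "x' \<in> intlat x y" "y' \<in> intlat x y" "x \<in> intlat x' y'"
    using intlat_generators[of x y] intlat_generators[of x' y'] unfolding assms(4) by simp_all
  have nz: "x \<noteq> 0" "x' \<noteq> 0" "y' \<noteq> 0" using reduced_nonzero assms by blast+
  have "Q x' = Q x" using reduced_min[OF assms(1) m(1) nz(2)] reduced_min[OF assms(3) m(3) nz(1)] by linarith
  moreover have "Q y' = Q x'" using assms(3) by (simp add: reduced_def)
  ultimately show "x' \<in> {x, -x, y, -y}" "y' \<in> {x, -x, y, -y}"
    using reduced_min_vectors[OF assms(1,2)] m by simp_all
qed

text \<open>Inverts \<open>u = x + y\<close>, \<open>v = x - y\<close>: the value at
  \<open>u\<close>, \<open>v\<close> is \<open>x\<close>, and at \<open>u\<close>, \<open>-v\<close>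
  it is \<open>y\<close>. The divisions are exact under the parity conditions of
  \<open>orth_pairs\<close>.\<close>

definition half_sum :: "int \<times> int \<Rightarrow> int \<times> int \<Rightarrow> int \<times> int" where
  "half_sum u v = ((fst u + fst v) div 2, (snd u + snd v) div 2)"

text \<open>\<open>quad u\<close> selects one of the four quarter turns of a pair,
  \<open>det2 u v > 0\<close> fixes the orientation, the strict ratio bounds exclude hexagonal
  lattices, and the parities make the half sums integral.\<close>

definition orth_pairs :: "((int \<times> int) \<times> (int \<times> int)) set" where
  "orth_pairs = {(u, v). quad u \<and> B u v = 0 \<and> det2 u v > 0 \<and> Q u < 3 * Q v \<and> Q v < 3 * Q u
     \<and> even (fst u + fst v) \<and> even (snd u + snd v)}"

definition pair_lattice :: "(int \<times> int) \<times> (int \<times> int) \<Rightarrow> (int \<times> int) set" where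
  "pair_lattice = (\<lambda>(u, v). intlat (half_sum u v) (half_sum u (-v)))"

text \<open>An orthogonal \<open>v\<close> is a multiple of the quarter turn of \<open>u\<close>;
  the factor \<open>Q u\<close> keeps the identities integral. Up to positive factors, for
  \<open>det2 u v > 0\<close>, the two coordinates that define \<open>quad\<close> are exchanged and
  one changes sign.\<close>

lemma orth_rotation:
  assumes "B u v = 0"
  shows "Q u * snd v = (a * fst u + b * snd u) * det2 u v"
    "Q u * (a * fst v + b * snd v) = - (D * snd u * det2 u v)"
proof -
  have 1: "(a * fst u + b * snd u) * fst v = - ((b * fst u + c * snd u) * snd v)"
    using assms by (simp add: B_def algebra_simps)
  have "(a * fst u + b * snd u) * det2 u v = (a * fst u + b * snd u) * fst u * snd v - snd u * ((a * fst u + b * snd u) * fst v)"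
    by (simp add: det2_def algebra_simps)
  also have "\<dots> = Q u * snd v" unfolding 1 by (simp add: Q_def power2_eq_square algebra_simps)
  finally show A: "Q u * snd v = (a * fst u + b * snd u) * det2 u v" by simp
  have "(b * fst u + c * snd u) * det2 u v = fst u * ((b * fst u + c * snd u) * snd v) - snd u * fst v * (b * fst u + c * snd u)"
    by (simp add: det2_def algebra_simps)
  also have "(b * fst u + c * snd u) * snd v = - ((a * fst u + b * snd u) * fst v)" using 1 by simp
  finally have Bq: "Q u * fst v = - ((b * fst u + c * snd u) * det2 u v)"
    by (simp add: Q_def power2_eq_square algebra_simps)
  have "Q u * (a * fst v + b * snd v) = a * (Q u * fst v) + b * (Q u * snd v)" by (simp add: algebra_simps)
  also have "\<dots> = - (D * snd u * det2 u v)" unfolding A Bq by (simp add: D_def power2_eq_square algebra_simps)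
  finally show "Q u * (a * fst v + b * snd v) = - (D * snd u * det2 u v)" .
qed

lemma quad_orth_not_quad:
  assumes "quad u" "B u v = 0" "det2 u v > 0"
  shows "\<not> quad v" "\<not> quad (-v)"
proof -
  have Qu: "Q u > 0" using quad_nonzero[OF assms(1)] Q_pos by blast
  have "Q u * snd v > 0" unfolding orth_rotation(1)[OF assms(2)] using assms by (intro mult_pos_pos) (auto simp: quad_def)
  hence "snd v > 0" using Qu by (simp add: zero_less_mult_iff)
  thus "\<not> quad (-v)" by (simp add: quad_def)
  have "D * snd u * det2 u v \<ge> 0" using assms D_pos by (simp add: quad_def)
  hence "Q u * (a * fst v + b * snd v) \<le> 0" unfolding orth_rotation(2)[OF assms(2)] by simp
  hence "a * fst v + b * snd v \<le> 0" using Qu by (simp add: mult_le_0_iff)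
  thus "\<not> quad v" by (simp add: quad_def)
qed

lemma quad_uminus: "quad u \<Longrightarrow> \<not> quad (-u)" by (auto simp: quad_def)

text \<open>\<open>quad\<close> is a half-open quadrant in the coordinates \<open>p\<close> and
  \<open>snd u\<close>, so its four quarter turns cover all nonzero vectors.\<close>

lemma ex_quad_rotation:
  assumes "B u v = 0" "det2 u v > 0"
  shows "quad u \<or> quad v \<or> quad (-u) \<or> quad (-v)"
proof -
  have u0: "u \<noteq> 0" using assms(2) by (auto simp: det2_def)
  have Qu: "Q u > 0" by (rule Q_pos'[OF u0])
  define p where "p = a * fst u + b * snd u"
  have nz: "p \<noteq> 0 \<or> snd u \<noteq> 0"
    using u0 a_pos by (auto simp: p_def prod_eq_iff)
  have 1: "Q u * snd v = p * det2 u v" and 2: "Q u * (a * fst v + b * snd v) = - (D * snd u * det2 u v)"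
    using orth_rotation[OF assms(1)] by (auto simp: p_def)
  consider "p > 0" "snd u \<ge> 0" | "p \<le> 0" "snd u > 0" | "p < 0" "snd u \<le> 0" | "p \<ge> 0" "snd u < 0"
    using nz by linarith
  thus ?thesis
  proof cases
    case 1
    thus ?thesis by (simp add: quad_def p_def)
  next
    case 2
    have "Q u * snd v \<le> 0" using 1 2(1) assms(2) by (simp add: mult_le_0_iff)
    hence "snd v \<le> 0" using Qu by (simp add: mult_le_0_iff)
    moreover have "Q u * (a * fst v + b * snd v) < 0" using \<open>Q u * (a * fst v + b * snd v) = _\<close> 2(2) assms(2) D_pos by simp
    hence "a * fst v + b * snd v < 0" using Qu by (simp add: mult_less_0_iff)
    ultimately show ?thesis by (simp add: quad_def)
  next
    case 3
    thus ?thesis by (simp add: quad_def p_def)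
  next
    case 4
    have "Q u * snd v \<ge> 0" using 1 4(1) assms(2) by (simp add: zero_le_mult_iff)
    hence "snd v \<ge> 0" using Qu by (simp add: zero_le_mult_iff)
    moreover have "D * snd u * det2 u v < 0" using 4(2) assms(2) D_pos by (intro mult_neg_pos mult_pos_neg)
    hence "Q u * (a * fst v + b * snd v) > 0" using 2 by simp
    hence "a * fst v + b * snd v > 0" using Qu by (simp add: zero_less_mult_iff)
    ultimately show ?thesis by (simp add: quad_def)
  qed
qed

lemma half_sums:
  assumes "even (fst u + fst v)" "even (snd u + snd v)"
  defines "x \<equiv> half_sum u v" and "y \<equiv> half_sum u (-v)"
  shows "u = x + y" "v = x - y"
proof -
  have e: "even (fst u - fst v)" "even (snd u - snd v)" using assms by auto
  have d: "(s + t) div 2 + (s - t) div 2 = s" "(s + t) div 2 - (s - t) div 2 = t" if "even (s + t)" "even (s - t)" for s t :: int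
    using that by presburger+
  show "u = x + y" "v = x - y"
    unfolding x_def y_def half_sum_def using d assms(1,2) e by (auto simp: prod_eq_iff)
qed

lemma pair_form_identities:
  assumes "u = x + y" "v = x - y"
  shows "B u v = Q x - Q y" "det2 u v = - 2 * det2 x y" "Q u = Q x + 2 * B x y + Q y" "Q v = Q x - 2 * B x y + Q y"
  unfolding assms by (simp_all add: Q_add Q_diff) (simp_all add: B_def Q_def det2_def power2_eq_square algebra_simps)

text \<open>Orthogonality gives \<open>Q x = Q y\<close>, hence
  \<open>Q u = 2 * Q x + 2 * B x y\<close> and \<open>Q v = 2 * Q x - 2 * B x y\<close>, and the
  ratio bounds become \<open>2 * \<bar>B x y\<bar> < Q x\<close>.\<close>

lemma orth_pair_reduced:
  assumes "(u, v) \<in> orth_pairs"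
  defines "x \<equiv> half_sum u v" and "y \<equiv> half_sum u (-v)"
  shows "reduced x y" "2 * \<bar>B x y\<bar> < Q x" "u = x + y" "v = x - y" "det2 u v = - 2 * det2 x y"
proof -
  show uv: "u = x + y" "v = x - y" using assms half_sums[of u v] by (auto simp: orth_pairs_def)
  note id = pair_form_identities[OF uv]
  show "det2 u v = - 2 * det2 x y" by (rule id)
  have QQ: "Q x = Q y" using assms(1) id by (auto simp: orth_pairs_def)
  show lt: "2 * \<bar>B x y\<bar> < Q x" using assms(1) id QQ by (auto simp: orth_pairs_def)
  show "reduced x y" using assms(1) id QQ lt by (auto simp: orth_pairs_def reduced_def)
qed

lemma pair_lattice_inj: "inj_on pair_lattice orth_pairs"
proof (rule inj_onI)
  fix s t assume st: "s \<in> orth_pairs" "t \<in> orth_pairs" "pair_lattice s = pair_lattice t"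
  obtain u v u' v' where defs: "s = (u, v)" "t = (u', v')" by (cases s, cases t)
  have m: "(u, v) \<in> orth_pairs" "(u', v') \<in> orth_pairs" using st by (simp_all add: defs)
  define x y x' y' where xy: "x = half_sum u v" "y = half_sum u (-v)" "x' = half_sum u' v'" "y' = half_sum u' (-v')"
  note 1 = orth_pair_reduced[OF m(1), folded xy] and 2 = orth_pair_reduced[OF m(2), folded xy]
  have "intlat x y = intlat x' y'" using st(3) by (simp add: pair_lattice_def xy defs)
  from intlat_eq_reduced[OF 1(1,2) 2(1) this] have mem: "x' \<in> {x, -x, y, -y}" "y' \<in> {x, -x, y, -y}" .
  have q: "quad u" "B u v = 0" "det2 u v > 0" "quad u'" "det2 u' v' > 0" using m by (auto simp: orth_pairs_def)
  have nq: "\<not> quad v" "\<not> quad (-v)" "\<not> quad (-u)"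
    using quad_orth_not_quad[OF q(1-3)] quad_uminus[OF q(1)] by auto
  have d: "det2 x' y' \<noteq> 0" "det2 x y < 0" "det2 x' y' < 0" using 1 2 q by auto
  have nn: "x' \<noteq> y'" "x' \<noteq> - y'" using d(1) by (auto simp: det2_def)
  have "u = u' \<and> v = v'"
  proof -
    have ds: "det2 x (-y) = - det2 x y" "det2 (-x) y = - det2 x y" "det2 y x = - det2 x y" "det2 (-y) (-x) = - det2 x y"
      by (simp_all add: det2_def)
    \<comment> \<open>Of the eight signed permutations of \<open>(x, y)\<close>, four reverse the
      orientation; the others are the quarter turns of \<open>(u, v)\<close>, and
      \<open>quad u'\<close> leaves only the identity.\<close>
    from mem nn consider "x' = x" "y' = y" | "x' = x" "y' = -y" | "x' = -x" "y' = y" | "x' = -x" "y' = -y"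
      | "x' = y" "y' = x" | "x' = y" "y' = -x" | "x' = -y" "y' = x" | "x' = -y" "y' = -x" by auto
    thus ?thesis
    proof cases
      case 1
      thus ?thesis using \<open>u = x + y\<close> \<open>v = x - y\<close> 2(3,4) by simp
    next
      case 4
      hence "u' = - u" using \<open>u = x + y\<close> 2(3) by simp
      thus ?thesis using nq q by simp
    next
      case 6
      hence "u' = - v" using \<open>v = x - y\<close> 2(3) by simp
      thus ?thesis using nq q by simp
    next
      case 7
      hence "u' = v" using \<open>v = x - y\<close> 2(3) by simp
      thus ?thesis using nq q by simp
    qed (use d ds in auto)
  qed
  thus "s = t" by (simp add: defs)
qed

text \<open>Changing the sign of \<open>y\<close> fixes the orientation. Replacing
  \<open>(x, y)\<close> by \<open>(-y, x)\<close> turns \<open>(u, v)\<close> into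
  \<open>(v, -u)\<close>, and some iterate has its first diagonal in \<open>quad\<close>; none of
  these changes affects the lattice.\<close>

lemma reduced_strict_in_pair_lattice:
  assumes "reduced x y" "2 * \<bar>B x y\<bar> < Q x"
  shows "intlat x y \<in> pair_lattice ` orth_pairs"
proof -
  have *: "intlat x y \<in> pair_lattice ` orth_pairs" if "reduced x y" "2 * \<bar>B x y\<bar> < Q x" "quad (x + y)" "det2 x y < 0" for x y
  proof -
    define u v where uv: "u = x + y" "v = x - y"
    note id = pair_form_identities[OF uv]
    have b: "2 * B x y < Q x" "- (2 * B x y) < Q x" using that(2) by linarith+
    have "quad u" "B u v = 0" "det2 u v > 0" "Q u < 3 * Q v" "Q v < 3 * Q u"
      using that id b by (auto simp: reduced_def uv(1))
    hence "(u, v) \<in> orth_pairs" unfolding orth_pairs_def by (auto simp: uv)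
    moreover have "half_sum u v = x" "half_sum u (-v) = y" by (simp_all add: half_sum_def uv)
    hence "pair_lattice (u, v) = intlat x y" by (simp add: pair_lattice_def)
    ultimately show ?thesis by force
  qed
  have **: "intlat x y \<in> pair_lattice ` orth_pairs" if r: "reduced x y" "2 * \<bar>B x y\<bar> < Q x" and d: "det2 x y < 0" for x y
  proof -
    define u v where uv: "u = x + y" "v = x - y"
    note id = pair_form_identities[OF uv]
    have "quad u \<or> quad v \<or> quad (-u) \<or> quad (-v)"
      by (rule ex_quad_rotation) (use id r d in \<open>auto simp: reduced_def\<close>)
    thus ?thesis
    proof (elim disjE)
      assume "quad u" thus ?thesis using *[OF r _ d] by (simp add: uv)
    next
      assume q: "quad v"
      have "intlat (-y) x \<in> pair_lattice ` orth_pairs"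
        by (rule *) (use r d q in \<open>auto simp: uv reduced_def det2_def B_commute algebra_simps\<close>)
      thus ?thesis by (simp add: intlat_commute)
    next
      assume q: "quad (-u)"
      have "intlat (-x) (-y) \<in> pair_lattice ` orth_pairs"
        by (rule *) (use r d q in \<open>auto simp: uv reduced_def det2_def algebra_simps\<close>)
      thus ?thesis by simp
    next
      assume q: "quad (-v)"
      have "intlat y (-x) \<in> pair_lattice ` orth_pairs"
        by (rule *) (use r d q in \<open>auto simp: uv reduced_def det2_def B_commute algebra_simps\<close>)
      thus ?thesis by (simp add: intlat_commute)
    qed
  qed
  show ?thesis
  proof (cases "det2 x y < 0")
    case True
    thus ?thesis using **[OF assms] by blast
  next
    case False
    have "intlat x (-y) \<in> pair_lattice ` orth_pairs"
      by (rule **) (use assms False in \<open>auto simp: reduced_def det2_def\<close>)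
    thus ?thesis by simp
  qed
qed

text \<open>Two vectors of equal norm at an angle of 60 degrees; an angle of 120 degrees reduces to
  it by changing the sign of \<open>y\<close>.\<close>

definition hex_pair :: "int \<times> int \<Rightarrow> int \<times> int \<Rightarrow> bool" where
  "hex_pair x y \<longleftrightarrow> x \<noteq> 0 \<and> Q x = Q y \<and> 2 * B x y = Q x"

text \<open>\<open>2 y - x\<close> is orthogonal to \<open>x\<close> and has norm
  \<open>3 * Q x\<close>, which determines it up to sign and leaves only \<open>y\<close> and
  \<open>x - y\<close>. A hexagonal lattice is thus recovered from one of its minimal
  vectors.\<close>

lemma hex_pair_unique:
  assumes "hex_pair x y" "hex_pair x y'" shows "intlat x y = intlat x y'"
proof -
  define h h' where "h = scale 2 y - x" and "h' = scale 2 y' - x"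
  have Bh: "B x h = 0" "B x h' = 0" and Qh: "Q h = 3 * Q x" "Q h' = 3 * Q x"
  proof -
    have "B x (scale 2 y - x) = 2 * B x y - Q x" "Q (scale 2 y - x) = 4 * Q y - 4 * B x y + Q x" for y
      by (simp_all add: B_def Q_def power2_eq_square algebra_simps)
    thus "B x h = 0" "B x h' = 0" "Q h = 3 * Q x" "Q h' = 3 * Q x"
      using assms by (simp_all add: h_def h'_def hex_pair_def)
  qed
  have Qx: "Q x > 0" using assms Q_pos'[of x] by (simp add: hex_pair_def)
  have dd: "(det2 x h)\<^sup>2 = (det2 x h')\<^sup>2"
  proof -
    have "D * (det2 x y)\<^sup>2 = Q x * Q y - (B x y)\<^sup>2" for x y
      by (simp add: D_def det2_def Q_def B_def power2_eq_square algebra_simps)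
    hence "D * (det2 x h)\<^sup>2 = D * (det2 x h')\<^sup>2" using Bh Qh by simp
    thus ?thesis using D_pos by simp
  qed
  \<comment> \<open>By \<open>Q x * Q t = D * (det2 x t)\<^sup>2 + (B x t)\<^sup>2\<close>, a vector
    is determined by its values of \<open>B x\<close> and \<open>det2 x\<close>.\<close>
  have eqv: "h = w" if "B x h = B x w" "det2 x h = det2 x w" for h w
  proof -
    define t where "t = h - w"
    have "B x t = 0" "det2 x t = 0" using that by (simp_all add: t_def B_def det2_def algebra_simps)
    hence "Q x * Q t = 0"
    proof -
      have "Q x * Q t = D * (det2 x t)\<^sup>2 + (B x t)\<^sup>2" by (simp add: D_def det2_def Q_def B_def power2_eq_square algebra_simps)
      thus ?thesis using \<open>B x t = 0\<close> \<open>det2 x t = 0\<close> by simp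
    qed
    hence "Q t = 0" using Qx by simp
    hence "t = 0" using Q_pos'[of t] by force
    thus ?thesis by (simp add: t_def)
  qed
  from dd have "det2 x h = det2 x h' \<or> det2 x h = - det2 x h'" by (simp add: power2_eq_iff)
  hence "h = h' \<or> h = - h'"
  proof
    assume "det2 x h = det2 x h'" thus ?thesis using eqv[of h h'] Bh by simp
  next
    assume "det2 x h = - det2 x h'"
    moreover have "det2 x (-h') = - det2 x h'" by (simp add: det2_def)
    ultimately show ?thesis using eqv[of h "-h'"] Bh by simp
  qed
  hence "y' = y \<or> y' = x - y" by (auto simp: h_def h'_def prod_eq_iff)
  thus ?thesis using intlat_diff[of x y] by auto
qed

text \<open>The Gram determinant gives
  \<open>4 * D * (det2 x y)\<^sup>2 = 3 * (Q x)\<^sup>2\<close>; the cruder constant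
  \<open>2 * D\<close> avoids square roots and is enough for a linear count.\<close>

lemma hex_pair_det: "hex_pair x y \<Longrightarrow> Q x \<le> 2 * D * \<bar>det2 x y\<bar>"
proof (rule power2_le_imp_le)
  assume h: "hex_pair x y"
  have "4 * (D * (det2 x y)\<^sup>2) = 4 * (Q x * Q y) - (2 * B x y)\<^sup>2"
    by (simp add: D_def det2_def Q_def B_def power2_eq_square algebra_simps)
  also have "\<dots> = 3 * (Q x)\<^sup>2" using h by (simp add: hex_pair_def power2_eq_square)
  finally have eq: "4 * (D * (det2 x y)\<^sup>2) = 3 * (Q x)\<^sup>2" .
  have "(Q x)\<^sup>2 \<le> 3 * (Q x)\<^sup>2" by simp
  also have "\<dots> = 4 * (D * (det2 x y)\<^sup>2)" by (rule eq[symmetric])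
  also have "\<dots> \<le> D * (4 * (D * (det2 x y)\<^sup>2))"
    using D_pos mult_right_mono[of 1 D "4 * (D * (det2 x y)\<^sup>2)"] by simp
  also have "\<dots> = (2 * D * \<bar>det2 x y\<bar>)\<^sup>2" by (simp add: power_mult_distrib power2_eq_square)
  finally show "(Q x)\<^sup>2 \<le> (2 * D * \<bar>det2 x y\<bar>)\<^sup>2" .
qed (use D_pos in simp)

end


section \<open>Primitive directions and their perpendiculars\<close>

context binary_form
begin

text \<open>The quarter turn of a primitive vector need not be primitive; this is its content, and
  division by it gives the generator \<open>perp z\<close> of the vectors orthogonal to
  \<open>z\<close>.\<close>

definition content_perp :: "int \<times> int \<Rightarrow> int" where
  "content_perp z = gcd (a * fst z + b * snd z) (b * fst z + c * snd z)"

definition perp :: "int \<times> int \<Rightarrow> int \<times> int" where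
  "perp z = (- ((b * fst z + c * snd z) div content_perp z), (a * fst z + b * snd z) div content_perp z)"

lemma scale_perp: "content_perp z * fst (perp z) = - (b * fst z + c * snd z)"
    "content_perp z * snd (perp z) = a * fst z + b * snd z"
  by (simp_all add: perp_def content_perp_def)

lemma content_perp_pos: "z \<in> prim_quad \<Longrightarrow> content_perp z > 0"
  by (auto simp: content_perp_def prim_quad_def quad_def)

text \<open>Up to sign and order the turned coordinates are the Gram matrix applied to
  \<open>z\<close>. Applying its adjugate recovers \<open>D * z\<close>, whose content is
  \<open>D\<close> because \<open>z\<close> is primitive.\<close>

lemma content_perp_dvd_D:
  assumes "prim z" shows "content_perp z dvd D"
proof -
  define e where "e = content_perp z"
  have e: "e dvd a * fst z + b * snd z" "e dvd b * fst z + c * snd z" by (auto simp: e_def content_perp_def)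
  have "D * fst z = c * (a * fst z + b * snd z) - b * (b * fst z + c * snd z)"
       "D * snd z = a * (b * fst z + c * snd z) - b * (a * fst z + b * snd z)"
    by (simp_all add: D_def power2_eq_square algebra_simps)
  hence "e dvd D * fst z" "e dvd D * snd z" using e by (metis dvd_diff dvd_mult)+
  hence "e dvd gcd (D * fst z) (D * snd z)" by simp
  also have "gcd (D * fst z) (D * snd z) = D" using assms D_pos by (simp add: gcd_mult_left prim_def)
  finally show ?thesis by (simp add: e_def)
qed

lemma content_perp_le_D: "prim z \<Longrightarrow> content_perp z \<le> D"
  using content_perp_dvd_D D_pos by (simp add: zdvd_imp_le)

lemma perp_form:
  shows "content_perp z * det2 z (perp z) = Q z" "(content_perp z)\<^sup>2 * Q (perp z) = D * Q z" "content_perp z * B z (perp z) = 0"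
proof -
  define e where "e = content_perp z"
  define v where "v = perp z"
  have v: "e * fst v = - (b * fst z + c * snd z)" "e * snd v = a * fst z + b * snd z"
    using scale_perp[of z] by (auto simp: e_def v_def)
  have "e * det2 z v = fst z * (e * snd v) - snd z * (e * fst v)" by (simp add: det2_def algebra_simps)
  also have "\<dots> = Q z" unfolding v by (simp add: Q_def power2_eq_square algebra_simps)
  finally show "content_perp z * det2 z (perp z) = Q z" by (simp add: e_def v_def)
  have "e\<^sup>2 * Q v = a * (e * fst v)\<^sup>2 + 2 * b * (e * fst v) * (e * snd v) + c * (e * snd v)\<^sup>2"
    by (simp add: Q_def power2_eq_square algebra_simps)
  also have "\<dots> = D * Q z" unfolding v by (simp add: Q_def D_def power2_eq_square algebra_simps)
  finally show "(content_perp z)\<^sup>2 * Q (perp z) = D * Q z" by (simp add: e_def v_def)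
  have "e * B z v = a * fst z * (e * fst v) + b * (fst z * (e * snd v) + snd z * (e * fst v)) + c * snd z * (e * snd v)"
    by (simp add: B_def algebra_simps)
  also have "\<dots> = 0" unfolding v by (simp add: algebra_simps)
  finally show "content_perp z * B z (perp z) = 0" by (simp add: e_def v_def)
qed

definition coeff_set :: "int \<times> int \<Rightarrow> (int \<times> int) set" where
  "coeff_set z = {w \<in> ratio_sector ((content_perp z)\<^sup>2) D.
     even (fst w * fst z + snd w * fst (perp z)) \<and> even (fst w * snd z + snd w * snd (perp z))}"

definition coeff_pair :: "(int \<times> int) \<times> (int \<times> int) \<Rightarrow> (int \<times> int) \<times> (int \<times> int)" where
  "coeff_pair = (\<lambda>(z, w). (scale (fst w) z, scale (snd w) (perp z)))"

text \<open>\<open>Q z\<close> cancels from the ratio because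
  \<open>(content_perp z)\<^sup>2 * Q (perp z) = D * Q z\<close>, so the sector depends on
  \<open>z\<close> only through \<open>content_perp z\<close>.\<close>

lemma ratio_iff:
  assumes "z \<in> prim_quad"
  shows "Q (scale \<alpha> z) < 3 * Q (scale \<beta> (perp z)) \<longleftrightarrow> (content_perp z)\<^sup>2 * \<alpha>\<^sup>2 < 3 * D * \<beta>\<^sup>2"
    "Q (scale \<beta> (perp z)) < 3 * Q (scale \<alpha> z) \<longleftrightarrow> D * \<beta>\<^sup>2 < 3 * (content_perp z)\<^sup>2 * \<alpha>\<^sup>2"
proof -
  define e where "e = content_perp z"
  have e: "e\<^sup>2 > 0" using content_perp_pos[OF assms] by (simp add: e_def)
  have Qz: "Q z > 0" using assms quad_nonzero Q_pos by (auto simp: prim_quad_def)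
  have 1: "e\<^sup>2 * Q (scale \<alpha> z) = Q z * (e\<^sup>2 * \<alpha>\<^sup>2)" by (simp add: Q_scale)
  have "e\<^sup>2 * Q (scale \<beta> (perp z)) = \<beta>\<^sup>2 * (e\<^sup>2 * Q (perp z))" by (simp add: Q_scale)
  also have "\<dots> = Q z * (D * \<beta>\<^sup>2)" using perp_form(2)[of z] by (simp add: e_def)
  finally have 2: "e\<^sup>2 * Q (scale \<beta> (perp z)) = Q z * (D * \<beta>\<^sup>2)" .
  have "Q (scale \<alpha> z) < 3 * Q (scale \<beta> (perp z)) \<longleftrightarrow> e\<^sup>2 * Q (scale \<alpha> z) < e\<^sup>2 * (3 * Q (scale \<beta> (perp z)))"
    using e by (simp only: mult_less_cancel_left_pos)
  also have "\<dots> \<longleftrightarrow> Q z * (e\<^sup>2 * \<alpha>\<^sup>2) < Q z * (3 * D * \<beta>\<^sup>2)" unfolding 1 using 2 by (simp add: mult_ac)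
  also have "\<dots> \<longleftrightarrow> e\<^sup>2 * \<alpha>\<^sup>2 < 3 * D * \<beta>\<^sup>2" using Qz by (simp only: mult_less_cancel_left_pos)
  finally show "Q (scale \<alpha> z) < 3 * Q (scale \<beta> (perp z)) \<longleftrightarrow> (content_perp z)\<^sup>2 * \<alpha>\<^sup>2 < 3 * D * \<beta>\<^sup>2" by (simp add: e_def)
  have "Q (scale \<beta> (perp z)) < 3 * Q (scale \<alpha> z) \<longleftrightarrow> e\<^sup>2 * Q (scale \<beta> (perp z)) < e\<^sup>2 * (3 * Q (scale \<alpha> z))"
    using e by (simp only: mult_less_cancel_left_pos)
  also have "\<dots> \<longleftrightarrow> Q z * (D * \<beta>\<^sup>2) < Q z * (3 * e\<^sup>2 * \<alpha>\<^sup>2)" unfolding 2 by (simp add: Q_scale mult_ac)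
  also have "\<dots> \<longleftrightarrow> D * \<beta>\<^sup>2 < 3 * e\<^sup>2 * \<alpha>\<^sup>2" using Qz by (simp only: mult_less_cancel_left_pos)
  finally show "Q (scale \<beta> (perp z)) < 3 * Q (scale \<alpha> z) \<longleftrightarrow> D * \<beta>\<^sup>2 < 3 * (content_perp z)\<^sup>2 * \<alpha>\<^sup>2" by (simp add: e_def)
qed

lemma det2_scale: "det2 (scale \<alpha> z) (scale \<beta> w) = \<alpha> * \<beta> * det2 z w"
  by (simp add: det2_def algebra_simps)

lemma B_scale: "B (scale \<alpha> z) (scale \<beta> w) = \<alpha> * \<beta> * B z w"
  by (simp add: B_def algebra_simps)

lemma coeff_pair_det: "content_perp z * det2 (scale \<alpha> z) (scale \<beta> (perp z)) = \<alpha> * \<beta> * Q z"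
  using perp_form(1)[of z] unfolding det2_scale by (metis mult.left_commute)

lemma det2_perp_pos: assumes "z \<in> prim_quad" shows "det2 z (perp z) > 0"
proof -
  have "content_perp z * det2 z (perp z) > 0"
    using assms quad_nonzero Q_pos perp_form(1)[of z] by (auto simp: prim_quad_def)
  thus ?thesis using content_perp_pos[OF assms] by (simp add: zero_less_mult_iff)
qed

text \<open>Surjectivity rests on \<open>perp z\<close> being primitive: an integral vector
  orthogonal to \<open>z\<close> is then an integral multiple of it.\<close>

lemma coeff_pair_bij: "bij_betw coeff_pair (Sigma prim_quad coeff_set) orth_pairs"
  unfolding bij_betw_def
proof (intro conjI inj_onI equalityI subsetI)
  fix s t assume st: "s \<in> Sigma prim_quad coeff_set" "t \<in> Sigma prim_quad coeff_set" "coeff_pair s = coeff_pair t"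
  obtain z w z' w' where e: "s = (z, w)" "t = (z', w')" by (cases s, cases t)
  have h: "z \<in> prim_quad" "z' \<in> prim_quad" "fst w > 0" "fst w' > 0"
    "scale (fst w) z = scale (fst w') z'" "scale (snd w) (perp z) = scale (snd w') (perp z')"
    using st by (auto simp: e coeff_pair_def coeff_set_def ratio_sector_def)
  have "fst w = fst w'" and z: "z = z'"
    using scale_prim_unique[OF h(5)] h by (auto simp: prim_quad_def)
  moreover have "snd w = snd w'"
  proof -
    have "det2 z (scale (snd w) (perp z)) = det2 z (scale (snd w') (perp z))" using h(6) z by simp
    hence "snd w * det2 z (perp z) = snd w' * det2 z (perp z)" by (simp add: det2_def algebra_simps)
    thus ?thesis using det2_perp_pos[OF h(1)] by simp
  qed
  ultimately show "s = t" by (simp add: e prod_eq_iff)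
next
  fix s assume "s \<in> coeff_pair ` Sigma prim_quad coeff_set"
  then obtain z w where s: "s = (scale (fst w) z, scale (snd w) (perp z))" and z: "z \<in> prim_quad" and w: "w \<in> coeff_set z"
    by (auto simp: coeff_pair_def)
  have "fst w > 0" "snd w > 0" using w by (auto simp: coeff_set_def ratio_sector_def)
  moreover have "quad z" using z by (simp add: prim_quad_def)
  moreover have "B z (perp z) = 0" using perp_form(3)[of z] content_perp_pos[OF z] by simp
  ultimately show "s \<in> orth_pairs"
    using w ratio_iff[OF z, where \<alpha> = "fst w" and \<beta> = "snd w"] det2_perp_pos[OF z]
    by (simp add: orth_pairs_def s quad_scale B_scale det2_scale coeff_set_def ratio_sector_def)
next
  fix s assume s: "s \<in> orth_pairs"
  obtain u v where uv: "s = (u, v)" by (cases s)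
  have h: "quad u" "B u v = 0" "det2 u v > 0" "Q u < 3 * Q v" "Q v < 3 * Q u" "even (fst u + fst v)" "even (snd u + snd v)"
    using s by (auto simp: uv orth_pairs_def)
  obtain \<alpha> z where z: "\<alpha> > 0" "prim z" "u = scale \<alpha> z" using ex_scale_prim[OF quad_nonzero[OF h(1)]] by blast
  have zq: "z \<in> prim_quad" using h(1) z by (simp add: prim_quad_def quad_scale)
  define e p r where "e = content_perp z" and "p = (a * fst z + b * snd z) div e" and "r = (b * fst z + c * snd z) div e"
  have e: "e > 0" using content_perp_pos[OF zq] by (simp add: e_def)
  have pr: "a * fst z + b * snd z = e * p" "b * fst z + c * snd z = e * r" by (simp_all add: p_def r_def e_def content_perp_def)
  have perp: "perp z = (- r, p)" by (simp add: perp_def p_def r_def e_def)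
  have cop: "coprime p r" unfolding p_def r_def e_def content_perp_def
    by (rule div_gcd_coprime) (use zq in \<open>auto simp: prim_quad_def quad_def\<close>)
  have p: "p > 0"
  proof -
    have "e * p > 0" using zq pr by (simp add: prim_quad_def quad_def)
    thus ?thesis using e by (simp add: zero_less_mult_iff)
  qed
  have "B u v = \<alpha> * e * (p * fst v + r * snd v)"
  proof -
    have "B u v = \<alpha> * ((a * fst z + b * snd z) * fst v + (b * fst z + c * snd z) * snd v)"
      by (simp add: z(3) B_def algebra_simps)
    thus ?thesis unfolding pr by (simp add: algebra_simps)
  qed
  hence eq: "p * fst v = - (r * snd v)" using h(2) e z(1) by auto
  hence "p dvd r * snd v" by (metis dvd_minus_iff dvd_triv_left)
  hence "p dvd snd v" using cop by (simp add: coprime_dvd_mult_right_iff)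
  then obtain \<beta> where b: "snd v = p * \<beta>" by (elim dvdE)
  have "p * fst v = p * (- r * \<beta>)" using eq b by simp
  hence "fst v = - r * \<beta>" using p mult_left_cancel[of p "fst v" "- r * \<beta>"] by (metis less_irrefl)
  hence v: "v = scale \<beta> (perp z)" by (simp add: prod_eq_iff perp b)
  have "\<alpha> * \<beta> * det2 z (perp z) > 0" using h(3) unfolding z(3) v det2_scale .
  hence bp: "\<beta> > 0" using z(1) det2_perp_pos[OF zq] by (simp add: zero_less_mult_iff)
  have "(\<alpha>, \<beta>) \<in> coeff_set z"
    using h ratio_iff[OF zq, where \<alpha> = \<alpha> and \<beta> = \<beta>] bp z(1) by (simp add: coeff_set_def ratio_sector_def z(3) v)
  thus "s \<in> coeff_pair ` Sigma prim_quad coeff_set"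
    using zq by (intro image_eqI[of _ _ "(z, (\<alpha>, \<beta>))"]) (auto simp: coeff_pair_def uv z(3) v)
qed

text \<open>Shifting \<open>z\<close> by \<open>2 * D\<close> times an integral vector shifts
  \<open>perp z\<close> by \<open>2 * (D / content_perp z)\<close> times an integral vector, and
  this quotient is an integer. The factor 2 in the modulus preserves the parities.\<close>

lemma residue_class_invariants:
  assumes "prim z" "prim z'" "z' \<in> residue_points (2 * D) z"
  shows "content_perp z' = content_perp z" "coeff_set z' = coeff_set z"
proof -
  have sym: "z \<in> residue_points (2 * D) z'" using assms(3) by (auto simp: residue_points_def)
  have dvd: "content_perp z dvd content_perp z'" if "prim z" "z' \<in> residue_points (2 * D) z" for z z'
  proof -
    define e where "e = content_perp z"
    have e: "e dvd a * fst z + b * snd z" "e dvd b * fst z + c * snd z" by (auto simp: e_def content_perp_def)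
    have eD: "e dvd 2 * D" using content_perp_dvd_D[OF that(1)] by (simp add: e_def)
    have "2 * D dvd fst z' - fst z" "2 * D dvd snd z' - snd z" using that(2) by (auto simp: residue_points_def mod_eq_dvd_iff)
    hence d: "e dvd fst z' - fst z" "e dvd snd z' - snd z" using eD dvd_trans by blast+
    have "a * fst z' + b * snd z' = (a * fst z + b * snd z) + (a * (fst z' - fst z) + b * (snd z' - snd z))"
         "b * fst z' + c * snd z' = (b * fst z + c * snd z) + (b * (fst z' - fst z) + c * (snd z' - snd z))"
      by (simp_all add: algebra_simps)
    hence "e dvd a * fst z' + b * snd z'" "e dvd b * fst z' + c * snd z'"
      using e d by (metis dvd_add dvd_mult)+
    thus ?thesis by (simp add: content_perp_def[of z'] e_def)
  qed
  have nn: "content_perp z \<ge> 0" "content_perp z' \<ge> 0" by (auto simp: content_perp_def)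
  show eq: "content_perp z' = content_perp z"
    using dvd[OF assms(1,3)] dvd[OF assms(2) sym] nn zdvd_antisym_nonneg by blast
  define e where "e = content_perp z"
  obtain f where f: "D = e * f" using content_perp_dvd_D[OF assms(1)] by (auto simp: e_def elim: dvdE)
  have e0: "e \<noteq> 0" using f D_pos by auto
  obtain k l where kl: "fst z' - fst z = 2 * D * k" "snd z' - snd z = 2 * D * l"
    using assms(3) by (auto simp: residue_points_def mod_eq_dvd_iff elim!: dvdE)
  have v: "e * fst (perp z) = - (b * fst z + c * snd z)" "e * snd (perp z) = a * fst z + b * snd z"
     "e * fst (perp z') = - (b * fst z' + c * snd z')" "e * snd (perp z') = a * fst z' + b * snd z'"
    using scale_perp[of z] scale_perp[of z'] eq by (auto simp: e_def)
  have z': "fst z' = fst z + 2 * (e * f) * k" "snd z' = snd z + 2 * (e * f) * l" using kl f by auto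
  have "e * fst (perp z') = e * (fst (perp z) - 2 * f * (b * k + c * l))"
       "e * snd (perp z') = e * (snd (perp z) + 2 * f * (a * k + b * l))"
    unfolding right_diff_distrib distrib_left v unfolding z' by (simp_all add: algebra_simps)
  hence w: "fst (perp z') = fst (perp z) - 2 * f * (b * k + c * l)" "snd (perp z') = snd (perp z) + 2 * f * (a * k + b * l)"
    using e0 by auto
  show "coeff_set z' = coeff_set z"
    unfolding coeff_set_def eq w z' by (auto simp: algebra_simps)
qed

end

section \<open>Sublattices of the plane\<close>


text \<open>Bezout's identity for the second coordinates makes the basis triangular, so that coset
  representatives can be read off as a box.\<close>

lemma hermite_form:
  assumes "det2 x y \<noteq> 0"
  obtains \<alpha> \<beta> \<delta> where "\<alpha> > 0" "\<delta> > 0" "\<alpha> * \<delta> = \<bar>det2 x y\<bar>" "intlat x y = intlat (\<alpha>, 0) (\<beta>, \<delta>)"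
proof -
  define \<delta> where "\<delta> = gcd (snd x) (snd y)"
  have "\<delta> \<noteq> 0"
  proof
    assume "\<delta> = 0"
    hence "snd x = 0" "snd y = 0" by (auto simp: \<delta>_def)
    thus False using assms by (simp add: det2_def)
  qed
  hence d: "\<delta> > 0" by (simp add: \<delta>_def)
  obtain p q where pq: "p * snd x + q * snd y = \<delta>" using bezout_int[of "snd x" "snd y"] by (auto simp: \<delta>_def)
  obtain x2 y2 where xy: "snd x = \<delta> * x2" "snd y = \<delta> * y2" by (metis \<delta>_def dvdE gcd_dvd1 gcd_dvd2)
  have "\<delta> * (p * x2 + q * y2) = \<delta> * 1" using pq by (simp add: xy algebra_simps)
  hence pq1: "p * x2 + q * y2 = 1" using d by simp
  define \<alpha> where "\<alpha> = y2 * fst x - x2 * fst y"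
  define \<beta> where "\<beta> = p * fst x + q * fst y"
  have det: "\<alpha> * \<delta> = det2 x y" by (simp add: \<alpha>_def det2_def xy algebra_simps)
  have eq: "intlat x y = intlat (\<alpha>, 0) (\<beta>, \<delta>)"
  proof (intro equalityI intlat_subset)
    show "(\<alpha>, 0) \<in> intlat x y" by (rule intlatI'[of _ y2 _ "- x2"]) (simp add: prod_eq_iff \<alpha>_def xy)
    show "(\<beta>, \<delta>) \<in> intlat x y" by (rule intlatI'[of _ p _ q]) (simp add: prod_eq_iff \<beta>_def pq)
    have "q * \<alpha> + x2 * \<beta> = (p * x2 + q * y2) * fst x" "- p * \<alpha> + y2 * \<beta> = (p * x2 + q * y2) * fst y"
      by (simp_all add: \<alpha>_def \<beta>_def algebra_simps)
    hence f: "fst x = q * \<alpha> + x2 * \<beta>" "fst y = - p * \<alpha> + y2 * \<beta>" unfolding pq1 by simp_all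
    show "x \<in> intlat (\<alpha>, 0) (\<beta>, \<delta>)" by (rule intlatI'[of _ q _ x2]) (simp add: prod_eq_iff f(1) xy)
    show "y \<in> intlat (\<alpha>, 0) (\<beta>, \<delta>)" by (rule intlatI'[of _ "-p" _ y2]) (simp add: prod_eq_iff f(2) xy)
  qed
  have "intlat (\<bar>\<alpha>\<bar>, 0) (\<beta>, \<delta>) = intlat (\<alpha>, 0) (\<beta>, \<delta>)"
  proof (cases "\<alpha> \<ge> 0")
    case False
    hence "(\<bar>\<alpha>\<bar>, 0 :: int) = - (\<alpha>, 0)" by (simp add: prod_eq_iff)
    thus ?thesis by (simp only: intlat_uminus)
  qed auto
  moreover have "\<alpha> \<noteq> 0" using det assms by auto
  moreover have "\<bar>\<alpha>\<bar> * \<delta> = \<bar>det2 x y\<bar>" using det d by (metis abs_mult abs_of_pos)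
  ultimately show ?thesis using that[of "\<bar>\<alpha>\<bar>" \<delta> \<beta>] d eq by simp
qed

lemma intlat_hermite_iff:
  assumes "\<delta> > 0"
  shows "z \<in> intlat (\<alpha>, 0) (\<beta>, \<delta>) \<longleftrightarrow> (\<exists>k l. fst z = k * \<alpha> + l * \<beta> \<and> snd z = l * \<delta>)"
  by (auto simp: intlat_def prod_eq_iff image_iff)

lemma intlat_add: "z \<in> intlat x y \<Longrightarrow> w \<in> intlat x y \<Longrightarrow> z + w \<in> intlat x y"
  and intlat_minus: "z \<in> intlat x y \<Longrightarrow> w \<in> intlat x y \<Longrightarrow> z - w \<in> intlat x y"
proof -
  assume "z \<in> intlat x y" "w \<in> intlat x y"
  then obtain k l k' l' where e: "z = scale k x + scale l y" "w = scale k' x + scale l' y" by (elim intlatE)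
  show "z + w \<in> intlat x y" by (rule intlatI'[of _ "k + k'" _ "l + l'"]) (simp add: e prod_eq_iff algebra_simps)
  show "z - w \<in> intlat x y" by (rule intlatI'[of _ "k - k'" _ "l - l'"]) (simp add: e prod_eq_iff algebra_simps)
qed

lemma intlat_zero: "0 \<in> intlat x y"
  by (rule intlatI'[of _ 0 _ 0]) (simp add: prod_eq_iff)

definition emb :: "real^2 \<Rightarrow> real^2 \<Rightarrow> int \<times> int \<Rightarrow> real^2" where
  "emb p r z = of_int (fst z) *\<^sub>R p + of_int (snd z) *\<^sub>R r"

lemma emb_add: "emb p r (z + w) = emb p r z + emb p r w"
  and emb_diff: "emb p r (z - w) = emb p r z - emb p r w"
  and emb_0: "emb p r 0 = 0"
  by (simp_all add: emb_def algebra_simps)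

lemma lattice_of_eq_emb: "lattice_of A = range (emb (column 1 A) (column 2 A))"
proof (intro equalityI subsetI)
  fix x assume "x \<in> lattice_of A"
  then obtain z where z: "x = A *v z" "\<And>i. z $ i \<in> \<int>" by (auto simp: lattice_of_def)
  obtain i j where ij: "z $ 1 = of_int i" "z $ 2 = of_int j" using z(2) by (metis Ints_cases)
  have "x = emb (column 1 A) (column 2 A) (i, j)"
    by (simp add: z(1) matrix_mult_sum sum_2 ij emb_def scalar_mult_eq_scaleR)
  thus "x \<in> range (emb (column 1 A) (column 2 A))" by blast
next
  fix x assume "x \<in> range (emb (column 1 A) (column 2 A))"
  then obtain i j where x: "x = emb (column 1 A) (column 2 A) (i, j)" by (metis imageE surj_pair)
  define z :: "real^2" where "z = (\<chi> k. if k = 1 then of_int i else of_int j)"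
  have "x = A *v z" by (simp add: x matrix_mult_sum sum_2 emb_def scalar_mult_eq_scaleR z_def)
  moreover have "\<forall>k. z $ k \<in> \<int>" by (simp add: z_def)
  ultimately show "x \<in> lattice_of A" by (auto simp: lattice_of_def)
qed

lemma emb_emb: "emb (emb p r x) (emb p r y) z = emb p r (scale (fst z) x + scale (snd z) y)"
  by (simp add: emb_def algebra_simps)

lemma emb_lattice: "range (emb (emb p r x) (emb p r y)) = emb p r ` intlat x y"
  by (auto simp: intlat_def emb_emb image_image case_prod_beta)

locale lattice_form = binary_form +
  fixes p r :: "real^2" and lam :: real
  assumes lam_pos: "lam > 0" and pp: "p \<bullet> p = lam * of_int a" and pr: "p \<bullet> r = lam * of_int b"
    and rr: "r \<bullet> r = lam * of_int c"
begin

lemma norm_emb: "(norm (emb p r z))\<^sup>2 = lam * of_int (Q z)"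
proof -
  have "(norm (emb p r z))\<^sup>2 = emb p r z \<bullet> emb p r z" by (simp add: power2_norm_eq_inner)
  also have "\<dots> = (of_int (fst z))\<^sup>2 * (p \<bullet> p) + 2 * of_int (fst z) * of_int (snd z) * (p \<bullet> r) + (of_int (snd z))\<^sup>2 * (r \<bullet> r)"
    by (simp add: emb_def inner_add_left inner_add_right power2_eq_square inner_commute algebra_simps)
  also have "\<dots> = lam * of_int (Q z)" unfolding pp pr rr by (simp add: Q_def algebra_simps)
  finally show ?thesis .
qed

lemma emb_eq_0_iff: "emb p r z = 0 \<longleftrightarrow> z = 0"
proof
  assume "emb p r z = 0"
  hence "lam * of_int (Q z) = 0" using norm_emb[of z] by simp
  hence "Q z = 0" using lam_pos by simp
  thus "z = 0" using Q_pos'[of z] by force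
qed (simp add: emb_0)

lemma inj_emb: "inj (emb p r)"
proof (rule injI)
  fix z w assume "emb p r z = emb p r w"
  hence "emb p r (z - w) = 0" by (simp add: emb_diff)
  thus "z = w" by (simp add: emb_eq_0_iff)
qed

lemma emb_mem_iff: "emb p r z \<in> emb p r ` L \<longleftrightarrow> z \<in> L"
  by (rule inj_image_mem_iff[OF inj_emb])

text \<open>The box \<open>{0..<\<alpha>} \<times> {0..<\<delta>}\<close> attached to the Hermite
  form meets every coset exactly once.\<close>

lemma lattice_index_eq:
  assumes "det2 x y \<noteq> 0"
  shows "lattice_index (range (emb p r)) (emb p r ` intlat x y) = nat \<bar>det2 x y\<bar>"
proof -
  obtain \<alpha> \<beta> \<delta> where h: "\<alpha> > 0" "\<delta> > 0" "\<alpha> * \<delta> = \<bar>det2 x y\<bar>" "intlat x y = intlat (\<alpha>, 0) (\<beta>, \<delta>)"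
    by (rule hermite_form[OF assms])
  define L where "L = intlat x y"
  define coset where "coset = (\<lambda>z. (\<lambda>w. z + w) ` (emb p r ` L))"
  have L_iff: "z \<in> L \<longleftrightarrow> (\<exists>k l. fst z = k * \<alpha> + l * \<beta> \<and> snd z = l * \<delta>)" for z
    unfolding L_def h(4) by (rule intlat_hermite_iff[OF h(2)])
  have coset_eq: "coset (emb p r z) = coset (emb p r w) \<longleftrightarrow> z - w \<in> L" for z w
  proof
    assume eq: "coset (emb p r z) = coset (emb p r w)"
    have "emb p r z + emb p r 0 \<in> coset (emb p r z)"
      unfolding coset_def L_def by (rule image_eqI[OF refl], rule imageI, rule intlat_zero)
    hence "emb p r z \<in> coset (emb p r w)" using eq by (simp add: emb_0)
    then obtain l where l: "l \<in> L" "emb p r z = emb p r w + emb p r l" by (auto simp: coset_def)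
    hence "emb p r (z - w) = emb p r l" by (simp add: emb_diff)
    thus "z - w \<in> L" using l(1) inj_emb by (simp add: inj_eq)
  next
    assume d: "z - w \<in> L"
    have sub: "coset (emb p r z) \<subseteq> coset (emb p r w)" if "z - w \<in> L" for z w
    proof
      fix t assume "t \<in> coset (emb p r z)"
      then obtain l where l: "l \<in> L" "t = emb p r z + emb p r l" by (auto simp: coset_def)
      have "t = emb p r w + emb p r ((z - w) + l)" using l by (simp add: emb_add emb_diff)
      moreover have "(z - w) + l \<in> L" using that l(1) unfolding L_def by (rule intlat_add)
      ultimately show "t \<in> coset (emb p r w)" unfolding coset_def by blast
    qed
    have "w - z \<in> L" using intlat_minus[OF intlat_zero d[unfolded L_def]] by (simp add: L_def)
    thus "coset (emb p r z) = coset (emb p r w)" using sub[OF d] sub[of w z] by blast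
  qed
  have "bij_betw (\<lambda>z. coset (emb p r z)) ({0..<\<alpha>} \<times> {0..<\<delta>}) (coset ` range (emb p r))"
    unfolding bij_betw_def
  proof (intro conjI inj_onI)
    fix z w assume z: "z \<in> {0..<\<alpha>} \<times> {0..<\<delta>}" and w: "w \<in> {0..<\<alpha>} \<times> {0..<\<delta>}" and "coset (emb p r z) = coset (emb p r w)"
    then obtain k l where kl: "fst z - fst w = k * \<alpha> + l * \<beta>" "snd z - snd w = l * \<delta>" by (auto simp: coset_eq L_iff)
    have small: "k = 0" if "s - t = k * n" "s \<in> {0..<n}" "t \<in> {0..<n}" for s t k n :: int
    proof -
      have "\<bar>k * n\<bar> < n" using that by auto
      hence "\<bar>k\<bar> * n < 1 * n" using that by (simp add: abs_mult)
      thus ?thesis using that by (auto simp: mult_less_cancel_right)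
    qed
    have "l = 0" using small[OF kl(2)] z w by auto
    moreover from this have "k = 0" using small[of "fst z" "fst w" k \<alpha>] kl z w by auto
    ultimately show "z = w" using kl by (simp add: prod_eq_iff)
  next
    show "(\<lambda>z. coset (emb p r z)) ` ({0..<\<alpha>} \<times> {0..<\<delta>}) = coset ` range (emb p r)"
    proof (intro equalityI subsetI)
      fix t assume "t \<in> coset ` range (emb p r)"
      then obtain z where t: "t = coset (emb p r z)" by blast
      define l where "l = snd z div \<delta>"
      \<comment> \<open>Multiples of \<open>(\<beta>, \<delta>)\<close> reduce the second coordinate
        first; multiples of \<open>(\<alpha>, 0)\<close> then change only the first.\<close>
      define w where "w = ((fst z - l * \<beta>) mod \<alpha>, snd z mod \<delta>)"
      have "z - w \<in> L" unfolding L_iff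
      proof (intro exI conjI)
        have "fst z - l * \<beta> = (fst z - l * \<beta>) div \<alpha> * \<alpha> + (fst z - l * \<beta>) mod \<alpha>" by simp
        thus "fst (z - w) = (fst z - l * \<beta>) div \<alpha> * \<alpha> + l * \<beta>" unfolding w_def fst_diff fst_conv by linarith
        show "snd (z - w) = l * \<delta>" by (simp add: w_def l_def minus_mod_eq_div_mult)
      qed
      hence "t = coset (emb p r w)" using t coset_eq by simp
      moreover have "w \<in> {0..<\<alpha>} \<times> {0..<\<delta>}" using h by (simp add: w_def)
      ultimately show "t \<in> (\<lambda>z. coset (emb p r z)) ` ({0..<\<alpha>} \<times> {0..<\<delta>})" by blast
    qed auto
  qed
  hence "card (coset ` range (emb p r)) = card ({0..<\<alpha>} \<times> {0..<\<delta>})" by (rule bij_betw_same_card[symmetric])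
  also have "\<dots> = nat (\<alpha> * \<delta>)" using h(1,2) by (simp add: nat_mult_distrib)
  finally show ?thesis unfolding lattice_index_def coset_def L_def h(3) .
qed

definition rmat :: "int \<times> int \<Rightarrow> int \<times> int \<Rightarrow> real^2^2" where
  "rmat x y = (\<chi> i j. if j = 1 then emb p r x $ i else emb p r y $ i)"

lemma column_rmat: "column 1 (rmat x y) = emb p r x" "column 2 (rmat x y) = emb p r y"
  by (simp_all add: rmat_def column_def vec_eq_iff)

lemma det_columns:
  fixes A :: "real^2^2"
  assumes "column 1 A = emb p r x" "column 2 A = emb p r y"
  shows "invertible A \<longleftrightarrow> det2 x y \<noteq> 0"
proof -
  define d where "d = p $ 1 * r $ 2 - r $ 1 * p $ 2"
  have A: "A $ i $ 1 = emb p r x $ i" "A $ i $ 2 = emb p r y $ i" for i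
    using assms by (auto simp: column_def vec_eq_iff)
  have "det A = of_int (det2 x y) * d"
    unfolding det_2 A d_def by (simp add: emb_def det2_def algebra_simps)
  \<comment> \<open>By Lagrange's identity \<open>d\<^sup>2\<close> is the Gram determinant of
    \<open>p\<close> and \<open>r\<close>, which equals \<open>lam\<^sup>2 * D\<close>.\<close>
  moreover have "d \<noteq> 0"
  proof
    assume "d = 0"
    have "d\<^sup>2 = (p \<bullet> p) * (r \<bullet> r) - (p \<bullet> r)\<^sup>2"
      by (simp add: d_def inner_vec_def sum_2 power2_eq_square algebra_simps)
    also have "\<dots> = lam\<^sup>2 * of_int D" unfolding pp pr rr by (simp add: D_def power2_eq_square algebra_simps)
    finally show False using \<open>d = 0\<close> lam_pos D_pos by simp
  qed
  ultimately show ?thesis by (simp add: invertible_det_nz)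
qed

text \<open>A \<open>LEAST\<close> over the reals is meaningful only if a least element exists.
  Squared norms in \<open>L\<close> are \<open>lam\<close> times natural numbers, so the
  well-ordering of the naturals supplies one.\<close>

lemma lattice_min_props:
  assumes "L \<subseteq> range (emb p r)" "x \<in> L" "x \<noteq> 0"
  shows "lattice_min L \<le> (norm x)\<^sup>2"
proof -
  define N where "N = {n. \<exists>z. emb p r z \<in> L \<and> z \<noteq> 0 \<and> n = nat (Q z)}"
  obtain z0 where z0: "x = emb p r z0" using assms by blast
  have "nat (Q z0) \<in> N" unfolding N_def by (intro CollectI exI[of _ z0]) (use assms z0 in \<open>auto simp: emb_0\<close>)
  define n where "n = (LEAST n. n \<in> N)"
  have n: "n \<in> N" unfolding n_def by (rule LeastI) fact
  have le: "n \<le> m" if "m \<in> N" for m unfolding n_def using that by (rule Least_le)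
  have "lattice_min L = lam * real n"
    unfolding lattice_min_def
  proof (rule Least_equality)
    obtain z where z: "emb p r z \<in> L" "z \<noteq> 0" "n = nat (Q z)" using n by (auto simp: N_def)
    have "lam * real n = (norm (emb p r z))\<^sup>2" using z Q_nonneg[of z] by (simp add: norm_emb)
    thus "lam * real n \<in> (\<lambda>x. (norm x)\<^sup>2) ` (L - {0})" using z emb_eq_0_iff by blast
  next
    fix m assume "m \<in> (\<lambda>x. (norm x)\<^sup>2) ` (L - {0})"
    then obtain w where w: "w \<in> L" "w \<noteq> 0" "m = (norm w)\<^sup>2" by auto
    obtain z where z: "w = emb p r z" using w assms by blast
    have "nat (Q z) \<in> N" unfolding N_def by (intro CollectI exI[of _ z]) (use w z in \<open>auto simp: emb_0\<close>)
    hence "real n \<le> real (nat (Q z))" using le by simp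
    hence "lam * real n \<le> lam * of_int (Q z)" using lam_pos Q_nonneg[of z] by simp
    thus "lam * real n \<le> m" by (simp add: w z norm_emb)
  qed
  also have "\<dots> \<le> lam * of_int (Q z0)" using le[OF \<open>nat (Q z0) \<in> N\<close>] lam_pos Q_nonneg[of z0]
    by (simp add: le_nat_iff)
  finally show ?thesis by (simp add: z0 norm_emb)
qed

text \<open>Comparing a minimal basis with \<open>x + y\<close> and \<open>x - y\<close> gives the
  bound on \<open>B x y\<close>; conversely \<open>reduced_min\<close> shows that a reduced basis
  consists of minimal vectors.\<close>

theorem wr_sublattices_eq:
  "wr_sublattices (range (emb p r)) = {emb p r ` intlat x y | x y. reduced x y}"
proof (intro equalityI subsetI)
  fix L assume L: "L \<in> wr_sublattices (range (emb p r))"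
  then obtain A where A: "invertible A" "L = lattice_of A" "\<And>j. column j A \<in> minimal_vectors L"
    by (auto simp: wr_sublattices_def well_rounded_def)
  have sub: "L \<subseteq> range (emb p r)" using L by (simp add: wr_sublattices_def)
  have "column j A \<in> range (emb p r)" for j using A(3)[of j] sub by (auto simp: minimal_vectors_def)
  then obtain x y where xy: "column 1 A = emb p r x" "column 2 A = emb p r y" by blast
  have d: "det2 x y \<noteq> 0" using A(1) det_columns[OF xy] by simp
  have Leq: "L = emb p r ` intlat x y" unfolding A(2) lattice_of_eq_emb xy emb_lattice ..
  have mn: "lam * of_int (Q x) = lattice_min L" "lam * of_int (Q y) = lattice_min L"
    using A(3)[of 1] A(3)[of 2] by (simp_all add: minimal_vectors_def xy norm_emb)
  hence QQ: "Q x = Q y" using lam_pos by (metis mult_cancel_left of_int_eq_iff order_less_irrefl)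
  have ge: "Q x \<le> Q w" if "w \<in> intlat x y" "w \<noteq> 0" for w
  proof -
    have "lattice_min L \<le> lam * of_int (Q w)"
      using lattice_min_props[OF sub, of "emb p r w"] that by (simp add: norm_emb emb_eq_0_iff Leq)
    hence "lam * of_int (Q x) \<le> lam * of_int (Q w)" unfolding mn(1) .
    thus ?thesis using lam_pos by (simp only: mult_le_cancel_left_pos of_int_le_iff)
  qed
  have "x + y = scale 1 x + scale 1 y" "x - y = scale 1 x + scale (-1) y" by (simp_all add: prod_eq_iff)
  hence "x + y \<noteq> 0" "x - y \<noteq> 0"
    using scale_combination_eq_0(1)[OF d, of 1 1] scale_combination_eq_0(1)[OF d, of 1 "-1"] by force+
  hence "Q x \<le> Q (x + y)" "Q x \<le> Q (x - y)" by (intro ge intlat_add intlat_minus; simp)+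
  hence "reduced x y" using d QQ by (simp add: reduced_def Q_add Q_diff)
  thus "L \<in> {emb p r ` intlat x y | x y. reduced x y}" using Leq by blast
next
  fix L assume "L \<in> {emb p r ` intlat x y | x y. reduced x y}"
  then obtain x y where Leq: "L = emb p r ` intlat x y" and red: "reduced x y" by blast
  have d: "det2 x y \<noteq> 0" using red by (simp add: reduced_def)
  have inv: "invertible (rmat x y)" using det_columns[OF column_rmat] d by simp
  have Lat: "L = lattice_of (rmat x y)" unfolding Leq lattice_of_eq_emb column_rmat emb_lattice ..
  have "lattice_min L = lam * of_int (Q x)"
    unfolding lattice_min_def
  proof (rule Least_equality)
    have "x \<noteq> 0" using reduced_nonzero[OF red] by simp
    hence "emb p r x \<in> L - {0}" by (simp add: Leq emb_mem_iff emb_eq_0_iff)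
    thus "lam * of_int (Q x) \<in> (\<lambda>x. (norm x)\<^sup>2) ` (L - {0})" using norm_emb[of x] by (metis imageI)
  next
    fix m assume "m \<in> (\<lambda>x. (norm x)\<^sup>2) ` (L - {0})"
    then obtain w where w: "w \<in> intlat x y" "emb p r w \<noteq> 0" "m = (norm (emb p r w))\<^sup>2" by (auto simp: Leq)
    have "Q x \<le> Q w" by (rule reduced_min[OF red w(1)]) (use w in \<open>auto simp: emb_0\<close>)
    thus "lam * of_int (Q x) \<le> m" using lam_pos by (simp add: w norm_emb)
  qed
  moreover have "Q x = Q y" using red by (simp add: reduced_def)
  ultimately have "emb p r x \<in> minimal_vectors L" "emb p r y \<in> minimal_vectors L"
    by (simp_all add: minimal_vectors_def Leq emb_mem_iff norm_emb)
  hence "\<forall>j. column j (rmat x y) \<in> minimal_vectors L"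
    by (simp add: forall_2 column_rmat)
  hence "well_rounded L" using inv Lat unfolding well_rounded_def by blast
  moreover have "planar_lattice L" using inv Lat unfolding planar_lattice_def by blast
  ultimately show "L \<in> wr_sublattices (range (emb p r))" by (auto simp: wr_sublattices_def Leq)
qed

end

section \<open>From arithmetic lattices to integral forms\<close>

lemma rat_dim_1_common_multiple:
  assumes "rat_dim S = 1"
  obtains g where "\<And>x. x \<in> S \<Longrightarrow> \<exists>q::rat. x = of_rat q * g"
proof -
  interpret vs: vector_space rat_scale by (rule vector_space_rat_scale)
  obtain Bs where "Bs \<subseteq> S" "vs.independent Bs" and Bs: "S \<subseteq> vs.span Bs" "card Bs = vs.dim S"
    by (rule vs.basis_exists[of S])
  then obtain g where "Bs = {g}" using assms by (auto simp: card_1_singleton_iff)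
  hence "S \<subseteq> range (\<lambda>q. rat_scale q g)" using Bs vs.span_singleton[of g] by simp
  hence "\<exists>q::rat. x = of_rat q * g" if "x \<in> S" for x using that by (auto simp: rat_scale_def)
  thus ?thesis by (rule that)
qed

lemma rat_common_denominator3:
  obtains d n1 n2 n3 :: int where "d > 0" "q1 = of_int n1 / (of_int d :: rat)" "q2 = of_int n2 / (of_int d :: rat)"
    "q3 = of_int n3 / (of_int d :: rat)"
proof -
  obtain a1 b1 where 1: "q1 = of_int a1 / of_int b1" "b1 > 0" by (metis quotient_of_denom_pos quotient_of_div surj_pair)
  obtain a2 b2 where 2: "q2 = of_int a2 / of_int b2" "b2 > 0" by (metis quotient_of_denom_pos quotient_of_div surj_pair)
  obtain a3 b3 where 3: "q3 = of_int a3 / of_int b3" "b3 > 0" by (metis quotient_of_denom_pos quotient_of_div surj_pair)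
  show ?thesis
    by (rule that[of "b1 * b2 * b3" "a1 * b2 * b3" "a2 * b1 * b3" "a3 * b1 * b2"])
      (use 1 2 3 in \<open>auto simp: field_simps\<close>)
qed

text \<open>A one-dimensional rational span makes all Gram entries rational multiples of one real
  \<open>g\<close>; clearing denominators leaves an integral matrix times a scalar.\<close>

lemma arithmetic_lattice_form:
  assumes "arithmetic_lattice M"
  obtains a b c p r lam where "lattice_form a b c p r lam" "M = range (emb p r)"
proof -
  obtain A where A: "invertible A" "M = lattice_of A" "rat_dim {(transpose A ** A) $ i $ j | i j. True} = 1"
    using assms by (auto simp: arithmetic_lattice_def)
  define p r where "p = column 1 A" and "r = column 2 A"
  have G: "(transpose A ** A) $ i $ j = column i A \<bullet> column j A" for i j
    by (simp add: matrix_matrix_mult_def transpose_def column_def inner_vec_def)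
  obtain g where g: "\<And>x. x \<in> {(transpose A ** A) $ i $ j | i j. True} \<Longrightarrow> \<exists>q::rat. x = of_rat q * g"
    using rat_dim_1_common_multiple[OF A(3)] by blast
  have ex: "\<exists>q::rat. column i A \<bullet> column j A = of_rat q * g" for i j
    unfolding G[symmetric] by (rule g) blast
  obtain q1 q2 q3 :: rat where q: "p \<bullet> p = of_rat q1 * g" "p \<bullet> r = of_rat q2 * g" "r \<bullet> r = of_rat q3 * g"
    using ex[of 1 1] ex[of 1 2] ex[of 2 2] unfolding p_def r_def by blast
  obtain d n1 n2 n3 where d: "d > 0" "q1 = of_int n1 / of_int d" "q2 = of_int n2 / of_int d" "q3 = of_int n3 / of_int d"
    using rat_common_denominator3[of q1 q2 q3] by blast
  have det: "(p \<bullet> p) * (r \<bullet> r) - (p \<bullet> r)\<^sup>2 > 0"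
  proof -
    have "det A \<noteq> 0" using A(1) by (simp add: invertible_det_nz)
    moreover have "(p \<bullet> p) * (r \<bullet> r) - (p \<bullet> r)\<^sup>2 = (det A)\<^sup>2"
      by (simp add: p_def r_def det_2 inner_vec_def sum_2 column_def power2_eq_square algebra_simps)
    ultimately show ?thesis by simp
  qed
  have pp0: "p \<bullet> p > 0"
  proof -
    have "p \<noteq> 0" using det by auto
    thus ?thesis by simp
  qed
  \<comment> \<open>\<open>g\<close> may be negative; its sign is moved into the integral entries so
    that \<open>lam\<close> is positive.\<close>
  define \<sigma> :: int where "\<sigma> = (if g > 0 then 1 else -1)"
  define lam where "lam = \<bar>g\<bar> / of_int d"
  have g0: "g \<noteq> 0" using pp0 q by auto
  have lam: "lam > 0" using g0 d by (simp add: lam_def)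
  have e: "of_rat (of_int n / of_int d) * g = lam * of_int (\<sigma> * n)" for n
    by (simp add: lam_def \<sigma>_def of_rat_divide)
  have pr: "p \<bullet> p = lam * of_int (\<sigma> * n1)" "p \<bullet> r = lam * of_int (\<sigma> * n2)" "r \<bullet> r = lam * of_int (\<sigma> * n3)"
    unfolding q d(2-4) e by simp_all
  have "lam * of_int (\<sigma> * n1) > 0" using pp0 pr by simp
  hence "(of_int (\<sigma> * n1) :: real) > 0" using lam by (simp add: zero_less_mult_iff)
  hence a: "\<sigma> * n1 > 0" by linarith
  have "(p \<bullet> p) * (r \<bullet> r) - (p \<bullet> r)\<^sup>2 = lam\<^sup>2 * of_int ((\<sigma> * n1) * (\<sigma> * n3) - (\<sigma> * n2)\<^sup>2)"
    unfolding pr by (simp add: power2_eq_square algebra_simps)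
  hence "lam\<^sup>2 * of_int ((\<sigma> * n1) * (\<sigma> * n3) - (\<sigma> * n2)\<^sup>2) > 0" using det by simp
  hence "(of_int ((\<sigma> * n1) * (\<sigma> * n3) - (\<sigma> * n2)\<^sup>2) :: real) > 0" using lam by (simp only: zero_less_mult_iff) auto
  hence D: "(\<sigma> * n1) * (\<sigma> * n3) - (\<sigma> * n2)\<^sup>2 > 0" by linarith
  have "lattice_form (\<sigma> * n1) (\<sigma> * n2) (\<sigma> * n3) p r lam"
    by unfold_locales (use a D lam pr in auto)
  moreover have "M = range (emb p r)" by (simp add: A(2) lattice_of_eq_emb p_def r_def)
  ultimately show ?thesis by (rule that)
qed

section \<open>The series over coefficient data\<close>


lemma has_sum_product_nonneg:
  fixes f :: "'a \<Rightarrow> real" and g :: "'b \<Rightarrow> real"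
  assumes "f summable_on A" "g summable_on B" "\<And>x. x \<in> A \<Longrightarrow> f x \<ge> 0" "\<And>y. y \<in> B \<Longrightarrow> g y \<ge> 0"
  shows "((\<lambda>(x, y). f x * g y) has_sum (infsum f A * infsum g B)) (A \<times> B)"
proof -
  have 1: "((\<lambda>y. (\<lambda>(x, y). f x * g y) (x, y)) has_sum (f x * infsum g B)) B" for x
    unfolding split_conv using assms(2) by (intro has_sum_cmult_right has_sum_infsum)
  have 2: "((\<lambda>x. f x * infsum g B) has_sum (infsum f A * infsum g B)) A"
    using assms(1) by (intro has_sum_cmult_left has_sum_infsum)
  have "(\<lambda>(x, y). f x * g y) summable_on Sigma A (\<lambda>_. B)"
    by (rule summable_on_SigmaI[OF 1]) (use 2 assms in \<open>auto simp: summable_on_def\<close>)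
  from has_sum_SigmaI[OF 1 2 this] show ?thesis .
qed

lemma has_density_UN:
  assumes "finite J" "\<And>j. j \<in> J \<Longrightarrow> has_density q (I j) (\<kappa> j)"
    "\<And>j k. j \<in> J \<Longrightarrow> k \<in> J \<Longrightarrow> j \<noteq> k \<Longrightarrow> I j \<inter> I k = {}"
  shows "has_density q (\<Union>j\<in>J. I j) (\<Sum>j\<in>J. \<kappa> j)"
  unfolding has_density_def
proof (intro conjI ballI allI)
  show "1 \<le> q i" if "i \<in> (\<Union>j\<in>J. I j)" for i using that assms(2) by (auto simp: has_density_def)
  have un: "{i \<in> (\<Union>j\<in>J. I j). q i \<le> n} = (\<Union>j\<in>J. {i \<in> I j. q i \<le> n})" for n by auto
  have fin: "finite {i \<in> I j. q i \<le> n}" if "j \<in> J" for j n using assms(2)[OF that] by (simp add: has_density_def)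
  show "finite {i \<in> (\<Union>j\<in>J. I j). q i \<le> n}" for n unfolding un using assms(1) fin by simp
  have card: "real (card {i \<in> (\<Union>j\<in>J. I j). q i \<le> n}) / real n = (\<Sum>j\<in>J. real (card {i \<in> I j. q i \<le> n}) / real n)" for n
  proof -
    have "card {i \<in> (\<Union>j\<in>J. I j). q i \<le> n} = (\<Sum>j\<in>J. card {i \<in> I j. q i \<le> n})"
      unfolding un by (rule card_UN_disjoint[OF assms(1)]) (use fin assms(3) in blast)+
    thus ?thesis by (simp add: sum_divide_distrib)
  qed
  show "(\<lambda>n. real (card {i \<in> (\<Union>j\<in>J. I j). q i \<le> n}) / real n) \<longlonglongrightarrow> (\<Sum>j\<in>J. \<kappa> j)"
    unfolding card using assms(2) by (intro tendsto_sum) (simp add: has_density_def)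
qed

context binary_form
begin

text \<open>The parity conditions depend only on \<open>w\<close> modulo 2, so the set is a union of
  classes modulo 2 within the sector. The class of \<open>(0, 0)\<close> always qualifies, which
  makes the density positive.\<close>

lemma coeff_set_density:
  assumes "z \<in> prim_quad"
  obtains \<sigma> where "\<sigma> > 0" "has_density (\<lambda>w. nat (fst w * snd w)) (coeff_set z) \<sigma>"
proof -
  define e where "e = content_perp z"
  have e2: "e\<^sup>2 > 0" using content_perp_pos[OF assms] by (simp add: e_def)
  obtain \<kappa> where k: "\<kappa> > 0"
    "\<forall>m>0. \<forall>c. has_density (\<lambda>z. nat (fst z * snd z)) (residue_points m c \<inter> ratio_sector (e\<^sup>2) D) (\<kappa> / (of_int m)\<^sup>2)"
    using ratio_sector_density[OF e2 D_pos] by blast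
  define J where "J = {w \<in> {0,1} \<times> {0,1::int}. even (fst w * fst z + snd w * fst (perp z)) \<and> even (fst w * snd z + snd w * snd (perp z))}"
  have fJ: "finite J" unfolding J_def by simp
  have Jmod: "fst j mod 2 = fst j" "snd j mod 2 = snd j" if "j \<in> J" for j
  proof -
    have "j \<in> {0,1} \<times> {0,1}" using that unfolding J_def mem_Collect_eq by (rule conjunct1)
    thus "fst j mod 2 = fst j" "snd j mod 2 = snd j" by auto
  qed
  have 1: "has_density (\<lambda>w. nat (fst w * snd w)) (\<Union>j\<in>J. residue_points 2 j \<inter> ratio_sector (e\<^sup>2) D) (\<Sum>j\<in>J. \<kappa> / (of_int 2)\<^sup>2)"
  proof (rule has_density_UN[OF fJ])
    show "has_density (\<lambda>w. nat (fst w * snd w)) (residue_points 2 j \<inter> ratio_sector (e\<^sup>2) D) (\<kappa> / (of_int 2)\<^sup>2)" for j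
      using k(2)[rule_format, of 2 j] by simp
  next
    fix j k assume jk: "j \<in> J" "k \<in> J" "j \<noteq> k"
    have "residue_points 2 j \<inter> residue_points 2 k = {}"
      using jk(3) Jmod[OF jk(1)] Jmod[OF jk(2)] by (auto simp: residue_points_def prod_eq_iff)
    thus "(residue_points 2 j \<inter> ratio_sector (e\<^sup>2) D) \<inter> (residue_points 2 k \<inter> ratio_sector (e\<^sup>2) D) = {}" by blast
  qed
  have 2: "(\<Union>j\<in>J. residue_points 2 j \<inter> ratio_sector (e\<^sup>2) D) = coeff_set z"
  proof -
    have par: "even (fst w * x + snd w * y) \<longleftrightarrow> even ((fst w mod 2) * x + (snd w mod 2) * y)" for w :: "int \<times> int" and x y
      by (simp add: even_add even_mult_iff)
    have J: "w \<in> residue_points 2 (fst w mod 2, snd w mod 2)" for w by (simp add: residue_points_def)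
    have Jm: "(fst w mod 2, snd w mod 2) \<in> J \<longleftrightarrow> even (fst w * fst z + snd w * fst (perp z)) \<and> even (fst w * snd z + snd w * snd (perp z))" for w :: "int \<times> int"
    proof -
      have "n mod 2 \<in> {0, 1}" for n :: int by auto
      hence "(fst w mod 2, snd w mod 2) \<in> {0,1} \<times> {0,1}" by (intro SigmaI)
      thus ?thesis unfolding J_def mem_Collect_eq fst_conv snd_conv
        using par[of w "fst z" "fst (perp z)"] par[of w "snd z" "snd (perp z)"] by blast
    qed
    have eq: "j = (fst w mod 2, snd w mod 2)" if "w \<in> residue_points 2 j" "j \<in> J" for w j
      using that(1) Jmod[OF that(2)] by (simp add: residue_points_def prod_eq_iff)
    show ?thesis
    proof (intro equalityI subsetI)
      fix w assume "w \<in> (\<Union>j\<in>J. residue_points 2 j \<inter> ratio_sector (e\<^sup>2) D)"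
      then obtain j where "j \<in> J" "w \<in> residue_points 2 j" "w \<in> ratio_sector (e\<^sup>2) D" by blast
      thus "w \<in> coeff_set z" using eq[of w j] Jm[of w] by (simp add: coeff_set_def e_def)
    next
      fix w assume "w \<in> coeff_set z"
      hence "w \<in> ratio_sector (e\<^sup>2) D" "(fst w mod 2, snd w mod 2) \<in> J" unfolding Jm by (simp_all add: coeff_set_def e_def)
      thus "w \<in> (\<Union>j\<in>J. residue_points 2 j \<inter> ratio_sector (e\<^sup>2) D)" using J[of w] by blast
    qed
  qed
  have "(0, 0) \<in> J" by (simp add: J_def)
  hence "card J > 0" using fJ by (auto simp: card_gt_0_iff)
  hence "(\<Sum>j\<in>J. \<kappa> / (of_int 2)\<^sup>2) > 0" using k(1) by simp
  thus ?thesis using that 1 unfolding 2 by blast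
qed

definition residue_class :: "int \<times> int \<Rightarrow> int \<times> int" where
  "residue_class z = (fst z mod (2 * D), snd z mod (2 * D))"

lemma finite_classes: "finite (residue_class ` prim_quad)"
proof (rule finite_subset)
  show "residue_class ` prim_quad \<subseteq> {0..<2 * D} \<times> {0..<2 * D}" using D_pos by (auto simp: residue_class_def)
qed auto

lemma residue_points_residue_class: "residue_points (2 * D) (residue_class z) = residue_points (2 * D) z"
  by (simp add: residue_points_def residue_class_def)

lemma residue_class_residue: "w \<in> residue_points (2 * D) z \<longleftrightarrow> residue_class w = residue_class z"
  by (simp add: residue_points_def residue_class_def)

lemma unit_residue_class:
  assumes "prim z" shows "unit_class (2 * D) (residue_class z)"
proof -
  define g where "g = gcd (gcd (fst (residue_class z)) (snd (residue_class z))) (2 * D)"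
  have g: "g dvd fst (residue_class z)" "g dvd snd (residue_class z)" "g dvd 2 * D"
    unfolding g_def by (rule dvd_trans[OF gcd_dvd1 gcd_dvd1] dvd_trans[OF gcd_dvd1 gcd_dvd2] gcd_dvd2)+
  hence "g dvd fst z" "g dvd snd z" unfolding residue_class_def fst_conv snd_conv by (metis dvd_mod_iff)+
  hence "g dvd 1" using assms unfolding prim_def by (rule coprime_common_divisor[rotated])
  thus ?thesis by (simp add: g_def unit_class_def)
qed

lemma class_invariants:
  assumes "z \<in> prim_quad" "w \<in> prim_quad" "residue_class w = residue_class z"
  shows "content_perp w = content_perp z" "coeff_set w = coeff_set z"
  using residue_class_invariants[of z w] assms by (auto simp: prim_quad_def residue_class_residue)

text \<open>A witness that the finite family of classes is nonempty, on which the positivity of the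
  pole coefficient rests.\<close>

lemma prim_quad_e1: "(1, 0) \<in> prim_quad"
  using a_pos by (simp add: prim_quad_def prim_def quad_def)

definition data :: "((int \<times> int) \<times> (int \<times> int)) set" where
  "data = Sigma prim_quad coeff_set"

text \<open>Since \<open>u = x + y\<close> and \<open>v = x - y\<close>, the index
  \<open>\<bar>det2 x y\<bar>\<close> is half of \<open>det2 u v\<close>, and
  \<open>content_perp z * det2 z (perp z) = Q z\<close>. The quotient is formed in the reals;
  \<open>data_lattice_props\<close> identifies it with an index, hence with a natural
  number.\<close>

definition data_index :: "(int \<times> int) \<times> (int \<times> int) \<Rightarrow> real" where
  "data_index = (\<lambda>(z, w). of_int (fst w * snd w) * of_int (Q z) / (2 * of_int (content_perp z)))"

theorem data_series:
  shows "s > 1 \<Longrightarrow> (\<lambda>d. data_index d powr -s) summable_on data"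
    and "\<exists>c>0. ((\<lambda>s. (s - 1)\<^sup>2 * infsum (\<lambda>d. data_index d powr -s) data) \<longlongrightarrow> c) (at_right 1)"
proof -
  define C where "C = residue_class ` prim_quad"
  have finC: "finite C" unfolding C_def by (rule finite_classes)
  have "\<forall>cc\<in>C. \<exists>z. z \<in> prim_quad \<and> residue_class z = cc" by (auto simp: C_def)
  then obtain rep where rep: "\<And>cc. cc \<in> C \<Longrightarrow> rep cc \<in> prim_quad" "\<And>cc. cc \<in> C \<Longrightarrow> residue_class (rep cc) = cc"
    by (metis bchoice)
  have "\<forall>cc\<in>C. \<exists>\<sigma>. \<sigma> > 0 \<and> has_density (\<lambda>w. nat (fst w * snd w)) (coeff_set (rep cc)) \<sigma>"
    using coeff_set_density rep(1) by metis
  then obtain \<sigma> where sg: "\<And>cc. cc \<in> C \<Longrightarrow> \<sigma> cc > 0" "\<And>cc. cc \<in> C \<Longrightarrow> has_density (\<lambda>w. nat (fst w * snd w)) (coeff_set (rep cc)) (\<sigma> cc)"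
    by (metis bchoice)
  define X where "X = (\<lambda>cc. prim_quad \<inter> residue_points (2 * D) cc)"
  define E where "E = (\<lambda>cc. coeff_set (rep cc))"
  define e where "e = (\<lambda>cc. real_of_int (content_perp (rep cc)))"
  have e: "e cc > 0" if "cc \<in> C" for cc using content_perp_pos[OF rep(1)[OF that]] by (simp add: e_def)
  have Xc: "residue_class z = cc" if "z \<in> X cc" "cc \<in> C" for z cc
    using that rep(2)[OF that(2)] residue_class_residue[of z "rep cc"] residue_points_residue_class[of "rep cc"] by (simp add: X_def)
  \<comment> \<open>The coefficient set is constant on a class, so the dependent sum becomes a
    finite disjoint union of Cartesian products.\<close>
  have un: "data = (\<Union>cc\<in>C. X cc \<times> E cc)"
  proof (intro equalityI subsetI)
    fix d assume "d \<in> data"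
    then obtain z w where d: "d = (z, w)" "z \<in> prim_quad" "w \<in> coeff_set z" by (auto simp: data_def)
    have cc: "residue_class z \<in> C" using d by (simp add: C_def)
    have "coeff_set (rep (residue_class z)) = coeff_set z" by (rule class_invariants[OF d(2) rep(1)[OF cc] rep(2)[OF cc]])
    moreover have "z \<in> residue_points (2 * D) (residue_class z)" by (simp add: residue_points_def residue_class_def)
    ultimately show "d \<in> (\<Union>cc\<in>C. X cc \<times> E cc)" using cc d by (auto simp: X_def E_def)
  next
    fix d assume "d \<in> (\<Union>cc\<in>C. X cc \<times> E cc)"
    then obtain cc z w where d: "cc \<in> C" "d = (z, w)" "z \<in> X cc" "w \<in> E cc" by auto
    have "z \<in> prim_quad" using d by (simp add: X_def)
    moreover have "coeff_set (rep cc) = coeff_set z"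
      by (rule class_invariants[OF \<open>z \<in> prim_quad\<close> rep(1)[OF d(1)]]) (use rep(2) Xc d in simp)
    ultimately show "d \<in> data" using d by (auto simp: data_def E_def)
  qed
  have disj: "X cc \<times> E cc \<inter> X cc' \<times> E cc' = {}" if "cc \<in> C" "cc' \<in> C" "cc \<noteq> cc'" for cc cc'
    using Xc that by blast
  define P where "P = (\<lambda>cc s. prim_series (2 * D) cc s)"
  define S where "S = (\<lambda>cc s. infsum (\<lambda>w. real (nat (fst w * snd w)) powr -s) (E cc))"
  have hs: "((\<lambda>d. data_index d powr -s) has_sum ((2 * e cc) powr s * (P cc s * S cc s))) (X cc \<times> E cc)" if cc: "cc \<in> C" and s: "s > 1" for cc s
  proof -
    have "((\<lambda>(z, w). real (nat (Q z)) powr -s * real (nat (fst w * snd w)) powr -s) has_sum (P cc s * S cc s)) (X cc \<times> E cc)"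
      unfolding P_def S_def prim_series_def X_def
      by (rule has_sum_product_nonneg) (use prim_summable[OF s] has_density_summable[OF sg(2)[OF cc] s] in \<open>auto simp: E_def\<close>)
    hence 1: "((\<lambda>d. (2 * e cc) powr s * (\<lambda>(z, w). real (nat (Q z)) powr -s * real (nat (fst w * snd w)) powr -s) d) has_sum ((2 * e cc) powr s * (P cc s * S cc s))) (X cc \<times> E cc)"
      by (rule has_sum_cmult_right)
    have 2: "data_index d powr -s = (2 * e cc) powr s * (\<lambda>(z, w). real (nat (Q z)) powr -s * real (nat (fst w * snd w)) powr -s) d"
      if dd: "d \<in> X cc \<times> E cc" for d
    proof -
      obtain z w where d: "d = (z, w)" "z \<in> X cc" "w \<in> E cc" using dd by auto
      have zq: "z \<in> prim_quad" using d by (simp add: X_def)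
      have ce: "content_perp z = content_perp (rep cc)"
        by (rule class_invariants[OF rep(1)[OF cc] zq]) (use rep(2) Xc d cc in simp)
      have "fst w > 0" "snd w > 0" using d(3) by (auto simp: E_def coeff_set_def ratio_sector_def)
      hence pw: "fst w * snd w \<ge> 0" by simp
      have "data_index d = (real (nat (Q z)) * real (nat (fst w * snd w))) / (2 * e cc)"
        using Q_nonneg[of z] pw by (simp add: data_index_def d(1) ce e_def del: of_int_mult)
      also have "\<dots> powr -s = (real (nat (Q z)) * real (nat (fst w * snd w))) powr -s / (2 * e cc) powr -s"
        by (rule powr_divide)
      also have "\<dots> = (2 * e cc) powr s * (real (nat (Q z)) powr -s * real (nat (fst w * snd w)) powr -s)"
        by (simp add: powr_mult powr_minus_divide)
      finally show ?thesis by (simp add: d(1))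
    qed
    show ?thesis by (rule iffD2[OF has_sum_cong[OF 2] 1])
  qed
  have total: "((\<lambda>d. data_index d powr -s) has_sum (\<Sum>cc\<in>C. (2 * e cc) powr s * (P cc s * S cc s))) data" if "s > 1" for s
    unfolding un by (rule sum_has_sum[OF finC hs disj]) (use that in auto)
  show "s > 1 \<Longrightarrow> (\<lambda>d. data_index d powr -s) summable_on data" using total[of s] by (auto simp: summable_on_def)
  have D2: "2 * D > 0" using D_pos by simp
  obtain \<rho> where rho: "\<rho> > 0" "\<And>cc. unit_class (2 * D) cc \<Longrightarrow> ((\<lambda>s. (s - 1) * prim_series (2 * D) cc s) \<longlongrightarrow> \<rho>) (at_right 1)"
    using prim_series_residue[OF D2] by blast
  have Plim: "((\<lambda>s. (s - 1) * P cc s) \<longlongrightarrow> \<rho>) (at_right 1)" if "cc \<in> C" for cc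
    unfolding P_def by (rule rho(2)) (use that unit_residue_class in \<open>auto simp: C_def prim_quad_def\<close>)
  have Slim: "((\<lambda>s. (s - 1) * S cc s) \<longlongrightarrow> \<sigma> cc) (at_right 1)" if "cc \<in> C" for cc
    unfolding S_def E_def by (rule has_density_residue[OF sg(2)[OF that]])
  \<comment> \<open>The coefficient of the double pole; every summand is positive, so nothing can
    cancel between classes.\<close>
  define c where "c = (\<Sum>cc\<in>C. (2 * e cc) powr 1 * (\<rho> * \<sigma> cc))"
  have "C \<noteq> {}" using prim_quad_e1 by (auto simp: C_def)
  hence c: "c > 0" unfolding c_def using finC e sg(1) rho(1)
    by (intro sum_pos mult_pos_pos) (auto intro!: less_imp_neq[symmetric])
  have "((\<lambda>s. \<Sum>cc\<in>C. (2 * e cc) powr s * (((s - 1) * P cc s) * ((s - 1) * S cc s))) \<longlongrightarrow> c) (at_right 1)"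
    unfolding c_def
  proof (intro tendsto_sum tendsto_mult Plim Slim)
    fix cc assume "cc \<in> C"
    thus "((\<lambda>s. (2 * e cc) powr s) \<longlongrightarrow> (2 * e cc) powr 1) (at_right 1)"
      using e[of cc] by (intro tendsto_powr tendsto_const tendsto_ident_at) auto
  qed auto
  moreover have "\<forall>\<^sub>F s in at_right 1. (\<Sum>cc\<in>C. (2 * e cc) powr s * (((s - 1) * P cc s) * ((s - 1) * S cc s)))
      = (s - 1)\<^sup>2 * infsum (\<lambda>d. data_index d powr -s) data"
    using eventually_at_right_less[of "1::real"]
  proof eventually_elim
    case (elim s)
    have "infsum (\<lambda>d. data_index d powr -s) data = (\<Sum>cc\<in>C. (2 * e cc) powr s * (P cc s * S cc s))"
      using total[OF elim] by (rule infsumI)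
    thus ?case by (simp add: sum_distrib_left power2_eq_square mult_ac)
  qed
  ultimately have "((\<lambda>s. (s - 1)\<^sup>2 * infsum (\<lambda>d. data_index d powr -s) data) \<longlongrightarrow> c) (at_right 1)"
    by (rule Lim_transform_eventually)
  thus "\<exists>c>0. ((\<lambda>s. (s - 1)\<^sup>2 * infsum (\<lambda>d. data_index d powr -s) data) \<longlongrightarrow> c) (at_right 1)" using c by blast
qed

end

section \<open>Counting coefficient data\<close>


text \<open>Coordinates that are comparable and have product at most \<open>y\<close> are both at
  most \<open>sqrt (K * y)\<close>. Unlike a density this holds for every \<open>y\<close>, so it
  can be summed over \<open>z\<close> with one constant.\<close>

lemma card_bounded_ratio_le:
  fixes K :: int and y :: nat
  assumes "K \<ge> 1"
  defines "W \<equiv> {w :: int \<times> int. fst w > 0 \<and> snd w > 0 \<and> (fst w)\<^sup>2 \<le> K * (snd w)\<^sup>2 \<and> (snd w)\<^sup>2 \<le> K * (fst w)\<^sup>2 \<and> fst w * snd w \<le> int y}"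
  shows "finite W" "real (card W) \<le> of_int K * real y"
proof -
  define t where "t = \<lfloor>sqrt (of_int K * real y)\<rfloor>"
  have t: "t \<ge> 0" using assms(1) by (simp add: t_def)
  have sq: "\<alpha> \<le> t" if "\<alpha> > 0" "\<beta> > 0" "\<alpha>\<^sup>2 \<le> K * \<beta>\<^sup>2" "\<alpha> * \<beta> \<le> int y" for \<alpha> \<beta> :: int
  proof -
    have "(\<alpha>\<^sup>2)\<^sup>2 = \<alpha>\<^sup>2 * \<alpha>\<^sup>2" by (simp add: power2_eq_square)
    also have "\<dots> \<le> \<alpha>\<^sup>2 * (K * \<beta>\<^sup>2)" using that by (intro mult_left_mono) auto
    also have "\<dots> = K * (\<alpha> * \<beta>)\<^sup>2" by (simp add: power_mult_distrib)
    also have "\<dots> \<le> K * (int y)\<^sup>2" using that assms(1) by (intro mult_left_mono power_mono) auto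
    also have "\<dots> \<le> K\<^sup>2 * (int y)\<^sup>2" using assms(1) by (intro mult_right_mono) (auto simp: power2_eq_square)
    finally have "(\<alpha>\<^sup>2)\<^sup>2 \<le> (K * int y)\<^sup>2" by (simp add: power_mult_distrib)
    hence "\<alpha>\<^sup>2 \<le> K * int y" by (rule power2_le_imp_le) (use assms(1) in simp)
    hence "(of_int (\<alpha>\<^sup>2) :: real) \<le> of_int (K * int y)" by (subst of_int_le_iff)
    hence "(of_int \<alpha>)\<^sup>2 \<le> of_int K * real y" by simp
    hence "of_int \<alpha> \<le> sqrt (of_int K * real y)" by (rule real_le_rsqrt)
    thus ?thesis by (simp add: t_def le_floor_iff)
  qed
  have sub: "W \<subseteq> {1..t} \<times> {1..t}"
  proof (rule subrelI)
    fix \<alpha> \<beta> assume "(\<alpha>, \<beta>) \<in> W"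
    thus "(\<alpha>, \<beta>) \<in> {1..t} \<times> {1..t}" using sq[of \<alpha> \<beta>] sq[of \<beta> \<alpha>] by (auto simp: W_def mult.commute)
  qed
  show "finite W" by (rule finite_subset[OF sub]) auto
  have "real (card W) \<le> real (card ({1..t} \<times> {1..t}))" by (intro of_nat_mono card_mono sub) simp
  also have "\<dots> = of_int t * of_int t" using t by simp
  also have "\<dots> \<le> sqrt (of_int K * real y) * sqrt (of_int K * real y)"
    using t by (intro mult_mono) (auto simp: t_def)
  also have "\<dots> = of_int K * real y" using assms(1) by simp
  finally show "real (card W) \<le> of_int K * real y" .
qed

context binary_form
begin

lemma data_index_le_iff:
  assumes "(z, w) \<in> data"
  shows "data_index (z, w) \<le> real N \<longleftrightarrow> fst w * snd w * Q z \<le> 2 * content_perp z * int N"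
proof -
  have e: "content_perp z > 0" using assms content_perp_pos by (auto simp: data_def)
  have "data_index (z, w) \<le> real N \<longleftrightarrow> of_int (fst w * snd w) * of_int (Q z) \<le> real N * (2 * of_int (content_perp z))"
    using e by (simp add: data_index_def pos_divide_le_eq)
  also have "\<dots> \<longleftrightarrow> of_int (fst w * snd w * Q z) \<le> (of_int (2 * content_perp z * int N) :: real)" by (simp add: mult_ac)
  finally show ?thesis by (simp only: of_int_le_iff)
qed

lemma data_coords_pos:
  assumes "(z, w) \<in> data" shows "fst w > 0" "snd w > 0" "Q z > 0" "content_perp z > 0" "content_perp z \<le> D" "quad z"
proof -
  have z: "z \<in> prim_quad" "w \<in> coeff_set z" using assms by (auto simp: data_def)
  show "fst w > 0" "snd w > 0" using z(2) by (auto simp: coeff_set_def ratio_sector_def)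
  show q: "quad z" using z by (simp add: prim_quad_def)
  show "Q z > 0" using quad_nonzero[OF q] Q_pos by blast
  show "content_perp z > 0" by (rule content_perp_pos[OF z(1)])
  show "content_perp z \<le> D" using content_perp_le_D z by (simp add: prim_quad_def)
qed

lemma has_density_quad:
  obtains \<kappa> where "\<kappa> > 0" "has_density (\<lambda>z. nat (Q z)) {z. quad z} \<kappa>"
proof -
  obtain \<kappa> where k: "\<kappa> > 0" "\<And>m cc. m > 0 \<Longrightarrow> has_density (\<lambda>z. nat (Q z)) {z \<in> residue_points m cc. quad z} (\<kappa> / (of_int m)\<^sup>2)"
    using quad_density by blast
  show ?thesis using that k(1) k(2)[of 1 "(0,0)"] by (simp add: residue_points_def)
qed

text \<open>For fixed \<open>z\<close> there are \<open>O(N / Q z)\<close> admissible pairs, and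
  summing \<open>1 / Q z\<close> produces the logarithm. Enlarging the range of \<open>z\<close>
  from primitive vectors to all of \<open>quad\<close> reduces this sum to a region count.\<close>

lemma data_count_le:
  obtains C where "\<And>N. finite {d \<in> data. data_index d \<le> real N}"
    "\<And>N. N \<ge> 1 \<Longrightarrow> real (card {d \<in> data. data_index d \<le> real N}) \<le> C * (real N * ln (2 * of_int D * real N))"
proof -
  obtain \<kappa> where k: "\<kappa> > 0" "has_density (\<lambda>z. nat (Q z)) {z. quad z} \<kappa>" using has_density_quad by blast
  obtain C where C: "C > 0" "\<And>n. n \<ge> 2 \<Longrightarrow> (\<Sum>z | z \<in> {z. quad z} \<and> nat (Q z) \<le> n. 1 / real (nat (Q z))) \<le> C * ln (real n)"
    using has_density_sum_inverse_le[OF k(2)] by blast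
  \<comment> \<open>The factor \<open>3 * D\<close> covers the sectors of all contents from 1 to
    \<open>D\<close>, so one family \<open>W\<close> serves every \<open>z\<close>.\<close>
  define W where "W = (\<lambda>y. {w :: int \<times> int. fst w > 0 \<and> snd w > 0 \<and> (fst w)\<^sup>2 \<le> (3 * D) * (snd w)\<^sup>2 \<and> (snd w)\<^sup>2 \<le> (3 * D) * (fst w)\<^sup>2 \<and> fst w * snd w \<le> int y})"
  have W: "finite (W y)" "real (card (W y)) \<le> of_int (3 * D) * real y" for y
    using card_bounded_ratio_le[of "3 * D" y] D_pos by (auto simp: W_def)
  define X where "X = (\<lambda>N. nat (2 * D) * N)"
  define A where "A = (\<lambda>N. {z. quad z \<and> nat (Q z) \<le> X N})"
  have finA: "finite (A N)" for N using k(2) by (simp add: A_def has_density_def)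
  have sub: "{d \<in> data. data_index d \<le> real N} \<subseteq> Sigma (A N) (\<lambda>z. W (X N div nat (Q z)))" for N
  proof (rule subrelI)
    fix z w assume "(z, w) \<in> {d \<in> data. data_index d \<le> real N}"
    hence d: "(z, w) \<in> data" "data_index (z, w) \<le> real N" by auto
    note pos = data_coords_pos[OF d(1)]
    have "fst w * snd w * Q z \<le> 2 * content_perp z * int N" using d data_index_le_iff by blast
    also have "\<dots> \<le> 2 * D * int N" using pos by (intro mult_right_mono) auto
    finally have le: "fst w * snd w * Q z \<le> int (X N)" using D_pos by (simp add: X_def)
    have "0 < fst w * snd w" using pos by simp
    hence "1 * Q z \<le> fst w * snd w * Q z" using pos by (intro mult_right_mono) linarith+
    hence "Q z \<le> int (X N)" using le by linarith
    hence zA: "z \<in> A N" using pos by (simp add: A_def nat_le_iff)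
    have "fst w * snd w \<le> int (X N) div Q z" using zdiv_mono1[OF le, of "Q z"] pos by simp
    also have "\<dots> = int (X N div nat (Q z))" using pos by (simp add: zdiv_int)
    finally have wy: "fst w * snd w \<le> int (X N div nat (Q z))" .
    define e where "e = content_perp z"
    have r: "e\<^sup>2 * (fst w)\<^sup>2 < 3 * D * (snd w)\<^sup>2" "D * (snd w)\<^sup>2 < 3 * e\<^sup>2 * (fst w)\<^sup>2"
      using d(1) by (auto simp: data_def coeff_set_def ratio_sector_def e_def)
    have e: "1 \<le> e" "e \<le> D" using pos by (auto simp: e_def)
    have "1 * (fst w)\<^sup>2 \<le> e\<^sup>2 * (fst w)\<^sup>2" using e by (intro mult_right_mono) auto
    hence r1: "(fst w)\<^sup>2 \<le> (3 * D) * (snd w)\<^sup>2" using r(1) by linarith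
    have "3 * e\<^sup>2 * (fst w)\<^sup>2 \<le> 3 * D\<^sup>2 * (fst w)\<^sup>2" using e by (intro mult_right_mono mult_left_mono power_mono) auto
    hence "D * (snd w)\<^sup>2 \<le> D * ((3 * D) * (fst w)\<^sup>2)" using r(2) by (simp add: power2_eq_square mult_ac)
    hence r2: "(snd w)\<^sup>2 \<le> (3 * D) * (fst w)\<^sup>2" using D_pos by (simp only: mult_le_cancel_left_pos)
    have "w \<in> W (X N div nat (Q z))" using pos r1 r2 wy by (simp add: W_def)
    thus "(z, w) \<in> Sigma (A N) (\<lambda>z. W (X N div nat (Q z)))" using zA by simp
  qed
  have finS: "finite (Sigma (A N) (\<lambda>z. W (X N div nat (Q z))))" for N using finA W by auto
  have 1: "finite {d \<in> data. data_index d \<le> real N}" for N by (rule finite_subset[OF sub finS])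
  define C' where "C' = of_int (3 * D) * of_int (2 * D) * C"
  have 2: "real (card {d \<in> data. data_index d \<le> real N}) \<le> C' * (real N * ln (2 * of_int D * real N))" if N: "N \<ge> 1" for N
  proof -
    have X2: "X N \<ge> 2"
    proof -
      have "nat (2 * D) \<ge> 2" using D_pos by linarith
      thus ?thesis using mult_le_mono[of 2 "nat (2 * D)" 1 N] N by (simp add: X_def)
    qed
    have Xr: "real (X N) = of_int (2 * D) * real N" using D_pos by (simp add: X_def)
    have "real (card {d \<in> data. data_index d \<le> real N}) \<le> real (card (Sigma (A N) (\<lambda>z. W (X N div nat (Q z)))))"
      using card_mono[OF finS sub] by simp
    also have "\<dots> = (\<Sum>z\<in>A N. real (card (W (X N div nat (Q z)))))" using finA W by simp
    also have "\<dots> \<le> (\<Sum>z\<in>A N. of_int (3 * D) * (real (X N) * (1 / real (nat (Q z)))))"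
    proof (rule sum_mono)
      fix z assume "z \<in> A N"
      have "real (card (W (X N div nat (Q z)))) \<le> of_int (3 * D) * real (X N div nat (Q z))" by (rule W)
      also have "\<dots> \<le> of_int (3 * D) * (real (X N) / real (nat (Q z)))"
        using D_pos by (intro mult_left_mono of_nat_div_le_of_nat) auto
      finally show "real (card (W (X N div nat (Q z)))) \<le> of_int (3 * D) * (real (X N) * (1 / real (nat (Q z))))" by simp
    qed
    also have "\<dots> = of_int (3 * D) * (real (X N) * (\<Sum>z\<in>A N. 1 / real (nat (Q z))))"
      by (simp only: sum_distrib_left)
    also have "\<dots> \<le> of_int (3 * D) * (real (X N) * (C * ln (real (X N))))"
      using C(2)[OF X2] D_pos by (intro mult_left_mono) (auto simp: A_def)
    also have "\<dots> = C' * (real N * ln (2 * of_int D * real N))" unfolding Xr by (simp add: C'_def)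
    finally show ?thesis .
  qed
  show ?thesis by (rule that[OF 1 2])
qed

text \<open>The multiples of a primitive vector contribute at most \<open>pi\<^sup>2 / 6\<close>
  times its own term. This carries the logarithmic lower bound from all vectors over to the
  primitive ones.\<close>

lemma prim_sum_inverse_ge:
  "(\<Sum>z | quad z \<and> nat (Q z) \<le> n. 1 / real (nat (Q z))) \<le> pi\<^sup>2 / 6 * (\<Sum>z | z \<in> prim_quad \<and> nat (Q z) \<le> n. 1 / real (nat (Q z)))"
proof -
  obtain \<kappa> where k: "\<kappa> > 0" "has_density (\<lambda>z. nat (Q z)) {z. quad z} \<kappa>" using has_density_quad by blast
  define A where "A = {z. quad z \<and> nat (Q z) \<le> n}"
  define P where "P = {z. z \<in> prim_quad \<and> nat (Q z) \<le> n}"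
  have finA: "finite A" using k(2) by (simp add: A_def has_density_def)
  have finP: "finite P" by (rule finite_subset[OF _ finA]) (auto simp: P_def A_def prim_quad_def)
  define g where "g = (\<lambda>(k, z). scale (int (Suc k)) z)"
  define f where "f = (\<lambda>z. 1 / real (nat (Q z)))"
  have sub: "A \<subseteq> g ` ({..<n} \<times> P)"
  proof
    fix z assume z: "z \<in> A"
    have q: "quad z" "Q z \<le> int n" using z by (auto simp: A_def nat_le_iff)
    obtain d w where d: "d > 0" "prim w" "z = scale d w" using ex_scale_prim[OF quad_nonzero[OF q(1)]] by blast
    have wq: "quad w" using q(1) d by (simp add: quad_scale)
    have Qw: "Q w \<ge> 1" using Q_pos[OF quad_nonzero[OF wq]] by simp
    have dd: "d\<^sup>2 * Q w \<le> int n" using q(2) d by (simp add: Q_scale)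
    have "1 * Q w \<le> d\<^sup>2 * Q w" using d Qw by (intro mult_right_mono) auto
    hence "Q w \<le> int n" using dd by linarith
    hence wP: "w \<in> P" using wq d by (simp add: P_def prim_quad_def nat_le_iff)
    have "d \<le> d\<^sup>2" using d by (simp add: power2_eq_square)
    also have "d\<^sup>2 \<le> d\<^sup>2 * Q w" using Qw by (simp add: mult_le_cancel_left1)
    finally have "d \<le> int n" using dd by linarith
    hence "(nat d - 1, w) \<in> {..<n} \<times> P" using wP d by auto
    moreover have "z = g (nat d - 1, w)" using d by (simp add: g_def)
    ultimately show "z \<in> g ` ({..<n} \<times> P)" by blast
  qed
  have "(\<Sum>z\<in>A. f z) \<le> (\<Sum>z\<in>g ` ({..<n} \<times> P). f z)"
    by (rule sum_mono2[OF _ sub]) (use finP in \<open>auto simp: f_def\<close>)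
  also have "\<dots> \<le> (\<Sum>x\<in>{..<n} \<times> P. (f \<circ> g) x)"
    by (rule sum_image_le) (use finP in \<open>auto simp: f_def\<close>)
  also have "\<dots> = (\<Sum>(k, z)\<in>{..<n} \<times> P. 1 / (1 + real k)\<^sup>2 * f z)"
  proof (rule sum.cong[OF refl], clarify)
    fix k u v
    have "real (nat (Q (scale (int (Suc k)) (u, v)))) = (1 + real k)\<^sup>2 * real (nat (Q (u, v)))"
      using Q_nonneg[of "(u, v)"] by (simp add: Q_scale nat_mult_distrib nat_power_eq)
    thus "(f \<circ> g) (k, (u, v)) = 1 / (1 + real k)\<^sup>2 * f (u, v)" by (simp add: f_def g_def del: of_nat_Suc)
  qed
  also have "\<dots> = (\<Sum>k<n. 1 / (1 + real k)\<^sup>2) * (\<Sum>z\<in>P. f z)"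
    by (simp only: sum.cartesian_product[symmetric] sum_product)
  also have "\<dots> \<le> pi\<^sup>2 / 6 * (\<Sum>z\<in>P. f z)"
  proof (rule mult_right_mono)
    have "(\<Sum>k<n. 1 / (1 + real k)\<^sup>2) \<le> (\<Sum>k. 1 / (1 + real k)\<^sup>2)"
      using sums_summable[OF inverse_squares_sums] by (intro sum_le_suminf) (auto simp: add_ac)
    also have "\<dots> = pi\<^sup>2 / 6" using sums_unique[OF inverse_squares_sums] by (simp add: add_ac)
    finally show "(\<Sum>k<n. 1 / (1 + real k)\<^sup>2) \<le> pi\<^sup>2 / 6" .
    show "0 \<le> (\<Sum>z\<in>P. f z)" by (intro sum_nonneg) (auto simp: f_def)
  qed
  finally show ?thesis by (simp add: A_def P_def f_def)
qed

text \<open>A density bounds the count from below only past a threshold depending on the set.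
  Finitely many coefficient sets occur, so one constant and one threshold serve all
  \<open>z\<close>.\<close>

lemma coeff_set_count_ge:
  obtains \<gamma> n0 where "\<gamma> > 0" "n0 \<ge> 1"
    "\<And>z n. z \<in> prim_quad \<Longrightarrow> n \<ge> n0 \<Longrightarrow> \<gamma> * real n \<le> real (card {w \<in> coeff_set z. nat (fst w * snd w) \<le> n})"
proof -
  define F where "F = coeff_set ` prim_quad"
  have finF: "finite F"
  proof -
    have "\<exists>rep. \<forall>cc\<in>residue_class ` prim_quad. rep cc \<in> prim_quad \<and> residue_class (rep cc) = cc"
      by (rule bchoice) auto
    then obtain rep where rep: "\<And>cc. cc \<in> residue_class ` prim_quad \<Longrightarrow> rep cc \<in> prim_quad \<and> residue_class (rep cc) = cc"
      by blast
    have "F \<subseteq> (\<lambda>cc. coeff_set (rep cc)) ` (residue_class ` prim_quad)"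
    proof
      fix E assume "E \<in> F"
      then obtain z where z: "z \<in> prim_quad" "E = coeff_set z" by (auto simp: F_def)
      have "coeff_set (rep (residue_class z)) = coeff_set z"
        by (rule class_invariants(2)[OF z(1)]) (use rep z in auto)
      thus "E \<in> (\<lambda>cc. coeff_set (rep cc)) ` (residue_class ` prim_quad)" using z by auto
    qed
    thus ?thesis using finite_classes by (meson finite_imageI finite_subset)
  qed
  have "\<forall>E\<in>F. \<exists>cn. fst cn > 0 \<and> (\<forall>n\<ge>snd cn. fst cn * real n \<le> real (card {w \<in> E. nat (fst w * snd w) \<le> n}))"
  proof
    fix E assume "E \<in> F"
    then obtain z where z: "z \<in> prim_quad" "E = coeff_set z" by (auto simp: F_def)
    obtain \<sigma> where s: "\<sigma> > 0" "has_density (\<lambda>w. nat (fst w * snd w)) E \<sigma>" using coeff_set_density[OF z(1)] z(2) by blast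
    have "\<sigma> / 2 < \<sigma>" using s by simp
    then obtain n0 where "\<And>n. n \<ge> n0 \<Longrightarrow> \<sigma> / 2 * real n \<le> real (card {w \<in> E. nat (fst w * snd w) \<le> n})"
      using has_density_count_ge[OF s(2)] by blast
    thus "\<exists>cn. fst cn > 0 \<and> (\<forall>n\<ge>snd cn. fst cn * real n \<le> real (card {w \<in> E. nat (fst w * snd w) \<le> n}))"
      using s(1) by (intro exI[of _ "(\<sigma> / 2, n0)"]) auto
  qed
  from bchoice[OF this] obtain cn where cn: "\<And>E. E \<in> F \<Longrightarrow> fst (cn E) > 0"
    "\<And>E n. E \<in> F \<Longrightarrow> n \<ge> snd (cn E) \<Longrightarrow> fst (cn E) * real n \<le> real (card {w \<in> E. nat (fst w * snd w) \<le> n})" by blast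
  define c where "c = Min ((fst \<circ> cn) ` F)"
  \<comment> \<open>The sum of the thresholds bounds each of them, and \<open>Suc\<close> makes
    \<open>n0\<close> positive, as it becomes a divisor later.\<close>
  define n0 where "n0 = Suc (\<Sum>E\<in>F. snd (cn E))"
  have ne: "F \<noteq> {}" using prim_quad_e1 by (auto simp: F_def)
  have "c \<in> (fst \<circ> cn) ` F" unfolding c_def using finF ne by (intro Min_in) auto
  hence c0: "c > 0" using cn(1) by auto
  show ?thesis
  proof (rule that[OF c0, of n0])
    show "n0 \<ge> 1" by (simp add: n0_def)
    fix z n assume z: "z \<in> prim_quad" and n: "n \<ge> n0"
    define E where "E = coeff_set z"
    have E: "E \<in> F" using z by (auto simp: F_def E_def)
    have "snd (cn E) \<le> (\<Sum>E\<in>F. snd (cn E))" using finF E by (intro member_le_sum) auto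
    hence nn: "n \<ge> snd (cn E)" using n by (simp add: n0_def)
    have "c \<le> fst (cn E)" unfolding c_def using finF E by (intro Min_le) auto
    hence "c * real n \<le> fst (cn E) * real n" by (intro mult_right_mono) auto
    also have "\<dots> \<le> real (card {w \<in> E. nat (fst w * snd w) \<le> n})" by (rule cn(2)[OF E nn])
    finally show "c * real n \<le> real (card {w \<in> coeff_set z. nat (fst w * snd w) \<le> n})" by (simp add: E_def)
  qed
qed

text \<open>Only \<open>z\<close> with \<open>Q z \<le> N / n0\<close> are used, so that
  \<open>2 * N / Q z\<close> is past the uniform threshold; this merely divides the argument of the
  logarithm by a constant.\<close>

lemma data_count_ge:
  obtains \<gamma> k n1 where "\<gamma> > 0" "k > 0"
    "\<And>N. N \<ge> n1 \<Longrightarrow> \<gamma> * (real N * ln (real N / k)) \<le> real (card {d \<in> data. data_index d \<le> real N})"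
proof -
  obtain c n0 where c: "c > 0" "n0 \<ge> 1"
    "\<And>z n. z \<in> prim_quad \<Longrightarrow> n \<ge> n0 \<Longrightarrow> c * real n \<le> real (card {w \<in> coeff_set z. nat (fst w * snd w) \<le> n})"
    using coeff_set_count_ge by blast
  obtain \<kappa> where k: "\<kappa> > 0" "has_density (\<lambda>z. nat (Q z)) {z. quad z} \<kappa>" using has_density_quad by blast
  obtain c' n1 where c': "c' > 0" "\<And>n. n \<ge> n1 \<Longrightarrow> c' * ln (real n) \<le> (\<Sum>z | z \<in> {z. quad z} \<and> nat (Q z) \<le> n. 1 / real (nat (Q z)))"
    using has_density_sum_inverse_ge[OF k(2,1)] by blast
  have finD: "finite {d \<in> data. data_index d \<le> real N}" for N using data_count_le by blast
  define C where "C = c * (c' / (pi\<^sup>2 / 6))"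
  have pi: "pi\<^sup>2 / 6 > 0" by simp
  have C0: "C > 0" using c c' pi by (simp add: C_def)
  have main: "C * (real N * ln (real N / (2 * real n0))) \<le> real (card {d \<in> data. data_index d \<le> real N})"
    if N: "N \<ge> n0 * (n1 + 1)" for N
  proof -
    define Y where "Y = N div n0"
    have Y: "Y \<ge> n1 + 1" using N c(2) by (simp add: Y_def less_eq_div_iff_mult_less_eq mult.commute)
    have YN: "Y * n0 \<le> N" by (simp add: Y_def)
    have Yge: "real N / (2 * real n0) \<le> real Y"
    proof -
      have "N < (Y + 1) * n0" using c(2) by (simp add: Y_def dividend_less_div_times)
      also have "\<dots> \<le> (2 * Y) * n0" using Y by (intro mult_right_mono) auto
      finally have "real N \<le> real (2 * Y * n0)" by (subst of_nat_le_iff) simp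
      thus ?thesis using c(2) by (simp add: field_simps)
    qed
    define P where "P = {z. z \<in> prim_quad \<and> nat (Q z) \<le> Y}"
    \<comment> \<open>The bound \<open>2 * N\<close> rests on \<open>content_perp z \<ge> 1\<close>
      and is therefore sufficient for an index of at most \<open>N\<close>.\<close>
    define E where "E = (\<lambda>z. {w \<in> coeff_set z. nat (fst w * snd w) \<le> 2 * N div nat (Q z)})"
    have sub: "Sigma P E \<subseteq> {d \<in> data. data_index d \<le> real N}"
    proof (rule subrelI)
      fix z w assume zw: "(z, w) \<in> Sigma P E"
      hence d: "(z, w) \<in> data" by (auto simp: P_def E_def data_def)
      note pos = data_coords_pos[OF d]
      have "nat (fst w * snd w) \<le> 2 * N div nat (Q z)" using zw by (simp add: E_def)
      hence "nat (fst w * snd w) * nat (Q z) \<le> 2 * N div nat (Q z) * nat (Q z)" by (rule mult_le_mono1)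
      also have "\<dots> \<le> 2 * N" by simp
      finally have "int (nat (fst w * snd w) * nat (Q z)) \<le> int (2 * N)" by (subst of_nat_le_iff)
      hence "fst w * snd w * Q z \<le> 2 * 1 * int N" using pos by simp
      also have "\<dots> \<le> 2 * content_perp z * int N" using pos by (intro mult_right_mono mult_left_mono) auto
      finally show "(z, w) \<in> {d \<in> data. data_index d \<le> real N}" using d data_index_le_iff[OF d] by simp
    qed
    have finS: "finite (Sigma P E)" by (rule finite_subset[OF sub finD])
    have finP: "finite P"
      by (rule finite_subset[of _ "{z \<in> {z. quad z}. nat (Q z) \<le> Y}"]) (use k(2) in \<open>auto simp: P_def prim_quad_def has_density_def\<close>)
    have finE: "finite (E z)" if "z \<in> P" for z
    proof (rule finite_subset)
      show "E z \<subseteq> snd ` Sigma P E" using that by force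
    qed (use finS in auto)
    have "ln (real N / (2 * real n0)) \<le> ln (real Y)"
      using Yge N c(2) by (subst ln_le_cancel_iff) (use Y in \<open>auto simp: \<open>n0 \<ge> 1\<close> intro!: divide_pos_pos\<close>)
    hence "c' * ln (real N / (2 * real n0)) \<le> c' * ln (real Y)" using c' by simp
    also have "\<dots> \<le> (\<Sum>z | quad z \<and> nat (Q z) \<le> Y. 1 / real (nat (Q z)))" using c'(2)[of Y] Y by simp
    also have "\<dots> \<le> pi\<^sup>2 / 6 * (\<Sum>z\<in>P. 1 / real (nat (Q z)))" using prim_sum_inverse_ge[of Y] by (simp add: P_def)
    finally have lnP: "c' / (pi\<^sup>2 / 6) * ln (real N / (2 * real n0)) \<le> (\<Sum>z\<in>P. 1 / real (nat (Q z)))"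
      using pi by (simp add: field_simps)
    have "C * (real N * ln (real N / (2 * real n0))) = c * real N * (c' / (pi\<^sup>2 / 6) * ln (real N / (2 * real n0)))"
      by (simp add: C_def)
    also have "\<dots> \<le> c * real N * (\<Sum>z\<in>P. 1 / real (nat (Q z)))" using lnP c(1) by (intro mult_left_mono) auto
    also have "\<dots> = (\<Sum>z\<in>P. c * (real N / real (nat (Q z))))" by (simp add: sum_distrib_left)
    also have "\<dots> \<le> (\<Sum>z\<in>P. real (card (E z)))"
    proof (rule sum_mono)
      fix z assume z: "z \<in> P"
      define q where "q = nat (Q z)"
      have zq: "z \<in> prim_quad" "q \<le> Y" using z by (auto simp: P_def q_def)
      have q0: "q > 0" using zq(1) Q_pos quad_nonzero by (auto simp: q_def prim_quad_def)
      have qN: "q * n0 \<le> N" using zq(2) YN by (meson le_trans mult_le_mono1)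
      have "q * 1 \<le> q * n0" using c(2) by (rule mult_le_mono2)
      hence qle: "q \<le> N" using qN by linarith
      have "n0 \<le> 2 * N div q" using qN q0 by (simp add: less_eq_div_iff_mult_less_eq mult.commute)
      from c(3)[OF zq(1) this] have 1: "c * real (2 * N div q) \<le> real (card (E z))" by (simp add: E_def q_def)
      \<comment> \<open>Rounding down loses less than 1, and \<open>N / q \<ge> 1\<close>, so the
        factor 2 leaves at least \<open>N / q\<close>.\<close>
      have "real N / real q \<le> real (2 * N div q)"
      proof -
        have "2 * N < (2 * N div q + 1) * q" using q0 by (simp add: dividend_less_div_times)
        hence "real (2 * N) \<le> real ((2 * N div q + 1) * q)" by (subst of_nat_le_iff) simp
        hence "2 * real N \<le> (real (2 * N div q) + 1) * real q" by (simp add: algebra_simps)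
        hence "2 * (real N / real q) \<le> real (2 * N div q) + 1" using q0 by (simp add: field_simps)
        moreover have "1 \<le> real N / real q" using qle q0 by simp
        ultimately show ?thesis by linarith
      qed
      hence "c * (real N / real q) \<le> c * real (2 * N div q)" using c(1) by (intro mult_left_mono) auto
      thus "c * (real N / real (nat (Q z))) \<le> real (card (E z))" using 1 by (simp add: q_def)
    qed
    also have "\<dots> = real (card (Sigma P E))" using finP finE by simp
    also have "\<dots> \<le> real (card {d \<in> data. data_index d \<le> real N})" using card_mono[OF finD sub] by simp
    finally show ?thesis .
  qed
  show ?thesis by (rule that[OF C0 _ main]) (use c(2) in auto)
qed

end

section \<open>Well-rounded sublattices\<close>


context lattice_form
begin

abbreviation idx :: "(real^2) set \<Rightarrow> nat" where
  "idx \<equiv> lattice_index (range (emb p r))"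

abbreviation WR :: "(real^2) set set" where
  "WR \<equiv> wr_sublattices (range (emb p r))"

definition data_lattice :: "(int \<times> int) \<times> (int \<times> int) \<Rightarrow> (real^2) set" where
  "data_lattice d = emb p r ` pair_lattice (coeff_pair d)"

lemma coeff_pair_data: "coeff_pair ` data = orth_pairs" "inj_on coeff_pair data"
  using coeff_pair_bij by (auto simp: bij_betw_def data_def)

lemma data_lattice_inj: "inj_on data_lattice data"
proof (rule inj_onI)
  fix d d' assume d: "d \<in> data" "d' \<in> data" "data_lattice d = data_lattice d'"
  have "pair_lattice (coeff_pair d) = pair_lattice (coeff_pair d')"
    using d(3) inj_image_eq_iff[OF inj_emb] by (simp add: data_lattice_def)
  moreover have "coeff_pair d \<in> orth_pairs" "coeff_pair d' \<in> orth_pairs"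
    unfolding coeff_pair_data(1)[symmetric] by (rule imageI[OF d(1)] imageI[OF d(2)])+
  ultimately have "coeff_pair d = coeff_pair d'" by (rule inj_onD[OF pair_lattice_inj])
  thus "d = d'" using inj_onD[OF coeff_pair_data(2)] d by blast
qed

lemma data_lattice_props:
  assumes "d \<in> data" shows "data_lattice d \<in> WR" "real (idx (data_lattice d)) = data_index d"
proof -
  obtain z w where d: "d = (z, w)" by (cases d)
  define u v where "u = scale (fst w) z" and "v = scale (snd w) (perp z)"
  have uv: "coeff_pair d = (u, v)" by (simp add: coeff_pair_def d u_def v_def)
  have op: "(u, v) \<in> orth_pairs" unfolding coeff_pair_data(1)[symmetric] uv[symmetric] by (rule imageI[OF assms])
  note red = orth_pair_reduced[OF op]
  have L: "data_lattice d = emb p r ` intlat (half_sum u v) (half_sum u (-v))"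
    by (simp add: data_lattice_def uv pair_lattice_def)
  show "data_lattice d \<in> WR" unfolding wr_sublattices_eq L using red(1) by blast
  define x y where "x = half_sum u v" and "y = half_sum u (-v)"
  have det: "det2 x y \<noteq> 0" "det2 u v = - 2 * det2 x y" using red(1,5) by (simp_all add: reduced_def x_def y_def)
  have "det2 u v > 0" using op by (simp add: orth_pairs_def)
  hence "2 * \<bar>det2 x y\<bar> = det2 u v" using det by linarith
  define i where "i = real (idx (data_lattice d))"
  have "2 * i = of_int (2 * \<bar>det2 x y\<bar>)"
    using lattice_index_eq[OF det(1)] by (simp add: i_def L x_def y_def)
  hence i2: "2 * i = of_int (det2 u v)" unfolding \<open>2 * \<bar>det2 x y\<bar> = det2 u v\<close> .
  have "i * (2 * of_int (content_perp z)) = of_int (content_perp z) * (2 * i)" by simp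
  also have "\<dots> = of_int (content_perp z * det2 u v)" unfolding i2 by simp
  also have "content_perp z * det2 u v = fst w * snd w * Q z"
    using coeff_pair_det[of z "fst w" "snd w"] by (simp add: u_def v_def)
  finally have "i * (2 * of_int (content_perp z)) = of_int (fst w * snd w) * of_int (Q z)" by simp
  moreover have "content_perp z > 0" using data_coords_pos(4) assms d by simp
  ultimately have "i = of_int (fst w * snd w) * of_int (Q z) / (2 * of_int (content_perp z))"
    by (subst nonzero_eq_divide_eq) auto
  thus "real (idx (data_lattice d)) = data_index d" by (simp add: data_index_def d i_def)
qed

text \<open>Taking the complement makes the splitting of \<open>WR\<close> immediate. That its
  members are hexagonal is derived below and yields the upper bounds that make this part
  negligible.\<close>

definition hex :: "(real^2) set set" where
  "hex = WR - data_lattice ` data"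

lemma hex_vector_exists:
  assumes "L \<in> hex" shows "\<exists>x y. hex_pair x y \<and> L = emb p r ` intlat x y"
proof -
  obtain x y where L: "L = emb p r ` intlat x y" "reduced x y" using assms unfolding hex_def wr_sublattices_eq by blast
  have "\<not> 2 * \<bar>B x y\<bar> < Q x"
  proof
    assume "2 * \<bar>B x y\<bar> < Q x"
    hence "intlat x y \<in> pair_lattice ` coeff_pair ` data"
      using reduced_strict_in_pair_lattice[OF L(2)] coeff_pair_data(1) by simp
    hence "L \<in> data_lattice ` data" unfolding L(1) data_lattice_def by blast
    thus False using assms by (simp add: hex_def)
  qed
  hence eq: "2 * \<bar>B x y\<bar> = Q x" "Q x = Q y" "x \<noteq> 0" using L(2) reduced_nonzero[OF L(2)] by (auto simp: reduced_def)
  show ?thesis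
  proof (cases "B x y \<ge> 0")
    case True
    thus ?thesis using eq L(1) unfolding hex_pair_def by (intro exI[of _ x] exI[of _ y]) auto
  next
    case False
    thus ?thesis using eq L(1) unfolding hex_pair_def by (intro exI[of _ x] exI[of _ "-y"]) auto
  qed
qed

text \<open>A choice of one minimal vector for each lattice is injective by
  \<open>hex_pair_unique\<close>; sums and counts over \<open>hex\<close> are thereby dominated by
  those over nonzero vectors.\<close>

lemma hex_vectors:
  obtains hv where "inj_on hv hex" "\<And>L. L \<in> hex \<Longrightarrow> hv L \<noteq> (0, 0)" "\<And>L. L \<in> hex \<Longrightarrow> Q (hv L) \<le> 2 * D * int (idx L)"
proof -
  obtain hv where hv: "\<And>L. L \<in> hex \<Longrightarrow> \<exists>y. hex_pair (hv L) y \<and> L = emb p r ` intlat (hv L) y"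
    using hex_vector_exists by metis
  have "inj_on hv hex"
  proof (rule inj_onI)
    fix L L' assume LL: "L \<in> hex" "L' \<in> hex" "hv L = hv L'"
    obtain y y' where y: "hex_pair (hv L) y" "L = emb p r ` intlat (hv L) y" "hex_pair (hv L') y'" "L' = emb p r ` intlat (hv L') y'"
      using hv LL by meson
    show "L = L'" using y hex_pair_unique[of "hv L" y y'] LL(3) by metis
  qed
  moreover have "hv L \<noteq> (0, 0)" "Q (hv L) \<le> 2 * D * int (idx L)" if L: "L \<in> hex" for L
  proof -
    obtain y where y: "hex_pair (hv L) y" "L = emb p r ` intlat (hv L) y" using hv[OF L] by blast
    show nz: "hv L \<noteq> (0, 0)" using y(1) by (auto simp: hex_pair_def zero_prod_def)
    have le: "Q (hv L) \<le> 2 * D * \<bar>det2 (hv L) y\<bar>" by (rule hex_pair_det[OF y(1)])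
    have "det2 (hv L) y \<noteq> 0" using le Q_pos[OF nz] by auto
    hence "idx L = nat \<bar>det2 (hv L) y\<bar>" by (subst y(2), rule lattice_index_eq)
    thus "Q (hv L) \<le> 2 * D * int (idx L)" using le by simp
  qed
  ultimately show ?thesis by (rule that)
qed

lemma WR_split: "WR = data_lattice ` data \<union> hex" "data_lattice ` data \<inter> hex = {}"
  using data_lattice_props(1) by (auto simp: hex_def)

text \<open>The dominating series over nonzero vectors has at most a simple pole, so one factor
  \<open>s - 1\<close> is left over and forces the limit 0.\<close>

lemma hex_series:
  shows "s > 1 \<Longrightarrow> (\<lambda>L. real (idx L) powr -s) summable_on hex"
    and "((\<lambda>s. (s - 1)\<^sup>2 * infsum (\<lambda>L. real (idx L) powr -s) hex) \<longlongrightarrow> 0) (at_right 1)"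
proof -
  obtain hv where hv: "inj_on hv hex" "\<And>L. L \<in> hex \<Longrightarrow> hv L \<noteq> (0, 0)" "\<And>L. L \<in> hex \<Longrightarrow> Q (hv L) \<le> 2 * D * int (idx L)"
    using hex_vectors by blast
  obtain \<kappa> where k: "has_density (\<lambda>z. nat (Q z)) {z. z \<noteq> (0,0)} \<kappa>" using form_density_nonzero by blast
  define g where "g = (\<lambda>s z. real (nat (Q z)) powr -s)"
  have gs: "g s summable_on {z. z \<noteq> (0,0)}" if "s > 1" for s
    unfolding g_def by (rule has_density_summable[OF k that])
  have sub: "hv ` hex \<subseteq> {z. z \<noteq> (0,0)}" using hv(2) by (intro image_subsetI CollectI)
  have le: "real (idx L) powr -s \<le> (2 * of_int D) powr s * g s (hv L)" if s: "s > 1" and L: "L \<in> hex" for s L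
  proof -
    have q: "Q (hv L) > 0" by (rule Q_pos[OF hv(2)[OF L]])
    have "(of_int (Q (hv L)) :: real) \<le> of_int (2 * D * int (idx L))" using hv(3)[OF L] by (subst of_int_le_iff)
    hence "real (nat (Q (hv L))) \<le> 2 * of_int D * real (idx L)" using q by simp
    hence "(2 * of_int D * real (idx L)) powr -s \<le> g s (hv L)"
      unfolding g_def using q s by (intro powr_mono2') auto
    hence "(2 * of_int D) powr s * (2 * of_int D * real (idx L)) powr -s \<le> (2 * of_int D) powr s * g s (hv L)"
      by (intro mult_left_mono) auto
    moreover have "d powr s * (d * x) powr -s = x powr -s" if "d > 0" for d x :: real
      using that by (simp add: powr_mult powr_minus)
    from this[of "2 * of_int D" "real (idx L)"]
    have "(2 * of_int D) powr s * (2 * of_int D * real (idx L)) powr -s = real (idx L) powr -s"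
      using D_pos by simp
    ultimately show ?thesis by simp
  qed
  have ghs: "(\<lambda>L. g s (hv L)) summable_on hex" if "s > 1" for s
    using summable_on_subset[OF gs[OF that] sub] summable_on_reindex[OF hv(1), of "g s"] by (simp add: o_def)
  have bs: "(\<lambda>L. (2 * of_int D) powr s * g s (hv L)) summable_on hex" if "s > 1" for s
    by (rule summable_on_cmult_right[OF ghs[OF that]])
  have hs: "(\<lambda>L. real (idx L) powr -s) summable_on hex" if s: "s > 1" for s
    by (rule summable_on_comparison_test[OF bs[OF s]]) (use le[OF s] in auto)
  thus "s > 1 \<Longrightarrow> (\<lambda>L. real (idx L) powr -s) summable_on hex" for s .
  have up: "infsum (\<lambda>L. real (idx L) powr -s) hex \<le> (2 * of_int D) powr s * infsum (g s) {z. z \<noteq> (0,0)}" if s: "s > 1" for s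
  proof -
    have "infsum (\<lambda>L. real (idx L) powr -s) hex \<le> infsum (\<lambda>L. (2 * of_int D) powr s * g s (hv L)) hex"
      by (rule infsum_mono[OF hs[OF s] bs[OF s] le[OF s]])
    also have "\<dots> = (2 * of_int D) powr s * infsum (\<lambda>L. g s (hv L)) hex"
      by (rule infsum_cmult_right) (use ghs[OF s] in auto)
    also have "infsum (\<lambda>L. g s (hv L)) hex = infsum (g s) (hv ` hex)"
      using infsum_reindex[OF hv(1), of "g s"] by (simp add: o_def)
    also have "\<dots> \<le> infsum (g s) {z. z \<noteq> (0,0)}"
      by (rule infsum_mono2[OF summable_on_subset[OF gs[OF s] sub] gs[OF s] sub]) (auto simp: g_def)
    finally show ?thesis by (simp add: mult_left_mono)
  qed
  show "((\<lambda>s. (s - 1)\<^sup>2 * infsum (\<lambda>L. real (idx L) powr -s) hex) \<longlongrightarrow> 0) (at_right 1)"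
  proof (rule tendsto_sandwich[of "\<lambda>_. 0" _ _ "\<lambda>s. (s - 1) * ((2 * of_int D) powr s * ((s - 1) * infsum (g s) {z. z \<noteq> (0,0)}))"])
    show "\<forall>\<^sub>F s in at_right 1. 0 \<le> (s - 1)\<^sup>2 * infsum (\<lambda>L. real (idx L) powr -s) hex"
      by (intro always_eventually allI mult_nonneg_nonneg infsum_nonneg) auto
    show "\<forall>\<^sub>F s in at_right 1. (s - 1)\<^sup>2 * infsum (\<lambda>L. real (idx L) powr -s) hex
        \<le> (s - 1) * ((2 * of_int D) powr s * ((s - 1) * infsum (g s) {z. z \<noteq> (0,0)}))"
      using eventually_at_right_less[of "1::real"]
    proof eventually_elim
      case (elim s)
      have "(s - 1)\<^sup>2 * infsum (\<lambda>L. real (idx L) powr -s) hex \<le> (s - 1)\<^sup>2 * ((2 * of_int D) powr s * infsum (g s) {z. z \<noteq> (0,0)})"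
        by (rule mult_left_mono[OF up[OF elim]]) simp
      thus ?case by (simp add: power2_eq_square mult_ac)
    qed
    have "((\<lambda>s. (s - 1) * ((2 * of_int D) powr s * ((s - 1) * infsum (g s) {z. z \<noteq> (0,0)}))) \<longlongrightarrow> (1 - 1) * ((2 * of_int D) powr 1 * \<kappa>)) (at_right 1)"
      unfolding g_def using D_pos
      by (intro tendsto_mult tendsto_diff tendsto_powr tendsto_const tendsto_ident_at has_density_residue[OF k]) auto
    thus "((\<lambda>s. (s - 1) * ((2 * of_int D) powr s * ((s - 1) * infsum (g s) {z. z \<noteq> (0,0)}))) \<longlongrightarrow> 0) (at_right 1)"
      by simp
  qed simp
qed

lemma WR_series:
  shows "s > 1 \<Longrightarrow> (\<lambda>L. real (idx L) powr -s) summable_on WR"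
    and "\<exists>\<gamma>>0. ((\<lambda>s. (s - 1)\<^sup>2 * infsum (\<lambda>L. real (idx L) powr -s) WR) \<longlongrightarrow> \<gamma>) (at_right 1)"
proof -
  have eq: "(\<lambda>d. real (idx (data_lattice d)) powr -s) summable_on data \<longleftrightarrow> (\<lambda>d. data_index d powr -s) summable_on data"
     "infsum (\<lambda>d. real (idx (data_lattice d)) powr -s) data = infsum (\<lambda>d. data_index d powr -s) data" for s
    using data_lattice_props(2) by (auto intro!: summable_on_cong infsum_cong)
  have ds: "(\<lambda>L. real (idx L) powr -s) summable_on data_lattice ` data" if "s > 1" for s
    using summable_on_reindex[OF data_lattice_inj, of "\<lambda>L. real (idx L) powr -s"] data_series(1)[OF that] eq(1)[of s] by (simp add: o_def)
  have di: "infsum (\<lambda>L. real (idx L) powr -s) (data_lattice ` data) = infsum (\<lambda>d. data_index d powr -s) data" for s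
    using infsum_reindex[OF data_lattice_inj, of "\<lambda>L. real (idx L) powr -s"] eq(2)[of s] by (simp add: o_def)
  show "s > 1 \<Longrightarrow> (\<lambda>L. real (idx L) powr -s) summable_on WR" for s
    by (subst WR_split(1)) (intro summable_on_Un_disjoint ds hex_series(1) WR_split(2))
  obtain \<gamma> where g: "\<gamma> > 0" "((\<lambda>s. (s - 1)\<^sup>2 * infsum (\<lambda>d. data_index d powr -s) data) \<longlongrightarrow> \<gamma>) (at_right 1)"
    using data_series(2) by blast
  have "((\<lambda>s. (s - 1)\<^sup>2 * infsum (\<lambda>d. data_index d powr -s) data + (s - 1)\<^sup>2 * infsum (\<lambda>L. real (idx L) powr -s) hex) \<longlongrightarrow> \<gamma> + 0) (at_right 1)"
    by (intro tendsto_add g hex_series(2))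
  moreover have "\<forall>\<^sub>F s in at_right 1. (s - 1)\<^sup>2 * infsum (\<lambda>d. data_index d powr -s) data + (s - 1)\<^sup>2 * infsum (\<lambda>L. real (idx L) powr -s) hex
      = (s - 1)\<^sup>2 * infsum (\<lambda>L. real (idx L) powr -s) WR"
    using eventually_at_right_less[of "1::real"]
  proof eventually_elim
    case (elim s)
    have "infsum (\<lambda>L. real (idx L) powr -s) WR = infsum (\<lambda>d. data_index d powr -s) data + infsum (\<lambda>L. real (idx L) powr -s) hex"
      unfolding di[symmetric] by (subst WR_split(1)) (intro infsum_Un_disjoint ds hex_series(1) WR_split(2) elim)
    thus ?case by (simp add: algebra_simps)
  qed
  ultimately have "((\<lambda>s. (s - 1)\<^sup>2 * infsum (\<lambda>L. real (idx L) powr -s) WR) \<longlongrightarrow> \<gamma> + 0) (at_right 1)"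
    by (rule Lim_transform_eventually)
  thus "\<exists>\<gamma>>0. ((\<lambda>s. (s - 1)\<^sup>2 * infsum (\<lambda>L. real (idx L) powr -s) WR) \<longlongrightarrow> \<gamma>) (at_right 1)" using g(1) by auto
qed

lemma hex_count_le:
  obtains K where "\<And>N. finite {L \<in> hex. idx L \<le> N}" "\<And>N. real (card {L \<in> hex. idx L \<le> N}) \<le> K * real N"
proof -
  obtain hv where hv: "inj_on hv hex" "\<And>L. L \<in> hex \<Longrightarrow> hv L \<noteq> (0, 0)" "\<And>L. L \<in> hex \<Longrightarrow> Q (hv L) \<le> 2 * D * int (idx L)"
    using hex_vectors by blast
  obtain \<kappa> where k: "has_density (\<lambda>z. nat (Q z)) {z. z \<noteq> (0,0)} \<kappa>" using form_density_nonzero by blast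
  obtain K where K: "K > 0" "\<And>n. real (card {z \<in> {z. z \<noteq> (0,0)}. nat (Q z) \<le> n}) \<le> K * real n"
    using has_density_count_le[OF k] by blast
  define X where "X = (\<lambda>N. nat (2 * D) * N)"
  have sub: "hv ` {L \<in> hex. idx L \<le> N} \<subseteq> {z \<in> {z. z \<noteq> (0,0)}. nat (Q z) \<le> X N}" for N
  proof
    fix z assume "z \<in> hv ` {L \<in> hex. idx L \<le> N}"
    then obtain L where L: "L \<in> hex" "idx L \<le> N" "z = hv L" by blast
    have "Q z \<le> 2 * D * int (idx L)" using hv(3)[OF L(1)] L(3) by simp
    also have "\<dots> \<le> 2 * D * int N" using L(2) D_pos by (intro mult_left_mono) auto
    finally have "nat (Q z) \<le> X N" using D_pos by (simp add: X_def nat_le_iff)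
    thus "z \<in> {z \<in> {z. z \<noteq> (0,0)}. nat (Q z) \<le> X N}" using hv(2)[OF L(1)] L(3) by simp
  qed
  have fin: "finite {z \<in> {z. z \<noteq> (0,0)}. nat (Q z) \<le> X N}" for N using k unfolding has_density_def by blast
  have inj: "inj_on hv {L \<in> hex. idx L \<le> N}" for N using hv(1) by (rule inj_on_subset) auto
  have f: "finite {L \<in> hex. idx L \<le> N}" for N
    using inj_on_finite[OF inj sub fin] .
  have "real (card {L \<in> hex. idx L \<le> N}) \<le> K * of_int (2 * D) * real N" for N
  proof -
    have "real (card {L \<in> hex. idx L \<le> N}) \<le> real (card {z \<in> {z. z \<noteq> (0,0)}. nat (Q z) \<le> X N})"
      using card_inj_on_le[OF inj sub fin] by (rule of_nat_mono)
    also have "\<dots> \<le> K * real (X N)" by (rule K)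
    also have "\<dots> = K * of_int (2 * D) * real N" using D_pos by (simp add: X_def)
    finally show ?thesis .
  qed
  thus ?thesis using f that by blast
qed

text \<open>The hexagonal part is \<open>O(N)\<close>, so the order is that of the count of
  \<open>data\<close>; constant factors inside the logarithms do not affect it.\<close>

lemma WR_count:
  "(\<lambda>N. real (card {L \<in> WR. idx L \<le> N})) \<in> \<Theta>(\<lambda>N. real N * ln (real N))"
proof (rule bigthetaI)
  define Cn where "Cn = (\<lambda>N. real (card {d \<in> data. data_index d \<le> real N}))"
  define Hn where "Hn = (\<lambda>N. real (card {L \<in> hex. idx L \<le> N}))"
  obtain C where C: "\<And>N. finite {d \<in> data. data_index d \<le> real N}"
    "\<And>N. N \<ge> 1 \<Longrightarrow> Cn N \<le> C * (real N * ln (2 * of_int D * real N))"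
    unfolding Cn_def using data_count_le by blast
  obtain K where K: "\<And>N. finite {L \<in> hex. idx L \<le> N}" "\<And>N. Hn N \<le> K * real N"
    unfolding Hn_def using hex_count_le by blast
  have im: "{L \<in> data_lattice ` data. idx L \<le> N} = data_lattice ` {d \<in> data. data_index d \<le> real N}" for N
  proof -
    have "idx (data_lattice d) \<le> N \<longleftrightarrow> data_index d \<le> real N" if "d \<in> data" for d
      using data_lattice_props(2)[OF that] by (metis of_nat_le_iff)
    thus ?thesis by auto
  qed
  have tot: "real (card {L \<in> WR. idx L \<le> N}) = Cn N + Hn N" for N
  proof -
    have "{L \<in> WR. idx L \<le> N} = data_lattice ` {d \<in> data. data_index d \<le> real N} \<union> {L \<in> hex. idx L \<le> N}"
      unfolding im[symmetric] WR_split(1) by auto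
    moreover have "data_lattice ` {d \<in> data. data_index d \<le> real N} \<inter> {L \<in> hex. idx L \<le> N} = {}"
      using WR_split(2) by auto
    moreover have "card (data_lattice ` {d \<in> data. data_index d \<le> real N}) = card {d \<in> data. data_index d \<le> real N}"
      by (rule card_image, rule inj_on_subset[OF data_lattice_inj]) auto
    ultimately show ?thesis using C(1) K(1) by (simp add: card_Un_disjoint Cn_def Hn_def)
  qed
  have D1: "(of_int D :: real) > 0" using D_pos by simp
  have "(\<lambda>N. real (card {L \<in> WR. idx L \<le> N})) \<in> O(\<lambda>N. C * (real N * ln (2 * of_int D * real N)) + K * real N)"
  proof (rule landau_o.big_mono, rule eventually_mono[OF eventually_ge_at_top[of 1]])
    fix N :: nat assume N: "N \<ge> 1"
    show "norm (real (card {L \<in> WR. idx L \<le> N})) \<le> norm (C * (real N * ln (2 * of_int D * real N)) + K * real N)"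
      using C(2)[OF N] K(2)[of N] tot[of N] by simp
  qed
  also have "(\<lambda>N. C * (real N * ln (2 * of_int D * real N)) + K * real N) \<in> O(\<lambda>N. real N * ln (real N))"
  proof (intro sum_in_bigo landau_o.big.cmult_in_iff')
    have "(\<lambda>N. real N * ln (2 * of_int D * real N)) \<in> O(\<lambda>N. real N * ln (real N))" using D1 by real_asymp
    thus "(\<lambda>N. C * (real N * ln (2 * of_int D * real N))) \<in> O(\<lambda>N. real N * ln (real N))" by (cases "C = 0") auto
    have "(\<lambda>N. real N) \<in> O(\<lambda>N. real N * ln (real N))" by real_asymp
    thus "(\<lambda>N. K * real N) \<in> O(\<lambda>N. real N * ln (real N))" by (cases "K = 0") auto
  qed
  finally show "(\<lambda>N. real (card {L \<in> WR. idx L \<le> N})) \<in> O(\<lambda>N. real N * ln (real N))" .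
  obtain \<gamma> k n1 where g: "\<gamma> > 0" "k > 0" "\<And>N. N \<ge> n1 \<Longrightarrow> \<gamma> * (real N * ln (real N / k)) \<le> Cn N"
    unfolding Cn_def using data_count_ge by blast
  have "(\<lambda>N. real N * ln (real N)) \<in> O(\<lambda>N. \<gamma> * (real N * ln (real N / k)))" using g(1,2) by real_asymp
  also have "(\<lambda>N. \<gamma> * (real N * ln (real N / k))) \<in> O(\<lambda>N. real (card {L \<in> WR. idx L \<le> N}))"
  proof (rule landau_o.big_mono)
    have "eventually (\<lambda>N. real N \<ge> k) sequentially" by real_asymp
    thus "\<forall>\<^sub>F N in sequentially. norm (\<gamma> * (real N * ln (real N / k))) \<le> norm (real (card {L \<in> WR. idx L \<le> N}))"
      using eventually_ge_at_top[of n1]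
    proof eventually_elim
      case (elim N)
      have "ln (real N / k) \<ge> 0" using elim(1) g(2) by simp
      hence "\<gamma> * (real N * ln (real N / k)) \<ge> 0" using g(1) by simp
      moreover have "Hn N \<ge> 0" by (simp add: Hn_def)
      ultimately show ?case using g(3)[OF elim(2)] tot[of N] by simp
    qed
  qed
  finally show "(\<lambda>N. real (card {L \<in> WR. idx L \<le> N})) \<in> \<Omega>(\<lambda>N. real N * ln (real N))" by (simp add: bigomega_iff_bigo)
qed

end

theorem theorem1p1:
  fixes M :: "(real^2) set"
  assumes "arithmetic_lattice M"
  shows "(\<forall>s::complex. Re s > 1 \<longrightarrow>
            (\<lambda>L. norm ((of_nat (lattice_index M L) :: complex) powr (- s))) summable_on wr_sublattices M)
    \<and> (\<exists>c::complex. c \<noteq> 0 \<and>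
            ((\<lambda>s::real. (of_real s - 1)\<^sup>2 * zeta_WR M (of_real s)) \<longlongrightarrow> c) (at_right 1))
    \<and> ((\<lambda>N::nat. real (card {L \<in> wr_sublattices M. lattice_index M L \<le> N}))
            \<in> \<Theta>(\<lambda>N. real N * ln (real N)))"
proof -
  obtain a b c p r lam where form: "lattice_form a b c p r lam" and M: "M = range (emb p r)"
    by (rule arithmetic_lattice_form[OF assms])
  interpret lattice_form a b c p r lam by (rule form)
  \<comment> \<open>The norm of a term depends only on \<open>Re s\<close>, which reduces the claim
    to the real series.\<close>
  have "(\<lambda>L. norm ((of_nat (lattice_index M L) :: complex) powr (- s))) summable_on wr_sublattices M" if "Re s > 1" for s
    using WR_series(1)[OF that] by (simp add: M norm_powr_real_powr)
  moreover have "\<exists>\<gamma>::complex. \<gamma> \<noteq> 0 \<and> ((\<lambda>s::real. (of_real s - 1)\<^sup>2 * zeta_WR M (of_real s)) \<longlongrightarrow> \<gamma>) (at_right 1)"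
  proof -
    obtain \<gamma> where g: "\<gamma> > 0" "((\<lambda>s. (s - 1)\<^sup>2 * infsum (\<lambda>L. real (idx L) powr -s) WR) \<longlongrightarrow> \<gamma>) (at_right 1)"
      using WR_series(2) by blast
    have "((\<lambda>s. complex_of_real ((s - 1)\<^sup>2 * infsum (\<lambda>L. real (idx L) powr -s) WR)) \<longlongrightarrow> of_real \<gamma>) (at_right 1)"
      by (rule tendsto_of_real[OF g(2)])
    moreover have "\<forall>\<^sub>F s in at_right 1. complex_of_real ((s - 1)\<^sup>2 * infsum (\<lambda>L. real (idx L) powr -s) WR) = (of_real s - 1)\<^sup>2 * zeta_WR M (of_real s)"
      using eventually_at_right_less[of "1::real"]
    proof eventually_elim
      case (elim s)
      \<comment> \<open>Real and complex \<open>powr\<close> agree on nonnegative bases and real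
        exponents, so the complex series at real \<open>s\<close> is the image of the real
        one.\<close>
      have pw: "complex_of_real (real n powr -s) = of_nat n powr (- of_real s)" for n
        using powr_of_real[of "real n" "-s"] by simp
      have "((\<lambda>L. complex_of_real (real (idx L) powr -s)) has_sum of_real (infsum (\<lambda>L. real (idx L) powr -s) WR)) WR"
        by (intro has_sum_of_real has_sum_infsum WR_series(1) elim)
      hence "zeta_WR M (of_real s) = of_real (infsum (\<lambda>L. real (idx L) powr -s) WR)"
        unfolding pw zeta_WR_def M by (rule infsumI)
      thus ?case by simp
    qed
    ultimately have "((\<lambda>s::real. (of_real s - 1)\<^sup>2 * zeta_WR M (of_real s)) \<longlongrightarrow> of_real \<gamma>) (at_right 1)"
      by (rule Lim_transform_eventually)
    thus ?thesis using g(1) by (intro exI[of _ "of_real \<gamma>"]) auto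
  qed
  moreover have "(\<lambda>N::nat. real (card {L \<in> wr_sublattices M. lattice_index M L \<le> N})) \<in> \<Theta>(\<lambda>N. real N * ln (real N))"
    unfolding M by (rule WR_count)
  ultimately show ?thesis by blast
qed

end
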